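(* Let $1/4<H<1$, $T>0$, let $b,\sigma$ satisfy the standing assumption (A) of the context, and let $\bar X$ solve $\bar X_t'=b_t(\bar X_t)$, $\bar X_0=x_0$ on $[0,T]$; set $x_T:=\bar X_T$. Suppose that $\nabla(\nabla\cdot b_t)(\bar X_t)=0$ for all $t\in[0,T]$ and that, for some $t_0\in(0,T)$, the matrix $\nabla^2(\nabla\cdot b_{t_0})(\bar X_{t_0})$ has a negative eigenvalue. Then there exists $\epsilon_*>0$ such that, for every $\epsilon>\epsilon_*$, the second variation of $J_\epsilon$ at $\bar X$ has a negative direction, i.e. there is an admissible perturbation $\eta$ with $\delta^2J_\epsilon(\bar X)[\eta,\eta]<0$. Consequently, for every $\epsilon>\epsilon_*$, $\bar X$ is neither a local most probable transition path (local minimizer of $J_\epsilon$ over $\mathcal H^{\sigma,T}_{H;x_0,x_T}$) nor a local most probable evolution path (local minimizer of $J_\epsilon$ over $x_0+\mathcal H_H^\sigma([0,T];\mathbb R^n)$).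
   Context: Standing assumption (A): $b\in C_b^{1,3}([0,T]\times\mathbb R^n;\mathbb R^n)$ (bounded, with bounded continuous derivatives up to order one in $t$ and order three in $x$); $\sigma_t=\operatorname{diag}(\sigma_t^1,\dots,\sigma_t^n)$ with $\sigma^i\in C^1([0,T])$ and $0<m_i\le\sigma_t^i\le M_i$. $\nabla,\nabla\cdot,\nabla^2$ act in the space variable. Kernel, for $0<s<t$: $K_H(t,s)=c_H\left[(t/s)^{H-\frac12}(t-s)^{H-\frac12}-(H-\frac12)s^{\frac12-H}\int_s^tu^{H-\frac32}(u-s)^{H-\frac12}du\right]$, $c_H=\sqrt{\frac{2H\Gamma(3/2-H)}{\Gamma(H+1/2)\Gamma(2-2H)}}$. For $u\in L^2([0,T];\mathbb R^n)$: $(K_Hu)(t)=\int_0^tK_H(t,s)u(s)ds$, $(K_H^\sigma u)(t)=\int_0^t\sigma_s\,d(K_Hu)(s)$ (Young integral). $K_H^\sigma$ is injective; $\mathcal H_H^\sigma([0,T];\mathbb R^n):=K_H^\sigma(L^2)$ with norm $\|h\|_{\mathcal H_H^\sigma}=\|(K_H^\sigma)^{-1}h\|_{L^2(0,T)}$. Local minimality is with respect to this norm. $d_H=\sqrt{2H\Gamma(H+\frac12)\Gamma(\frac32-H)/\Gamma(2-2H)}$. For $\phi\in x_0+\mathcal H_H^\sigma([0,T];\mathbb R^n)$, $$J_\epsilon(\phi)=\frac1{2\epsilon}\int_0^T\left|(K_H^\sigma)^{-1}\left(\phi_\cdot-x_0-\int_0^\cdot b_s(\phi_s)ds\right)(t)\right|^2dt+\frac{d_H}2\int_0^T\nabla\cdot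 b_t(\phi_t)\,dt .$$ $\mathcal H^{\sigma,T}_{H;x_0,x_T}=\{\phi\in x_0+\mathcal H_H^\sigma([0,T];\mathbb R^n):\phi_T=x_T\}$. Admissible perturbations are the elements of $\mathcal H_H^\sigma([0,T];\mathbb R^n)$ (free endpoint), respectively those with $\eta_T=0$ (fixed endpoint). The second variation is $$\delta^2J_\epsilon(\bar X)[\eta,\eta]=\frac1\epsilon\int_0^T\left|(K_H^\sigma)^{-1}\left(\eta_\cdot-\int_0^\cdot\nabla b_s(\bar X_s)\eta_s\,ds\right)(t)\right|^2dt+\frac{d_H}2\int_0^T\eta_t^T\nabla^2(\nabla\cdot b_t)(\bar X_t)\eta_t\,dt .$$ *)

theory Defs
  imports "HOL-Analysis.Analysis"
begin

section \<open>Differential operators in the space variable\<close>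

definition divergence :: "(real^'n \<Rightarrow> real^'n) \<Rightarrow> real^'n \<Rightarrow> real" where
  "divergence f x = trace (jacobian f (at x))"

definition gradient :: "(real^'n \<Rightarrow> real) \<Rightarrow> real^'n \<Rightarrow> real^'n" where
  "gradient g x = (\<chi> i. frechet_derivative g (at x) (axis i 1))"

definition hessian :: "(real^'n \<Rightarrow> real) \<Rightarrow> real^'n \<Rightarrow> real^'n^'n" where
  "hessian g x = jacobian (gradient g) (at x)"

definition is_eigenvalue :: "real^'n^'n \<Rightarrow> real \<Rightarrow> bool" where
  "is_eigenvalue A \<mu> \<longleftrightarrow> (\<exists>v. v \<noteq> 0 \<and> A *v v = \<mu> *\<^sub>R v)"


section \<open>Standing assumption on drift and diffusion coefficient\<close>

definition bounded_continuous_on_strip ::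
  "real \<Rightarrow> (real \<Rightarrow> real^'n \<Rightarrow> 'b::real_normed_vector) \<Rightarrow> bool" where
  "bounded_continuous_on_strip T F \<longleftrightarrow>
     continuous_on ({0..T} \<times> UNIV) (\<lambda>(t, x). F t x) \<and>
     bounded ((\<lambda>(t, x). F t x) ` ({0..T} \<times> UNIV))"

text \<open>
  Here \<open>bt\<close> is the time derivative (one-sided at \<open>0\<close> and \<open>T\<close>), and \<open>D1\<close>, \<open>D2\<close>, \<open>D3\<close> are the first
  three Frechet derivatives in space. No mixed time-space derivatives are required.
\<close>

definition C_b_1_3 :: "real \<Rightarrow> (real \<Rightarrow> real^'n \<Rightarrow> real^'n) \<Rightarrow> bool" where
  "C_b_1_3 T b \<longleftrightarrow>
     bounded_continuous_on_strip T b \<and>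
     (\<exists>bt :: real \<Rightarrow> real^'n \<Rightarrow> real^'n.
        bounded_continuous_on_strip T bt \<and>
        (\<forall>t\<in>{0..T}. \<forall>x. ((\<lambda>s. b s x) has_vector_derivative bt t x) (at t within {0..T}))) \<and>
     (\<exists>(D1 :: real \<Rightarrow> real^'n \<Rightarrow> (real^'n) \<Rightarrow>\<^sub>L (real^'n))
       (D2 :: real \<Rightarrow> real^'n \<Rightarrow> (real^'n) \<Rightarrow>\<^sub>L (real^'n) \<Rightarrow>\<^sub>L (real^'n))
       (D3 :: real \<Rightarrow> real^'n \<Rightarrow> (real^'n) \<Rightarrow>\<^sub>L (real^'n) \<Rightarrow>\<^sub>L (real^'n) \<Rightarrow>\<^sub>L (real^'n)).
        bounded_continuous_on_strip T D1 \<and>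
        bounded_continuous_on_strip T D2 \<and>
        bounded_continuous_on_strip T D3 \<and>
        (\<forall>t\<in>{0..T}. \<forall>x.
           (b t has_derivative blinfun_apply (D1 t x)) (at x) \<and>
           (D1 t has_derivative blinfun_apply (D2 t x)) (at x) \<and>
           (D2 t has_derivative blinfun_apply (D3 t x)) (at x)))"

definition C1_on_interval :: "real \<Rightarrow> (real \<Rightarrow> real) \<Rightarrow> bool" where
  "C1_on_interval T f \<longleftrightarrow>
     (\<exists>f'. continuous_on {0..T} f' \<and>
           (\<forall>t\<in>{0..T}. (f has_real_derivative f' t) (at t within {0..T})))"

definition assumption_A ::
  "real \<Rightarrow> (real \<Rightarrow> real^'n \<Rightarrow> real^'n) \<Rightarrow> (real \<Rightarrow> real^'n^'n) \<Rightarrow> bool" where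
  "assumption_A T b \<sigma> \<longleftrightarrow>
     C_b_1_3 T b \<and>
     (\<forall>t\<in>{0..T}. \<forall>i j. i \<noteq> j \<longrightarrow> \<sigma> t $ i $ j = 0) \<and>
     (\<forall>i. C1_on_interval T (\<lambda>t. \<sigma> t $ i $ i)) \<and>
     (\<forall>i. \<exists>m M. 0 < m \<and> (\<forall>t\<in>{0..T}. m \<le> \<sigma> t $ i $ i \<and> \<sigma> t $ i $ i \<le> M))"


section \<open>The operators \<open>K\<^sub>H\<close> and \<open>K\<^sub>H\<^sup>\<sigma>\<close>\<close>

definition c_H :: "real \<Rightarrow> real" where
  "c_H H = sqrt (2 * H * Gamma (3/2 - H) / (Gamma (H + 1/2) * Gamma (2 - 2 * H)))"

definition d_H :: "real \<Rightarrow> real" where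
  "d_H H = sqrt (2 * H * Gamma (H + 1/2) * Gamma (3/2 - H) / Gamma (2 - 2 * H))"

definition K_kernel :: "real \<Rightarrow> real \<Rightarrow> real \<Rightarrow> real" where
  "K_kernel H t s =
     c_H H * ((t / s) powr (H - 1/2) * (t - s) powr (H - 1/2)
              - (H - 1/2) * s powr (1/2 - H)
                * (LINT u:{s..t}|lebesgue. u powr (H - 3/2) * (u - s) powr (H - 1/2)))"

text \<open>
  Elements of \<open>L\<^sup>2([0,T];\<real>\<^sup>n)\<close> are represented by functions; functions that agree almost everywhere on
  \<open>[0,T]\<close> are not identified.
\<close>

definition L2 :: "real \<Rightarrow> (real \<Rightarrow> real^'n) set" where
  "L2 T = {u. set_borel_measurable lebesgue {0..T} u \<and>
              set_integrable lebesgue {0..T} (\<lambda>t. (norm (u t))\<^sup>2)}"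

definition L2_norm :: "real \<Rightarrow> (real \<Rightarrow> real^'n) \<Rightarrow> real" where
  "L2_norm T u = sqrt (LINT t:{0..T}|lebesgue. (norm (u t))\<^sup>2)"

definition K_op :: "real \<Rightarrow> (real \<Rightarrow> real^'n) \<Rightarrow> real \<Rightarrow> real^'n" where
  "K_op H u t = (LINT s:{0<..<t}|lebesgue. K_kernel H t s *\<^sub>R u s)"

text \<open>
  The Young integral \<open>\<integral>\<^sub>a\<^sup>b A\<^sub>s dg(s)\<close> is the limit of the Riemann--Stieltjes sums as the mesh tends to zero:
  the gauge in the definition has a constant radius, so that \<open>fine\<close> bounds the mesh of the tagged division.
\<close>

definition has_young_integral ::
  "(real \<Rightarrow> real^'n^'n) \<Rightarrow> (real \<Rightarrow> real^'n) \<Rightarrow> real \<Rightarrow> real \<Rightarrow> real^'n \<Rightarrow> bool" where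
  "has_young_integral A g a b I \<longleftrightarrow>
     (\<forall>e>0. \<exists>d>0. \<forall>\<D>. \<D> tagged_division_of {a..b} \<and> (\<lambda>x. ball x d) fine \<D> \<longrightarrow>
        norm ((\<Sum>(x, k)\<in>\<D>. A x *v (g (Sup k) - g (Inf k))) - I) < e)"

definition young_integral ::
  "(real \<Rightarrow> real^'n^'n) \<Rightarrow> (real \<Rightarrow> real^'n) \<Rightarrow> real \<Rightarrow> real \<Rightarrow> real^'n" where
  "young_integral A g a b = (THE I. has_young_integral A g a b I)"

definition K_sigma :: "real \<Rightarrow> (real \<Rightarrow> real^'n^'n) \<Rightarrow> (real \<Rightarrow> real^'n) \<Rightarrow> real \<Rightarrow> real^'n" where
  "K_sigma H \<sigma> u t = young_integral \<sigma> (K_op H u) 0 t"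


section \<open>The Cameron--Martin space and path spaces\<close>

text \<open>
  Paths are total functions of which only the restriction to \<open>[0,T]\<close> matters: membership below and all
  functionals depend on nothing else.
\<close>

definition H_space :: "real \<Rightarrow> (real \<Rightarrow> real^'n^'n) \<Rightarrow> real \<Rightarrow> (real \<Rightarrow> real^'n) set" where
  "H_space H \<sigma> T = {h. \<exists>u\<in>L2 T. \<forall>t\<in>{0..T}. h t = K_sigma H \<sigma> u t}"

text \<open>
  The inverse selects a representative of the preimage, which is unique up to null sets because
  \<open>K\<^sub>H\<^sup>\<sigma>\<close> is injective on \<open>L\<^sup>2\<close>. It is meaningful on \<open>H_space H \<sigma> T\<close> only.
\<close>

definition K_sigma_inv ::
  "real \<Rightarrow> (real \<Rightarrow> real^'n^'n) \<Rightarrow> real \<Rightarrow> (real \<Rightarrow> real^'n) \<Rightarrow> real \<Rightarrow> real^'n" where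
  "K_sigma_inv H \<sigma> T h = (SOME u. u \<in> L2 T \<and> (\<forall>t\<in>{0..T}. K_sigma H \<sigma> u t = h t))"

definition H_norm :: "real \<Rightarrow> (real \<Rightarrow> real^'n^'n) \<Rightarrow> real \<Rightarrow> (real \<Rightarrow> real^'n) \<Rightarrow> real" where
  "H_norm H \<sigma> T h = L2_norm T (K_sigma_inv H \<sigma> T h)"

definition free_paths ::
  "real \<Rightarrow> (real \<Rightarrow> real^'n^'n) \<Rightarrow> real \<Rightarrow> real^'n \<Rightarrow> (real \<Rightarrow> real^'n) set" where
  "free_paths H \<sigma> T x0 = {\<phi>. (\<lambda>t. \<phi> t - x0) \<in> H_space H \<sigma> T}"

definition fixed_paths ::
  "real \<Rightarrow> (real \<Rightarrow> real^'n^'n) \<Rightarrow> real \<Rightarrow> real^'n \<Rightarrow> real^'n \<Rightarrow> (real \<Rightarrow> real^'n) set" where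
  "fixed_paths H \<sigma> T x0 xT = {\<phi> \<in> free_paths H \<sigma> T x0. \<phi> T = xT}"

definition free_perturbations ::
  "real \<Rightarrow> (real \<Rightarrow> real^'n^'n) \<Rightarrow> real \<Rightarrow> (real \<Rightarrow> real^'n) set" where
  "free_perturbations H \<sigma> T = H_space H \<sigma> T"

definition fixed_perturbations ::
  "real \<Rightarrow> (real \<Rightarrow> real^'n^'n) \<Rightarrow> real \<Rightarrow> (real \<Rightarrow> real^'n) set" where
  "fixed_perturbations H \<sigma> T = {\<eta> \<in> H_space H \<sigma> T. \<eta> T = 0}"


section \<open>The functional, its second variation, and local minimizers\<close>

definition J_fun ::
  "real \<Rightarrow> (real \<Rightarrow> real^'n^'n) \<Rightarrow> real \<Rightarrow> (real \<Rightarrow> real^'n \<Rightarrow> real^'n) \<Rightarrow> real^'n \<Rightarrow> real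
     \<Rightarrow> (real \<Rightarrow> real^'n) \<Rightarrow> real" where
  "J_fun H \<sigma> T b x0 \<epsilon> \<phi> =
     1 / (2 * \<epsilon>) *
       (LINT t:{0..T}|lebesgue.
          (norm (K_sigma_inv H \<sigma> T
                   (\<lambda>r. \<phi> r - x0 - (LINT s:{0..r}|lebesgue. b s (\<phi> s))) t))\<^sup>2)
     + d_H H / 2 * (LINT t:{0..T}|lebesgue. divergence (b t) (\<phi> t))"

definition second_variation ::
  "real \<Rightarrow> (real \<Rightarrow> real^'n^'n) \<Rightarrow> real \<Rightarrow> (real \<Rightarrow> real^'n \<Rightarrow> real^'n) \<Rightarrow> real
     \<Rightarrow> (real \<Rightarrow> real^'n) \<Rightarrow> (real \<Rightarrow> real^'n) \<Rightarrow> real" where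
  "second_variation H \<sigma> T b \<epsilon> X \<eta> =
     1 / \<epsilon> *
       (LINT t:{0..T}|lebesgue.
          (norm (K_sigma_inv H \<sigma> T
                   (\<lambda>r. \<eta> r - (LINT s:{0..r}|lebesgue. jacobian (b s) (at (X s)) *v \<eta> s)) t))\<^sup>2)
     + d_H H / 2 *
       (LINT t:{0..T}|lebesgue. \<eta> t \<bullet> (hessian (divergence (b t)) (X t) *v \<eta> t))"

definition local_minimizer ::
  "((real \<Rightarrow> real^'n) \<Rightarrow> real) \<Rightarrow> (real \<Rightarrow> real^'n) set \<Rightarrow> ((real \<Rightarrow> real^'n) \<Rightarrow> real)
     \<Rightarrow> (real \<Rightarrow> real^'n) \<Rightarrow> bool" where
  "local_minimizer N S F X \<longleftrightarrow>
     X \<in> S \<and> (\<exists>\<delta>>0. \<forall>\<phi>\<in>S. N (\<lambda>t. \<phi> t - X t) < \<delta> \<longrightarrow> F X \<le> F \<phi>)"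

definition local_most_probable_transition_path ::
  "real \<Rightarrow> (real \<Rightarrow> real^'n^'n) \<Rightarrow> real \<Rightarrow> (real \<Rightarrow> real^'n \<Rightarrow> real^'n) \<Rightarrow> real^'n \<Rightarrow> real^'n \<Rightarrow> real
     \<Rightarrow> (real \<Rightarrow> real^'n) \<Rightarrow> bool" where
  "local_most_probable_transition_path H \<sigma> T b x0 xT \<epsilon> X \<longleftrightarrow>
     local_minimizer (H_norm H \<sigma> T) (fixed_paths H \<sigma> T x0 xT) (J_fun H \<sigma> T b x0 \<epsilon>) X"

definition local_most_probable_evolution_path ::
  "real \<Rightarrow> (real \<Rightarrow> real^'n^'n) \<Rightarrow> real \<Rightarrow> (real \<Rightarrow> real^'n \<Rightarrow> real^'n) \<Rightarrow> real^'n \<Rightarrow> real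
     \<Rightarrow> (real \<Rightarrow> real^'n) \<Rightarrow> bool" where
  "local_most_probable_evolution_path H \<sigma> T b x0 \<epsilon> X \<longleftrightarrow>
     local_minimizer (H_norm H \<sigma> T) (free_paths H \<sigma> T x0) (J_fun H \<sigma> T b x0 \<epsilon>) X"

end

(*
  Rescaling the action by epsilon, the quadratic control cost carries the factor 1/epsilon while the
  divergence term does not. So a fixed perturbation eta on which the Hessian of the divergence is
  negative makes the second variation negative for large epsilon, and since the divergence is critical
  along X, moving to X + s eta lowers J by an amount of order s^2, while the control cost is at most
  C s^2 / epsilon. We take for eta a bump near t0 in the direction of the eigenvector.

  The point is that eta and the control of X + s eta lie in the Cameron--Martin space with the right
  bounds. With a = H - 1/2 and G = I^(a+1)(s^(-a) u) (a fractional integral, up to a constant),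
    K_H u (t) = const * (t^a G(t) - a int_0^t r^(a-1) G(r) dr),
  so that (K_H u)' = f amounts to G' = t^(-a) f: an Abel equation, solved for H < 1/2 by a fractional
  integral and for H > 1/2 by the Marchaud derivative, which exists because f is Hoelder continuous of
  exponent 1/2 > a. The same formula gives injectivity of K_H, which is what makes the inverse
  K_sigma_inv, a choice of preimage, computable.
*)

theory Submission
  imports Defs
begin

section \<open>Fractional integrals\<close>

text \<open>J is never differentiated. The cost bound of order s^2 along X + s \<eta> comes from a
  linear estimate: the residual (X + s \<eta>)' - b(X + s \<eta>), which is s \<eta>' minus an
  increment of the drift, has a Hoelder constant proportional to s, and solving the Volterra
  equation costs at most a constant times the square of that Hoelder constant. Hence all constants
  have to be fixed before the right-hand side is chosen. The weights t^a and t^(-a) may be singular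
  at 0, so the equation is solved for densities that vanish up to a positive time. The density
  b_t(X_t) of X - x0 need not vanish there; membership of X in the path space is therefore not
  derived but drawn from the definition of a local minimizer. All Volterra integrals run over the
  whole line with truncated powers \<open>kern\<close>, so that Fubini and translations carry no
  limits of integration; \<open>kern 0\<close> is the Heaviside function and \<open>rl 0\<close> the
  primitive. Equations for merely integrable functions are stated for their primitives, which keeps
  almost-everywhere differentiation out of the proof.\<close>

definition kern :: "real \<Rightarrow> real \<Rightarrow> real" where
  "kern p y = (if 0 < y then y powr p else 0)"

lemma kern_nonneg [simp]: "0 \<le> kern p y"
  by (simp add: kern_def)

lemma kern_nonpos [simp]: "y \<le> 0 \<Longrightarrow> kern p y = 0"
  by (simp add: kern_def)

lemma kern_measurable [measurable]: "kern p \<in> borel_measurable borel"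
  unfolding kern_def by measurable

lemma kern_mult: "kern p y * kern q y = kern (p + q) y"
  by (simp add: kern_def powr_add)

lemma kern_has_integral:
  assumes "p > -1" "c \<ge> 0"
  shows "has_bochner_integral lborel (\<lambda>y. kern p y * indicator {..c} y) (c powr (p + 1) / (p + 1))"
proof -
  have "(kern p has_integral (c powr (p + 1) / (p + 1))) {0..c}"
    by (rule has_integral_spike_finite[OF _ _ has_integral_powr_from_0[OF assms], of "{0}"])
      (auto simp: kern_def)
  then have "((\<lambda>y. if y \<in> {0..c} then kern p y else 0) has_integral (c powr (p + 1) / (p + 1))) UNIV"
    by (simp only: has_integral_restrict_UNIV)
  also have "(\<lambda>y. if y \<in> {0..c} then kern p y else 0) = (\<lambda>y. kern p y * indicator {..c} y)"
    by (auto simp: fun_eq_iff kern_def)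
  finally have "integral\<^sup>N lborel (\<lambda>y. ennreal (kern p y * indicator {..c} y))
      = ennreal (c powr (p + 1) / (p + 1))"
    by (intro nn_integral_has_integral_lborel) (auto simp: kern_def)
  then show ?thesis
    using assms by (intro has_bochner_integral_nn_integral) auto
qed

text \<open>Mass of the kernel near its singularity s = t. It tends to 0 with \<delta>, which
  controls truncations, and for \<delta> of the size of the interval it bounds a whole fractional
  integral.\<close>

lemma kern_reflected:
  assumes "p > -1" "\<delta> \<ge> 0"
  shows "has_bochner_integral lborel (\<lambda>s. kern p (t - s) * indicator {..\<delta>} (t - s)) (\<delta> powr (p+1) / (p+1))"
  using lborel_has_bochner_integral_real_affine_iff
      [THEN iffD1, OF _ kern_has_integral[OF assms], of "-1" t] by auto

lemma kern_beta0:
  assumes "p > -1" "q > -1"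
  shows "has_bochner_integral lborel (\<lambda>s. kern p (1 - s) * kern q s) (Beta (p + 1) (q + 1))"
proof -
  have "((\<lambda>s. s powr q * (1 - s) powr p) has_integral Beta (q + 1) (p + 1)) {0..1}"
    using has_integral_Beta_real[of "q + 1" "p + 1"] assms by simp
  then have "((\<lambda>s. kern p (1 - s) * kern q s) has_integral Beta (q + 1) (p + 1)) {0..1}"
    by (rule has_integral_spike_finite[of "{0, 1}", rotated 2]) (auto simp: kern_def)
  then have "((\<lambda>s. if s \<in> {0..1} then kern p (1 - s) * kern q s else 0) has_integral Beta (q + 1) (p + 1)) UNIV"
    by (simp only: has_integral_restrict_UNIV)
  also have "(\<lambda>s. if s \<in> {0..1} then kern p (1 - s) * kern q s else 0) = (\<lambda>s. kern p (1 - s) * kern q s)"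
    by (auto simp: fun_eq_iff kern_def)
  finally have I: "((\<lambda>s. kern p (1 - s) * kern q s) has_integral Beta (p + 1) (q + 1)) UNIV"
    by (simp add: Beta_commute)
  then have "integral\<^sup>N lborel (\<lambda>s. ennreal (kern p (1 - s) * kern q s)) = ennreal (Beta (p + 1) (q + 1))"
    by (intro nn_integral_has_integral_lborel) auto
  then show ?thesis
    using has_integral_nonneg[OF I] by (intro has_bochner_integral_nn_integral) auto
qed

text \<open>The semigroup law at kernel level. The substitution s = r + (t - r) y reduces it to
  Euler's Beta integral over (0,1); for r >= t the two factors have disjoint supports and both sides
  vanish.\<close>

lemma kern_beta:
  assumes "p > -1" "q > -1"
  shows "has_bochner_integral lborel (\<lambda>s. kern p (t - s) * kern q (s - r))
           (Beta (p + 1) (q + 1) * kern (p + q + 1) (t - r))"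
proof (cases "r < t")
  case True
  then have "has_bochner_integral lborel
      (\<lambda>s. kern p (1 - (-r/(t-r) + (1/(t-r)) * s)) * kern q (-r/(t-r) + (1/(t-r)) * s))
      (Beta (p + 1) (q + 1) /\<^sub>R \<bar>1 / (t - r)\<bar>)"
    using lborel_has_bochner_integral_real_affine_iff
      [THEN iffD1, OF _ kern_beta0[OF assms], of "1/(t-r)" "-r/(t-r)"] by auto
  then have "has_bochner_integral lborel
      (\<lambda>s. (t - r) powr (p + q) * (kern p (1 - (-r/(t-r) + (1/(t-r)) * s)) * kern q (-r/(t-r) + (1/(t-r)) * s)))
      ((t - r) powr (p + q) * (Beta (p + 1) (q + 1) /\<^sub>R \<bar>1 / (t - r)\<bar>))"
    by (rule has_bochner_integral_mult_right)
  also have "(t - r) powr (p + q) * (Beta (p + 1) (q + 1) /\<^sub>R \<bar>1 / (t - r)\<bar>)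
      = Beta (p + 1) (q + 1) * kern (p + q + 1) (t - r)"
    using True by (simp add: kern_def powr_add)
  also have "(\<lambda>s. (t - r) powr (p + q) * (kern p (1 - (-r/(t-r) + (1/(t-r)) * s)) * kern q (-r/(t-r) + (1/(t-r)) * s)))
      = (\<lambda>s. kern p (t - s) * kern q (s - r))"
  proof
    fix s
    have 2: "-r/(t-r) + (1/(t-r)) * s = (s - r) / (t - r)"
      by (simp add: diff_divide_distrib)
    have 1: "1 - (-r/(t-r) + (1/(t-r)) * s) = (t - s) / (t - r)"
      unfolding 2 using True by (simp add: field_simps)
    show "(t - r) powr (p + q) * (kern p (1 - (-r/(t-r) + (1/(t-r)) * s)) * kern q (-r/(t-r) + (1/(t-r)) * s))
        = kern p (t - s) * kern q (s - r)"
      unfolding 1 unfolding 2 using True by (auto simp: kern_def powr_divide powr_add zero_less_divide_iff)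
  qed
  finally show ?thesis .
next
  case False
  then have "(\<lambda>s. kern p (t - s) * kern q (s - r)) = (\<lambda>s. 0)"
    by (auto simp: kern_def)
  with False show ?thesis by (simp add: has_bochner_integral_zero)
qed

lemma Beta_real_pos: "a > 0 \<Longrightarrow> b > 0 \<Longrightarrow> Beta a b > (0::real)"
  by (simp add: Beta_def)

text \<open>The Riemann--Liouville integral of order \<open>p + 1\<close>, without the factor \<open>1 / Gamma (p + 1)\<close>.\<close>

definition rl :: "real \<Rightarrow> (real \<Rightarrow> 'b::euclidean_space) \<Rightarrow> real \<Rightarrow> 'b" where
  "rl p w t = (LINT s|lborel. kern p (t - s) *\<^sub>R w s)"

lemma rl_measurable [measurable]:
  fixes w :: "real \<Rightarrow> 'b::euclidean_space"
  assumes [measurable]: "w \<in> borel_measurable borel"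
  shows "rl p w \<in> borel_measurable borel"
  unfolding rl_def by measurable

lemma kern_le: "p \<ge> 0 \<Longrightarrow> y \<le> t \<Longrightarrow> kern p y \<le> \<bar>t\<bar> powr p"
  by (auto simp: kern_def intro!: powr_mono2)

lemma integrable_kern_scaleR:
  fixes w :: "real \<Rightarrow> 'b::euclidean_space"
  assumes w: "integrable lborel w" "\<And>r. r \<le> 0 \<Longrightarrow> w r = 0" and "p \<ge> 0"
  shows "integrable lborel (\<lambda>s. kern p (t - s) *\<^sub>R w s)"
proof (rule Bochner_Integration.integrable_bound[of _ "\<lambda>s. \<bar>t\<bar> powr p *\<^sub>R w s"])
  show "integrable lborel (\<lambda>s. \<bar>t\<bar> powr p *\<^sub>R w s)"
    using w(1) by simp
  have [measurable]: "w \<in> borel_measurable borel" using w(1) by auto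
  show "(\<lambda>s. kern p (t - s) *\<^sub>R w s) \<in> borel_measurable lborel" by measurable
  show "AE s in lborel. norm (kern p (t - s) *\<^sub>R w s) \<le> norm (\<bar>t\<bar> powr p *\<^sub>R w s)"
  proof (rule AE_I2)
    fix s :: real
    show "norm (kern p (t - s) *\<^sub>R w s) \<le> norm (\<bar>t\<bar> powr p *\<^sub>R w s)"
      using kern_le[OF \<open>p \<ge> 0\<close>, of "t - s" t] w(2)[of s]
      by (cases "s \<le> 0") (auto intro!: mult_right_mono)
  qed
qed

text \<open>Fubini and \<open>kern_beta\<close>. Each kernel may be singular on its own, but
  \<open>p + q + 1 \<ge> 0\<close> makes the composed kernel locally bounded, so the identity holds
  at every t although w is only integrable. The Beta factor appears because the Gamma factors are
  left out of \<open>rl\<close>.\<close>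

lemma rl_rl:
  fixes w :: "real \<Rightarrow> 'b::euclidean_space"
  assumes w: "integrable lborel w" "\<And>r. r \<le> 0 \<Longrightarrow> w r = 0"
    and pq: "p > -1" "q > -1" "p + q + 1 \<ge> 0"
  shows "rl p (rl q w) t = Beta (p + 1) (q + 1) *\<^sub>R rl (p + q + 1) w t"
proof -
  have [measurable]: "w \<in> borel_measurable borel" using w(1) by auto
  define F where "F = (\<lambda>s r. (kern p (t - s) * kern q (s - r)) *\<^sub>R w r)"
  have meas [measurable]: "(\<lambda>(r, s). F s r) \<in> borel_measurable (lborel \<Otimes>\<^sub>M lborel)"
    unfolding F_def by measurable
  have inner: "has_bochner_integral lborel (\<lambda>s. F s r)
      ((Beta (p + 1) (q + 1) * kern (p + q + 1) (t - r)) *\<^sub>R w r)" for r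
    unfolding F_def by (intro has_bochner_integral_scaleR_left kern_beta pq)
  have innern: "has_bochner_integral lborel (\<lambda>s. norm (F s r))
      ((Beta (p + 1) (q + 1) * kern (p + q + 1) (t - r)) * norm (w r))" for r
    unfolding F_def norm_scaleR abs_mult abs_of_nonneg[OF kern_nonneg]
    by (intro has_bochner_integral_mult_left kern_beta pq)
  \<comment> \<open>Absolute convergence: the integral over s is an exact Beta integral, and what
    remains is a bounded kernel against |w|.\<close>
  have int: "integrable (lborel \<Otimes>\<^sub>M lborel) (\<lambda>(r, s). F s r)"
  proof (rule lborel_pair.Fubini_integrable)
    have "integrable lborel (\<lambda>r. Beta (p + 1) (q + 1) * norm (kern (p + q + 1) (t - r) *\<^sub>R w r))"
      by (intro integrable_mult_right integrable_norm integrable_kern_scaleR w) (use pq in auto)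
    then show "integrable lborel (\<lambda>r. LINT s|lborel. norm (case (r, s) of (r, s) \<Rightarrow> F s r))"
      using has_bochner_integral_integral_eq[OF innern] by (simp add: mult.assoc)
    show "AE r in lborel. integrable lborel (\<lambda>s. case (r, s) of (r, s) \<Rightarrow> F s r)"
      using inner by (auto simp: has_bochner_integral_iff)
  qed simp
  have "rl p (rl q w) t = (LINT s|lborel. LINT r|lborel. F s r)"
    by (simp add: rl_def F_def flip: integral_scaleR_right scaleR_scaleR)
  also have "\<dots> = (LINT r|lborel. LINT s|lborel. F s r)"
    using lborel_pair.Fubini_integral[OF int] .
  also have "\<dots> = Beta (p + 1) (q + 1) *\<^sub>R rl (p + q + 1) w t"
    unfolding has_bochner_integral_integral_eq[OF inner] rl_def by (simp flip: integral_scaleR_right scaleR_scaleR)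
  finally show ?thesis .
qed

section \<open>Weighted fractional integrals of square-integrable densities\<close>

lemma Cauchy_Schwarz_integral:
  fixes f :: "'a \<Rightarrow> real" and w :: "'a \<Rightarrow> 'b::{banach, second_countable_topology}"
  assumes [measurable]: "f \<in> borel_measurable M" "w \<in> borel_measurable M"
    and f: "integrable M (\<lambda>x. (f x)\<^sup>2)" and w: "integrable M (\<lambda>x. (norm (w x))\<^sup>2)"
  shows "integrable M (\<lambda>x. f x *\<^sub>R w x)"
    and "(LINT x|M. norm (f x *\<^sub>R w x))\<^sup>2 \<le> (LINT x|M. (f x)\<^sup>2) * (LINT x|M. (norm (w x))\<^sup>2)"
    and "(norm (LINT x|M. f x *\<^sub>R w x))\<^sup>2 \<le> (LINT x|M. (f x)\<^sup>2) * (LINT x|M. (norm (w x))\<^sup>2)"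
proof -
  let ?F = "LINT x|M. (f x)\<^sup>2" and ?W = "LINT x|M. (norm (w x))\<^sup>2"
  show int: "integrable M (\<lambda>x. f x *\<^sub>R w x)"
  proof (rule Bochner_Integration.integrable_bound[of _ "\<lambda>x. (f x)\<^sup>2 + (norm (w x))\<^sup>2"])
    show "AE x in M. norm (f x *\<^sub>R w x) \<le> norm ((f x)\<^sup>2 + (norm (w x))\<^sup>2)"
    proof (rule AE_I2)
      fix x
      have "2 * (\<bar>f x\<bar> * norm (w x)) \<le> (f x)\<^sup>2 + (norm (w x))\<^sup>2"
        using sum_squares_bound[of "\<bar>f x\<bar>" "norm (w x)"] by (simp add: mult.assoc)
      moreover have "0 \<le> \<bar>f x\<bar> * norm (w x)" by simp
      ultimately show "norm (f x *\<^sub>R w x) \<le> norm ((f x)\<^sup>2 + (norm (w x))\<^sup>2)"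
        unfolding norm_scaleR real_norm_def by linarith
    qed
  qed (use f w in auto)
  have "(\<integral>\<^sup>+x. ennreal \<bar>f x\<bar> * ennreal (norm (w x)) \<partial>M)\<^sup>2 \<le>
      (\<integral>\<^sup>+x. (ennreal \<bar>f x\<bar>)^2 \<partial>M) * (\<integral>\<^sup>+x. (ennreal (norm (w x)))^2 \<partial>M)"
    by (rule Cauchy_Schwarz_nn_integral) auto
  also have "(\<integral>\<^sup>+x. (ennreal \<bar>f x\<bar>)^2 \<partial>M) = ennreal ?F"
    using f by (simp add: ennreal_power nn_integral_eq_integral)
  also have "(\<integral>\<^sup>+x. (ennreal (norm (w x)))^2 \<partial>M) = ennreal ?W"
    using w by (simp add: ennreal_power nn_integral_eq_integral)
  also have "(\<integral>\<^sup>+x. ennreal \<bar>f x\<bar> * ennreal (norm (w x)) \<partial>M) = ennreal (LINT x|M. norm (f x *\<^sub>R w x))"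
    using integrable_norm[OF int] by (simp add: nn_integral_eq_integral flip: ennreal_mult)
  finally have "ennreal ((LINT x|M. norm (f x *\<^sub>R w x))\<^sup>2) \<le> ennreal (?F * ?W)"
    by (simp add: ennreal_power flip: ennreal_mult)
  then show le: "(LINT x|M. norm (f x *\<^sub>R w x))\<^sup>2 \<le> ?F * ?W"
    by (subst (asm) ennreal_le_iff) auto
  have "norm (LINT x|M. f x *\<^sub>R w x) \<le> (LINT x|M. norm (f x *\<^sub>R w x))"
    by (rule integral_norm_bound)
  then have "(norm (LINT x|M. f x *\<^sub>R w x))\<^sup>2 \<le> (LINT x|M. norm (f x *\<^sub>R w x))\<^sup>2"
    by (intro power_mono) auto
  with le show "(norm (LINT x|M. f x *\<^sub>R w x))\<^sup>2 \<le> ?F * ?W" by linarith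
qed

text \<open>The representatives used for elements of \<open>L2 T\<close>: Borel measurable, and zero
  off (0,T] so that integrals over the whole line make sense without a cutoff.
  \<open>L2_borel_version\<close> provides one for every element.\<close>

definition sqint :: "real \<Rightarrow> (real \<Rightarrow> 'b::euclidean_space) \<Rightarrow> bool" where
  "sqint T u \<longleftrightarrow> u \<in> borel_measurable borel \<and> integrable lborel (\<lambda>t. (norm (u t))\<^sup>2) \<and>
     (\<forall>t. t \<notin> {0<..T} \<longrightarrow> u t = 0)"

text \<open>With \<open>a = H - 1/2\<close>, the operator \<open>K_op H\<close> factors through \<open>fvol a\<close>.\<close>

definition fvol :: "real \<Rightarrow> (real \<Rightarrow> 'b::euclidean_space) \<Rightarrow> real \<Rightarrow> 'b" where
  "fvol a u = rl a (\<lambda>s. kern (- a) s *\<^sub>R u s)"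

context
  fixes a T :: real and u :: "real \<Rightarrow> 'b::euclidean_space"
  assumes a: "\<bar>a\<bar> < 1/2" and u: "sqint T u"
begin

lemma sqint_measurable [measurable]: "u \<in> borel_measurable borel"
  and sqint_square_integrable: "integrable lborel (\<lambda>t. (norm (u t))\<^sup>2)"
  and sqint_outside: "t \<notin> {0<..T} \<Longrightarrow> u t = 0"
  using u by (auto simp: sqint_def)

text \<open>Cauchy-Schwarz: s^(-a) is square integrable near 0 because 2a < 1.\<close>

lemma weight_integrable: "integrable lborel (\<lambda>s. kern (- a) s *\<^sub>R u s)"
proof -
  have "has_bochner_integral lborel (\<lambda>s. kern (-2*a) s * indicator {..\<bar>T\<bar>} s) (\<bar>T\<bar> powr (-2*a+1) / (-2*a+1))"
    by (rule kern_has_integral) (use a in auto)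
  moreover have "(\<lambda>s. kern (-2*a) s * indicator {..\<bar>T\<bar>} s) = (\<lambda>s. (kern (-a) s * indicator {..\<bar>T\<bar>} s)\<^sup>2)"
    by (auto simp: fun_eq_iff power2_eq_square kern_mult split: split_indicator)
  ultimately have "integrable lborel (\<lambda>s. (kern (-a) s * indicator {..\<bar>T\<bar>} s) *\<^sub>R u s)"
    by (intro Cauchy_Schwarz_integral sqint_square_integrable) (auto simp: has_bochner_integral_iff)
  moreover have "(\<lambda>s. (kern (-a) s * indicator {..\<bar>T\<bar>} s) *\<^sub>R u s) = (\<lambda>s. kern (- a) s *\<^sub>R u s)"
  proof
    fix s
    show "(kern (-a) s * indicator {..\<bar>T\<bar>} s) *\<^sub>R u s = kern (- a) s *\<^sub>R u s"
    proof (cases "s \<le> \<bar>T\<bar>")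
      case False
      then have "s \<notin> {0<..T}" by auto
      from sqint_outside[OF this] show ?thesis by simp
    qed simp
  qed
  ultimately show ?thesis by simp
qed

text \<open>Squaring doubles the exponents to 2a and -2a, both above -1 since |a| < 1/2. They add up
  to 0, so the squared norm of the kernel is linear in t whatever a is; this is the source of the
  bound by sqrt t in \<open>fvol_bound\<close>.\<close>

lemma kern_sq_beta:
  "has_bochner_integral lborel (\<lambda>s. (kern a (t - s) * kern (-a) s)\<^sup>2) (Beta (2*a+1) (-2*a+1) * kern 1 t)"
proof -
  have "has_bochner_integral lborel (\<lambda>s. kern (2*a) (t - s) * kern (-2*a) (s - 0))
      (Beta (2*a+1) (-2*a+1) * kern (2*a + (-2*a) + 1) (t - 0))"
    by (rule kern_beta) (use a in auto)
  moreover have "(\<lambda>s. kern (2*a) (t - s) * kern (-2*a) (s - 0)) = (\<lambda>s. (kern a (t - s) * kern (-a) s)\<^sup>2)"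
    by (auto simp: fun_eq_iff power2_eq_square kern_mult algebra_simps)
  ultimately show ?thesis by simp
qed

lemma fvol_bound:
  "integrable lborel (\<lambda>s. (kern a (t - s) * kern (-a) s) *\<^sub>R u s)"
  "(LINT s|lborel. norm ((kern a (t - s) * kern (-a) s) *\<^sub>R u s)) \<le>
     sqrt (Beta (2*a+1) (-2*a+1) * (LINT s|lborel. (norm (u s))\<^sup>2)) * kern (1/2) t"
  "norm (fvol a u t) \<le> sqrt (Beta (2*a+1) (-2*a+1) * (LINT s|lborel. (norm (u s))\<^sup>2)) * kern (1/2) t"
proof -
  have i: "integrable lborel (\<lambda>s. (kern a (t - s) * kern (-a) s)\<^sup>2)"
    using kern_sq_beta by (auto simp: has_bochner_integral_iff)
  show "integrable lborel (\<lambda>s. (kern a (t - s) * kern (-a) s) *\<^sub>R u s)"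
    by (rule Cauchy_Schwarz_integral(1)[OF _ _ i sqint_square_integrable]) auto
  have "(LINT s|lborel. norm ((kern a (t - s) * kern (-a) s) *\<^sub>R u s))\<^sup>2
      \<le> (LINT s|lborel. (kern a (t - s) * kern (-a) s)\<^sup>2) * (LINT s|lborel. (norm (u s))\<^sup>2)"
    by (rule Cauchy_Schwarz_integral(2)[OF _ _ i sqint_square_integrable]) auto
  then have "(LINT s|lborel. norm ((kern a (t - s) * kern (-a) s) *\<^sub>R u s)) \<le>
      sqrt (Beta (2*a+1) (-2*a+1) * kern 1 t * (LINT s|lborel. (norm (u s))\<^sup>2))"
    unfolding has_bochner_integral_integral_eq[OF kern_sq_beta] by (rule real_le_rsqrt)
  also have "\<dots> = sqrt (Beta (2*a+1) (-2*a+1) * (LINT s|lborel. (norm (u s))\<^sup>2)) * kern (1/2) t"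
    by (auto simp: real_sqrt_mult kern_def powr_half_sqrt)
  finally show *: "(LINT s|lborel. norm ((kern a (t - s) * kern (-a) s) *\<^sub>R u s)) \<le>
     sqrt (Beta (2*a+1) (-2*a+1) * (LINT s|lborel. (norm (u s))\<^sup>2)) * kern (1/2) t" .
  have "norm (fvol a u t) \<le> (LINT s|lborel. norm ((kern a (t - s) * kern (-a) s) *\<^sub>R u s))"
    unfolding fvol_def rl_def scaleR_scaleR by (rule integral_norm_bound)
  with * show "norm (fvol a u t) \<le> sqrt (Beta (2*a+1) (-2*a+1) * (LINT s|lborel. (norm (u s))\<^sup>2)) * kern (1/2) t"
    by linarith
qed

lemma fvol_measurable [measurable]: "fvol a u \<in> borel_measurable borel"
  unfolding fvol_def by measurable

lemma fvol_0 [simp]: "fvol a u 0 = 0"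
  using fvol_bound(3)[of 0] by simp

text \<open>With the strip t - s <= \<delta> cut out, the kernel is bounded for t in a bounded set,
  and dominated convergence applies. The cutoff jumps only at s = t - \<delta>, a null set.\<close>

lemma truncated_fvol_continuous:
  assumes "\<delta> > 0"
  shows "isCont (\<lambda>t. LINT s|lborel. (kern a (t - s) * indicator {\<delta><..} (t - s)) *\<^sub>R (kern (-a) s *\<^sub>R u s)) t"
  unfolding continuous_at_sequentially comp_def
proof (intro allI impI)
  fix x :: "nat \<Rightarrow> real" assume x: "x \<longlonglongrightarrow> t"
  then obtain B where B: "\<And>n. \<bar>x n\<bar> \<le> B"
    using convergent_imp_bounded[of x] by (auto simp: bounded_iff)
  \<comment> \<open>The first summand bounds the kernel for a < 0, where small arguments are
    critical, the second for a >= 0, where large ones are.\<close>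
  let ?b = "\<delta> powr a + B powr a"
  have bd: "kern a (x n - s) * indicator {\<delta><..} (x n - s) \<le> ?b" if "s > 0" for n s
  proof (cases "x n - s > \<delta>")
    case True
    have "x n - s \<le> B" using B[of n] that by auto
    then have "(x n - s) powr a \<le> ?b"
      using True assms powr_mono2[of a "x n - s" B] powr_mono2'[of a \<delta> "x n - s"]
      by (cases "a \<ge> 0") (auto intro: order_trans)
    then show ?thesis using True assms by (simp add: kern_def)
  qed auto
  show "(\<lambda>n. LINT s|lborel. (kern a (x n - s) * indicator {\<delta><..} (x n - s)) *\<^sub>R (kern (-a) s *\<^sub>R u s))
      \<longlonglongrightarrow> (LINT s|lborel. (kern a (t - s) * indicator {\<delta><..} (t - s)) *\<^sub>R (kern (-a) s *\<^sub>R u s))"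
  proof (rule integral_dominated_convergence)
    show "integrable lborel (\<lambda>s. ?b * norm (kern (-a) s *\<^sub>R u s))"
      by (intro integrable_mult_right integrable_norm weight_integrable)
    show "AE s in lborel. norm ((kern a (x n - s) * indicator {\<delta><..} (x n - s)) *\<^sub>R (kern (-a) s *\<^sub>R u s))
        \<le> ?b * norm (kern (-a) s *\<^sub>R u s)" for n
    proof (rule AE_I2)
      fix s
      show "norm ((kern a (x n - s) * indicator {\<delta><..} (x n - s)) *\<^sub>R (kern (-a) s *\<^sub>R u s))
        \<le> ?b * norm (kern (-a) s *\<^sub>R u s)"
      proof (cases "s > 0")
        case True
        then have "\<bar>kern a (x n - s) * indicator {\<delta><..} (x n - s)\<bar> \<le> ?b" using bd by (simp add: abs_of_nonneg)
        then show ?thesis unfolding norm_scaleR by (rule mult_right_mono) auto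
      qed simp
    qed
    show "AE s in lborel. (\<lambda>n. (kern a (x n - s) * indicator {\<delta><..} (x n - s)) *\<^sub>R (kern (-a) s *\<^sub>R u s))
        \<longlonglongrightarrow> (kern a (t - s) * indicator {\<delta><..} (t - s)) *\<^sub>R (kern (-a) s *\<^sub>R u s)"
      using AE_lborel_singleton[of "t - \<delta>"]
    proof eventually_elim
      case (elim s)
      have lim: "(\<lambda>n. x n - s) \<longlonglongrightarrow> t - s" by (intro tendsto_intros x)
      have "(\<lambda>n. kern a (x n - s) * indicator {\<delta><..} (x n - s)) \<longlonglongrightarrow> kern a (t - s) * indicator {\<delta><..} (t - s)"
      proof (cases "t - s > \<delta>")
        case True
        have "(\<lambda>n. (x n - s) powr a) \<longlonglongrightarrow> (t - s) powr a"
          by (intro tendsto_powr lim tendsto_const) (use True assms in auto)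
        moreover have "eventually (\<lambda>n. (x n - s) powr a = kern a (x n - s) * indicator {\<delta><..} (x n - s)) sequentially"
          using order_tendstoD(1)[OF lim True] by eventually_elim (use assms in \<open>auto simp: kern_def\<close>)
        ultimately have "(\<lambda>n. kern a (x n - s) * indicator {\<delta><..} (x n - s)) \<longlonglongrightarrow> (t - s) powr a"
          by (rule Lim_transform_eventually)
        then show ?thesis using True assms by (simp add: kern_def)
      next
        case False
        with elim have lt: "t - s < \<delta>" by auto
        have "eventually (\<lambda>n. 0 = kern a (x n - s) * indicator {\<delta><..} (x n - s)) sequentially"
          using order_tendstoD(2)[OF lim lt] by eventually_elim auto
        then have "(\<lambda>n. kern a (x n - s) * indicator {\<delta><..} (x n - s)) \<longlonglongrightarrow> 0"
          by (rule Lim_transform_eventually[OF tendsto_const])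
        then show ?thesis using lt by auto
      qed
      then show ?case by (rule tendsto_scaleR) auto
    qed
  qed auto
qed

text \<open>Uniform limit of the truncations. Away from 0 the weight s^(-a) is bounded, so by
  Cauchy-Schwarz the square of what a strip of width \<delta> contributes is at most a constant
  times \<delta>^(2a+1), and 2a + 1 > 0.\<close>

lemma fvol_continuous_pos:
  assumes "0 < t1"
  shows "continuous_on {t1..T} (fvol a u)"
proof (rule uniform_limit_theorem)
  define g where "g = (\<lambda>n t. LINT s|lborel. (kern a (t - s) * indicator {1 / Suc n<..} (t - s)) *\<^sub>R (kern (-a) s *\<^sub>R u s))"
  show "\<forall>\<^sub>F n in sequentially. continuous_on {t1..T} (g n)"
    unfolding g_def
    by (intro always_eventually allI continuous_at_imp_continuous_on ballI truncated_fvol_continuous) simp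
  \<comment> \<open>Bounds s^(-a) on [t1/2, T], one summand for each sign of a. A strip narrower
    than t1/2 below some t >= t1 stays in this interval.\<close>
  define M where "M = (t1/2) powr (-a) + T powr (-a)"
  let ?U = "LINT s|lborel. (norm (u s))\<^sup>2"
  have M: "kern (-a) s \<le> M" if "t1/2 \<le> s" "s \<le> T" for s
  proof -
    have "s powr (-a) \<le> M" unfolding M_def
      using that assms powr_mono2[of "-a" s T] powr_mono2'[of "-a" "t1/2" s]
      by (cases "-a \<ge> 0") (auto intro: order_trans)
    then show ?thesis using that assms by (auto simp: kern_def)
  qed
  have M0: "M \<ge> 0" by (simp add: M_def)
  have tail: "(norm (fvol a u t - g n t))\<^sup>2 \<le> M\<^sup>2 * ((1 / Suc n) powr (2*a+1) / (2*a+1)) * ?U"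
    if t: "t \<in> {t1..T}" and n: "1 / Suc n < t1/2" for t n
  proof -
    let ?f = "\<lambda>s. kern a (t - s) * indicator {..1 / Suc n} (t - s) * kern (-a) s"
    let ?h = "\<lambda>s. M\<^sup>2 * (kern (2*a) (t - s) * indicator {..1 / Suc n} (t - s))"
    have le: "(?f s)\<^sup>2 \<le> ?h s" for s
    proof (cases "0 < t - s \<and> t - s \<le> 1 / Suc n")
      case True
      then have "t1/2 \<le> s" "s \<le> T" using t n by auto
      then have "(kern (-a) s)\<^sup>2 \<le> M\<^sup>2" using M by (intro power_mono) auto
      moreover have "(kern a (t - s))\<^sup>2 = kern (2*a) (t - s)" by (simp add: power2_eq_square kern_mult)
      ultimately show ?thesis using True
        by (simp add: power_mult_distrib mult.commute[of "kern (2*a) (t - s)"] mult_right_mono)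
    qed (auto split: split_indicator)
    have ih: "has_bochner_integral lborel ?h (M\<^sup>2 * ((1 / Suc n) powr (2*a+1) / (2*a+1)))"
      by (intro has_bochner_integral_mult_right kern_reflected) (use a in auto)
    have i: "integrable lborel (\<lambda>s. (?f s)\<^sup>2)"
      by (rule Bochner_Integration.integrable_bound[of _ ?h])
        (use ih le in \<open>auto simp: has_bochner_integral_iff intro!: order_trans[OF le]\<close>)
    have "fvol a u t - g n t = (LINT s|lborel. ?f s *\<^sub>R u s)"
    proof -
      have "integrable lborel (\<lambda>s. (kern a (t - s) * indicator {1 / Suc n<..} (t - s)) *\<^sub>R (kern (-a) s *\<^sub>R u s))"
        by (rule Bochner_Integration.integrable_bound[OF fvol_bound(1)[of t]]) (auto split: split_indicator)
      then have "fvol a u t - g n t = (LINT s|lborel. (kern a (t - s) * kern (-a) s) *\<^sub>R u s -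
          (kern a (t - s) * indicator {1 / Suc n<..} (t - s)) *\<^sub>R (kern (-a) s *\<^sub>R u s))"
        unfolding fvol_def rl_def g_def scaleR_scaleR using fvol_bound(1)[of t]
        by (intro Bochner_Integration.integral_diff[symmetric]) (auto simp: mult.assoc)
      also have "\<dots> = (LINT s|lborel. ?f s *\<^sub>R u s)"
        by (intro Bochner_Integration.integral_cong) (auto split: split_indicator)
      finally show ?thesis .
    qed
    then have "(norm (fvol a u t - g n t))\<^sup>2 \<le> (LINT s|lborel. (?f s)\<^sup>2) * ?U"
      using Cauchy_Schwarz_integral(3)[OF _ _ i sqint_square_integrable] by simp
    also have "\<dots> \<le> (LINT s|lborel. ?h s) * ?U"
      using ih by (intro mult_right_mono integral_mono le i) (auto simp: has_bochner_integral_iff)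
    finally show ?thesis using has_bochner_integral_integral_eq[OF ih] by simp
  qed
  have "(\<lambda>n. M\<^sup>2 * ((1 / Suc n) powr (2*a+1) / (2*a+1)) * ?U) \<longlonglongrightarrow> M\<^sup>2 * (0 powr (2*a+1) / (2*a+1)) * ?U"
    by (intro tendsto_intros tendsto_powr' LIMSEQ_Suc[OF lim_1_over_n]) (use a in auto)
  then have lim: "(\<lambda>n. M\<^sup>2 * ((1 / Suc n) powr (2*a+1) / (2*a+1)) * ?U) \<longlonglongrightarrow> 0" by simp
  show "uniform_limit {t1..T} g (fvol a u) sequentially"
  proof (rule uniform_limitI)
    fix e :: real assume "e > 0"
    have "eventually (\<lambda>n. M\<^sup>2 * ((1 / Suc n) powr (2*a+1) / (2*a+1)) * ?U < e\<^sup>2) sequentially"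
      using order_tendstoD(2)[OF lim, of "e\<^sup>2"] \<open>e > 0\<close> by simp
    moreover have "eventually (\<lambda>n. 1 / Suc n < t1/2) sequentially"
      using order_tendstoD(2)[OF LIMSEQ_Suc[OF lim_1_over_n], of "t1/2"] assms by simp
    ultimately show "\<forall>\<^sub>F n in sequentially. \<forall>t\<in>{t1..T}. dist (g n t) (fvol a u t) < e"
    proof eventually_elim
      case (elim n)
      show ?case
      proof
        fix t assume "t \<in> {t1..T}"
        from tail[OF this elim(2)] elim(1) have "(norm (fvol a u t - g n t))\<^sup>2 < e\<^sup>2" by linarith
        then have "norm (fvol a u t - g n t) < e"
          using \<open>e > 0\<close> by (meson less_imp_le power_less_imp_less_base)
        then show "dist (g n t) (fvol a u t) < e" by (simp add: dist_norm norm_minus_commute)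
      qed
    qed
  qed
qed simp

end

declare sqint_measurable [measurable del] fvol_measurable [measurable del]

section \<open>Primitives, and injectivity of the Volterra operator\<close>

lemma rl0_split:
  fixes w :: "real \<Rightarrow> 'b::euclidean_space"
  assumes w: "integrable lborel w" and "p \<le> x"
  shows "rl 0 w x = rl 0 w p + integral {p..x} w" and "w integrable_on {p..x}"
proof -
  have si: "set_integrable lborel A w" if "A \<in> sets lborel" for A
    unfolding set_integrable_def using w that by (rule integrable_mult_indicator[rotated])
  have rl0: "rl 0 w y = (LINT s|lborel. indicator {..<y} s *\<^sub>R w s)" for y
    unfolding rl_def by (intro Bochner_Integration.integral_cong) (auto simp: kern_def split: split_indicator)
  have "rl 0 w x = (LINT s|lborel. indicator {..<p} s *\<^sub>R w s + indicator {p..<x} s *\<^sub>R w s)"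
    unfolding rl0 using assms(2) by (intro Bochner_Integration.integral_cong) (auto split: split_indicator)
  also have "\<dots> = rl 0 w p + (LINT s|lborel. indicator {p..<x} s *\<^sub>R w s)"
    unfolding rl0 using si by (intro Bochner_Integration.integral_add) (auto simp: set_integrable_def)
  also have "(LINT s|lborel. indicator {p..<x} s *\<^sub>R w s) = (LINT s:{p..x}|lborel. w s)"
    unfolding set_lebesgue_integral_def using w AE_lborel_singleton[of x]
    by (intro integral_cong_AE) (auto elim!: eventually_mono split: split_indicator)
  also have "\<dots> = integral {p..x} w"
    by (intro set_borel_integral_eq_integral si) auto
  finally show "rl 0 w x = rl 0 w p + integral {p..x} w" .
  show "w integrable_on {p..x}"
    by (intro set_borel_integral_eq_integral si) auto
qed

lemma rl0_continuous:
  fixes w :: "real \<Rightarrow> 'b::euclidean_space"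
  assumes "integrable lborel w"
  shows "continuous_on S (rl 0 w)"
proof -
  have "continuous_on {-n..n} (rl 0 w)" for n :: real
  proof -
    have "continuous_on {-n..n} (\<lambda>x. rl 0 w (-n) + integral {-n..x} w)"
      by (cases "-n \<le> n") (auto intro!: continuous_intros indefinite_integral_continuous_1 rl0_split assms)
    then show ?thesis
      by (rule continuous_on_eq) (auto intro!: rl0_split(1)[symmetric] assms)
  qed
  then have "isCont (rl 0 w) x" for x
    by (rule continuous_on_interior[of "{-(\<bar>x\<bar> + 1)..\<bar>x\<bar> + 1}"]) auto
  then show ?thesis
    by (intro continuous_at_imp_continuous_on) auto
qed

lemma rl0_has_vector_derivative:
  fixes w :: "real \<Rightarrow> 'b::euclidean_space"
  assumes "integrable lborel w" "continuous_on {p..q} w" "x \<in> {p..q}"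
  shows "(rl 0 w has_vector_derivative w x) (at x within {p..q})"
proof (rule has_vector_derivative_transform[OF assms(3)])
  show "((\<lambda>x. rl 0 w p + integral {p..x} w) has_vector_derivative w x) (at x within {p..q})"
    using integral_has_vector_derivative[OF assms(2,3)] by (auto intro!: derivative_eq_intros)
qed (use rl0_split(1)[OF assms(1)] in auto)

lemma rl0_zero_imp_zero:
  fixes g :: "real \<Rightarrow> 'b::euclidean_space"
  assumes g: "continuous_on {0..T} g" "\<And>t. t < 0 \<Longrightarrow> g t = 0"
    and z: "\<And>t. t \<in> {0..T} \<Longrightarrow> rl 0 g t = 0" and "T > 0" and t: "t \<in> {0..T}"
  shows "g t = 0"
proof -
  \<comment> \<open>The cutoff makes g integrable on the line and leaves its primitive on [0,T]
    unchanged.\<close>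
  define V where "V = (\<lambda>t. indicator {0..T} t *\<^sub>R g t)"
  have cV: "continuous_on {0..T} V"
    by (rule continuous_on_eq[OF g(1)]) (simp add: V_def)
  have V: "integrable lborel V"
    unfolding V_def using borel_integrable_atLeastAtMost'[OF g(1)] by (simp add: set_integrable_def)
  have "rl 0 V t = 0" if "t \<in> {0..T}" for t
  proof -
    have "kern 0 (t - s) *\<^sub>R V s = kern 0 (t - s) *\<^sub>R g s" for s
      using that g(2)[of s] by (cases "s < t") (auto simp: V_def split: split_indicator)
    then show ?thesis using z[OF that] by (simp only: rl_def)
  qed
  then have d0: "(rl 0 V has_vector_derivative 0) (at t within {0..T})"
    by (intro has_vector_derivative_transform[OF t _ has_vector_derivative_const[of 0]]) auto
  have "V t = 0"
    using vector_derivative_unique_within_closed_interval[of 0 T t "rl 0 V" "V t" 0]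
      rl0_has_vector_derivative[OF V cV t] d0 \<open>T > 0\<close> t by auto
  then show ?thesis using t by (simp add: V_def)
qed

text \<open>The positive and the negative part of f are densities of finite measures that agree on
  all half-lines, hence everywhere, and densities are unique almost everywhere. Since
  \<open>ennreal\<close> truncates at 0, f and -f themselves serve as these densities.\<close>

lemma AE_zero_real:
  fixes f :: "real \<Rightarrow> real"
  assumes f: "integrable lborel f" and "\<And>x. (LINT s|lborel. f s * indicator {x<..} s) = 0"
  shows "AE s in lborel. f s = 0"
proof -
  have [measurable]: "f \<in> borel_measurable borel" using f by auto
  have ip: "integrable lborel (\<lambda>s. max 0 (g s) * indicator {x<..} s)" if "integrable lborel g" for x and g :: "real \<Rightarrow> real"
  proof (rule Bochner_Integration.integrable_bound[OF that])
    have [measurable]: "g \<in> borel_measurable borel" using that by auto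
    show "(\<lambda>s. max 0 (g s) * indicator {x<..} s) \<in> borel_measurable lborel" by measurable
  qed (auto split: split_indicator)
  have em: "emeasure (density lborel (\<lambda>s. ennreal (g s))) {x<..} = ennreal (LINT s|lborel. max 0 (g s) * indicator {x<..} s)"
    if "integrable lborel g" for x and g :: "real \<Rightarrow> real"
  proof -
    have [measurable]: "g \<in> borel_measurable borel" using that by auto
    have "emeasure (density lborel (\<lambda>s. ennreal (g s))) {x<..} = (\<integral>\<^sup>+s. ennreal (max 0 (g s) * indicator {x<..} s) \<partial>lborel)"
      by (subst emeasure_density) (auto intro!: nn_integral_cong simp: ennreal_eq_0_iff max_def ennreal_neg split: split_indicator)
    also have "\<dots> = ennreal (LINT s|lborel. max 0 (g s) * indicator {x<..} s)"
      by (intro nn_integral_eq_integral ip that) (auto split: split_indicator)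
    finally show ?thesis .
  qed
  have "density lborel (\<lambda>s. ennreal (f s)) = density lborel (\<lambda>s. ennreal (- f s))"
  proof (rule measure_eqI_lessThan)
    fix x :: real
    have "(LINT s|lborel. max 0 (f s) * indicator {x<..} s) - (LINT s|lborel. max 0 (- f s) * indicator {x<..} s)
        = (LINT s|lborel. f s * indicator {x<..} s)"
      by (subst Bochner_Integration.integral_diff[symmetric])
        (auto intro!: ip f Bochner_Integration.integral_cong split: split_indicator)
    then show "emeasure (density lborel (\<lambda>s. ennreal (f s))) {x<..} = emeasure (density lborel (\<lambda>s. ennreal (- f s))) {x<..}"
      using assms(2)[of x] em[OF f, of x] em[of "\<lambda>s. - f s" x] f by simp
  qed (use em[OF f] in auto)
  then have "AE s in lborel. ennreal (f s) = ennreal (- f s)"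
    by (subst (asm) sigma_finite_measure.density_unique_iff[OF sigma_finite_lborel]) auto
  then show ?thesis
  proof eventually_elim
    case (elim s)
    have "ennreal \<bar>f s\<bar> = 0"
      using elim ennreal_neg[of "f s"] ennreal_neg[of "- f s"] by (cases "f s \<ge> 0") auto
    then show ?case by (simp add: ennreal_eq_0_iff)
  qed
qed

lemma AE_zero:
  fixes w :: "real \<Rightarrow> 'b::euclidean_space"
  assumes w: "integrable lborel w" and "\<And>t. rl 0 w t = 0" and T: "\<And>t. t > T \<Longrightarrow> w t = 0"
  shows "AE s in lborel. w s = 0"
proof -
  have "AE s in lborel. w s \<bullet> i = 0" for i
  proof (rule AE_zero_real)
    show "integrable lborel (\<lambda>s. w s \<bullet> i)" using w by auto
    fix x :: real
    have [measurable]: "w \<in> borel_measurable borel" using w by auto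
    \<comment> \<open>Beyond T the function w vanishes, so the integral over a half-line is one over
      a compact interval, that is, an increment of the primitive.\<close>
    define N where "N = max T x + 1"
    have "(LINT s|lborel. (w s \<bullet> i) * indicator {x<..} s) = (LINT s|lborel. (indicator {x..N} s *\<^sub>R w s) \<bullet> i)"
      using AE_lborel_singleton[of x]
      by (intro integral_cong_AE) (auto elim!: eventually_mono simp: N_def T split: split_indicator)
    also have "\<dots> = (LINT s:{x..N}|lborel. w s) \<bullet> i"
      unfolding set_lebesgue_integral_def by (rule integral_inner_left) (auto intro!: integrable_mult_indicator w)
    also have "(LINT s:{x..N}|lborel. w s) = integral {x..N} w"
      by (intro set_borel_integral_eq_integral) (auto simp: set_integrable_def intro!: integrable_mult_indicator w)
    also have "\<dots> = 0"
      using rl0_split(1)[OF w, of x N] assms(2) by (simp add: N_def)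
    finally show "(LINT s|lborel. (w s \<bullet> i) * indicator {x<..} s) = 0" by simp
  qed
  then have "AE s in lborel. \<forall>i\<in>Basis. w s \<bullet> i = 0"
    by (simp add: AE_finite_all)
  then show ?thesis
    by eventually_elim (auto intro: euclidean_eqI)
qed

text \<open>This is K_H without the factor \<open>c_H H\<close>, see \<open>K_op_eq_kop\<close>. The
  form is made for differentiation: where G = \<open>fvol a u\<close> has a derivative, the
  derivative of the weight t^a cancels against the second term and only t^a G'(t) is left. The
  indicator secures integrability on the line and has no effect for t <= T.\<close>

definition kop :: "real \<Rightarrow> real \<Rightarrow> (real \<Rightarrow> 'b::euclidean_space) \<Rightarrow> real \<Rightarrow> 'b" where
  "kop T a u t = t powr a *\<^sub>R fvol a u t
     - a *\<^sub>R rl 0 (\<lambda>r. (kern (a - 1) r * indicator {..T} r) *\<^sub>R fvol a u r) t"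

context
  fixes a T :: real and u :: "real \<Rightarrow> 'b::euclidean_space"
  assumes a: "\<bar>a\<bar> < 1/2" and u: "sqint T u" and T: "T > 0"
begin

lemma fvol_continuous: "continuous_on {0..T} (fvol a u)"
  unfolding continuous_on_eq_continuous_within
proof
  fix t assume t: "t \<in> {0..T}"
  show "continuous (at t within {0..T}) (fvol a u)"
  proof (cases "t = 0")
    case True
    let ?C = "sqrt (Beta (2*a+1) (-2*a+1) * (LINT s|lborel. (norm (u s))\<^sup>2))"
    have "((\<lambda>t. ?C * sqrt t) \<longlongrightarrow> ?C * sqrt 0) (at 0 within {0..T})"
      by (intro tendsto_intros)
    then have "((\<lambda>t. ?C * sqrt t) \<longlongrightarrow> 0) (at 0 within {0..T})" by simp
    moreover have "\<forall>\<^sub>F t in at 0 within {0..T}. norm (fvol a u t) \<le> ?C * sqrt t"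
      unfolding eventually_at_filter
    proof (intro always_eventually allI impI)
      fix t assume "t \<in> {0..T}" "t \<noteq> 0"
      then show "norm (fvol a u t) \<le> ?C * sqrt t"
        using fvol_bound(3)[OF a u, of t] by (auto simp: kern_def powr_half_sqrt)
    qed
    ultimately have "(fvol a u \<longlongrightarrow> 0) (at 0 within {0..T})"
      by (rule Lim_null_comparison[rotated])
    then show ?thesis using True fvol_0[OF a u] by (simp add: continuous_within)
  next
    case False
    with t have "t > 0" by auto
    then have "continuous (at t within {t/2..T}) (fvol a u)"
      using fvol_continuous_pos[OF a u, of "t/2"] t by (auto simp: continuous_on_eq_continuous_within)
    moreover have "at t within {0..T} = at t within {t/2..T}"
      by (rule at_within_nhd[of t "{t/2<..}"]) (use \<open>t > 0\<close> in auto)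
    ultimately show ?thesis by simp
  qed
qed

text \<open>The bound of G by sqrt r improves the weight r^(a-1) to r^(a-1/2), which is integrable
  at 0 because a > -1/2.\<close>

lemma volume_integrable: "integrable lborel (\<lambda>r. (kern (a - 1) r * indicator {..T} r) *\<^sub>R fvol a u r)"
proof (rule Bochner_Integration.integrable_bound)
  let ?C = "sqrt (Beta (2*a+1) (-2*a+1) * (LINT s|lborel. (norm (u s))\<^sup>2))"
  show "integrable lborel (\<lambda>r. ?C * (kern (a - 1/2) r * indicator {..T} r))"
    using kern_has_integral[of "a - 1/2" T] a T by (intro integrable_mult_right) (auto simp: has_bochner_integral_iff)
  show "AE r in lborel. norm ((kern (a - 1) r * indicator {..T} r) *\<^sub>R fvol a u r)
      \<le> norm (?C * (kern (a - 1/2) r * indicator {..T} r))"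
  proof (rule AE_I2)
    fix r
    have "norm ((kern (a - 1) r * indicator {..T} r) *\<^sub>R fvol a u r)
        \<le> (kern (a - 1) r * indicator {..T} r) * (?C * kern (1/2) r)"
      unfolding norm_scaleR using fvol_bound(3)[OF a u, of r] by (auto intro: mult_left_mono split: split_indicator)
    also have "\<dots> = ?C * ((kern (a - 1) r * kern (1/2) r) * indicator {..T} r)"
      by (simp add: algebra_simps)
    also have "kern (a - 1) r * kern (1/2) r = kern (a - 1/2) r"
      by (simp add: kern_mult)
    finally show "norm ((kern (a - 1) r * indicator {..T} r) *\<^sub>R fvol a u r)
      \<le> norm (?C * (kern (a - 1/2) r * indicator {..T} r))"
      by simp
  qed
qed (measurable, rule fvol_measurable[OF a u])

text \<open>For a < 0 the factor t^a blows up at 0, but t^a G(t) is of order t^(a+1/2).\<close>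

lemma kop_continuous: "continuous_on {0..T} (kop T a u)"
proof -
  have "continuous_on {0..T} (\<lambda>t. t powr a *\<^sub>R fvol a u t)"
    unfolding continuous_on_eq_continuous_within
  proof
    fix t assume t: "t \<in> {0..T}"
    show "continuous (at t within {0..T}) (\<lambda>t. t powr a *\<^sub>R fvol a u t)"
    proof (cases "t = 0")
      case True
      let ?C = "sqrt (Beta (2*a+1) (-2*a+1) * (LINT s|lborel. (norm (u s))\<^sup>2))"
      have "((\<lambda>t. ?C * t powr (a + 1/2)) \<longlongrightarrow> ?C * 0 powr (a + 1/2)) (at 0 within {0..T})"
        by (intro tendsto_intros tendsto_powr') (use a in \<open>auto simp: eventually_at_filter\<close>)
      then have "((\<lambda>t. ?C * t powr (a + 1/2)) \<longlongrightarrow> 0) (at 0 within {0..T})" by simp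
      moreover have "\<forall>\<^sub>F t in at 0 within {0..T}. norm (t powr a *\<^sub>R fvol a u t) \<le> ?C * t powr (a + 1/2)"
        unfolding eventually_at_filter
      proof (intro always_eventually allI impI)
        fix t assume "t \<in> {0..T}" "t \<noteq> 0"
        then have "t powr a * norm (fvol a u t) \<le> t powr a * (?C * t powr (1/2))"
          using fvol_bound(3)[OF a u, of t] by (intro mult_left_mono) (auto simp: kern_def)
        then show "norm (t powr a *\<^sub>R fvol a u t) \<le> ?C * t powr (a + 1/2)"
          by (simp add: powr_add mult_ac)
      qed
      ultimately have "((\<lambda>t. t powr a *\<^sub>R fvol a u t) \<longlongrightarrow> 0) (at 0 within {0..T})"
        by (rule Lim_null_comparison[rotated])
      then show ?thesis using True by (simp add: continuous_within)
    next
      case False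
      then show ?thesis
        using fvol_continuous t unfolding continuous_on_eq_continuous_within continuous_within
        by (intro tendsto_scaleR tendsto_powr tendsto_const tendsto_ident_at) auto
    qed
  qed
  then show ?thesis
    unfolding kop_def[abs_def]
    by (intro continuous_on_diff) (auto intro!: continuous_on_scaleR continuous_on_const rl0_continuous volume_integrable)
qed

text \<open>Let W = \<open>rl 0 w\<close> be the integral of r^(a-1) G(r). The hypothesis reads t^a
  G = a W, and W' = t^(a-1) G = (a/t) W, so t^(-a) W is constant on (0,T]. Then G = a t^(-a) W is
  constant there too, and continuity with G(0) = 0 makes the constant 0.\<close>

lemma kop_zero_imp_fvol_zero:
  assumes z: "\<And>t. t \<in> {0..T} \<Longrightarrow> kop T a u t = 0" and t: "t \<in> {0..T}"
  shows "fvol a u t = 0"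
proof -
  define w where "w = (\<lambda>r. (kern (a - 1) r * indicator {..T} r) *\<^sub>R fvol a u r)"
  have w: "integrable lborel w" unfolding w_def by (rule volume_integrable)
  have eq: "t powr a *\<^sub>R fvol a u t = a *\<^sub>R rl 0 w t" if "t \<in> {0..T}" for t
    using z[OF that] by (simp add: kop_def w_def)
  have const: "x powr (-a) *\<^sub>R rl 0 w x = y powr (-a) *\<^sub>R rl 0 w y" if xy: "x \<in> {0<..T}" "y \<in> {0<..T}" for x y
  proof -
    define p where "p = min x y"
    have p: "0 < p" "p \<le> x" "p \<le> y" using xy by (auto simp: p_def)
    show ?thesis
    proof (rule has_derivative_zero_unique[of "{p..T}"])
      fix t assume t: "t \<in> {p..T}"
      have "continuous_on {p..T} (\<lambda>r. r powr (a - 1) *\<^sub>R fvol a u r)"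
        by (intro continuous_intros continuous_on_subset[OF fvol_continuous]) (use p in auto)
      then have "continuous_on {p..T} w"
        by (rule continuous_on_eq) (use p in \<open>auto simp: w_def kern_def\<close>)
      then have "(rl 0 w has_vector_derivative w t) (at t within {p..T})"
        by (intro rl0_has_vector_derivative w t)
      moreover have "w t = (a / t) *\<^sub>R rl 0 w t"
      proof -
        have "w t = t powr (a - 1) *\<^sub>R fvol a u t"
          using t p by (auto simp: w_def kern_def)
        also have "\<dots> = (1 / t) *\<^sub>R (t powr a *\<^sub>R fvol a u t)"
          using t p by (auto simp: powr_diff)
        also have "\<dots> = (a / t) *\<^sub>R rl 0 w t"
          using t p by (subst eq) auto
        finally show ?thesis .
      qed
      moreover have "((\<lambda>x. x powr (-a)) has_real_derivative (-a * t powr (-a-1))) (at t within {p..T})"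
        using t p by (auto intro!: derivative_eq_intros)
      ultimately have "((\<lambda>x. x powr (-a) *\<^sub>R rl 0 w x) has_vector_derivative
          t powr (-a) *\<^sub>R ((a / t) *\<^sub>R rl 0 w t) + (-a * t powr (-a-1)) *\<^sub>R rl 0 w t) (at t within {p..T})"
        by (intro has_vector_derivative_scaleR) auto
      also have "t powr (-a) *\<^sub>R ((a / t) *\<^sub>R rl 0 w t) + (-a * t powr (-a-1)) *\<^sub>R rl 0 w t = 0"
        using t p by (simp add: powr_diff scaleR_left_distrib[symmetric])
      finally show "((\<lambda>x. x powr (-a) *\<^sub>R rl 0 w x) has_derivative (\<lambda>h. 0)) (at t within {p..T})"
        by (simp add: has_vector_derivative_def)
    qed (use xy p in auto)
  qed
  define g where "g = a *\<^sub>R (T powr (-a) *\<^sub>R rl 0 w T)"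
  have G: "fvol a u t = g" if "t \<in> {0<..T}" for t
  proof -
    have "fvol a u t = t powr (-a) *\<^sub>R (t powr a *\<^sub>R fvol a u t)"
      using that by (simp add: powr_add[symmetric])
    also have "\<dots> = a *\<^sub>R (t powr (-a) *\<^sub>R rl 0 w t)"
      using that by (subst eq) auto
    also have "\<dots> = g" unfolding g_def using const[OF that, of T] T by simp
    finally show ?thesis .
  qed
  have "(fvol a u \<longlongrightarrow> fvol a u 0) (at_right 0)"
    using fvol_continuous T by (rule continuous_on_Icc_at_rightD)
  moreover have "(fvol a u \<longlongrightarrow> g) (at_right 0)"
  proof (rule Lim_transform_eventually[OF tendsto_const])
    show "\<forall>\<^sub>F x in at_right 0. g = fvol a u x"
      using eventually_at_right_real[OF T] by eventually_elim (use G in auto)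
  qed
  ultimately have "g = fvol a u 0"
    using tendsto_unique trivial_limit_at_right_real by blast
  then have "g = 0" using fvol_0[OF a u] by simp
  with G t fvol_0[OF a u] show ?thesis by (cases "t = 0") auto
qed

text \<open>Abel's inversion. Applying \<open>rl (-a)\<close> to G = \<open>rl a w\<close> = 0 gives
  a multiple of \<open>rl 1 w\<close>, since the orders add up to -a + a + 1 = 1. This is the second
  primitive of w: one differentiation of a continuous function yields \<open>rl 0 w\<close> = 0, and
  \<open>AE_zero\<close> does the rest.\<close>

lemma kop_injective:
  assumes "\<And>t. t \<in> {0..T} \<Longrightarrow> kop T a u t = 0"
  shows "AE s in lborel. u s = 0"
proof -
  define w where "w = (\<lambda>s. kern (- a) s *\<^sub>R u s)"
  have w: "integrable lborel w" unfolding w_def by (rule weight_integrable[OF a u])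
  have w0: "w r = 0" if "r \<le> 0" for r using that by (simp add: w_def)
  have wT: "w r = 0" if "r > T" for r using that u by (simp add: w_def sqint_def)
  have G: "rl a w t = 0" if "t \<le> T" for t
  proof (cases "t \<ge> 0")
    case True
    then show ?thesis using kop_zero_imp_fvol_zero[OF assms, of t] that by (simp add: fvol_def w_def)
  next
    case False
    then have "kern a (t - s) *\<^sub>R w s = 0" for s
      using w0[of s] by (cases "s \<le> 0") auto
    then show ?thesis by (simp only: rl_def integral_zero)
  qed
  have rl1: "rl 1 w t = 0" if "t \<le> T" for t
  proof -
    have "rl (-a) (rl a w) t = 0"
    proof -
      have "kern (-a) (t - s) *\<^sub>R rl a w s = 0" for s
        using G[of s] that by (cases "s < t") auto
      then show ?thesis by (simp only: rl_def[of "-a"] integral_zero)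
    qed
    then show ?thesis
      using rl_rl[OF w w0, of "-a" a t] a Beta_real_pos[of "1-a" "a+1"] by (auto simp: abs_if split: if_splits)
  qed
  have rlneg: "rl 0 w t = 0" if "t \<le> 0" for t
  proof -
    have "kern 0 (t - s) *\<^sub>R w s = 0" for s
      using w0[of s] that by (cases "s \<le> 0") auto
    then show ?thesis by (simp only: rl_def integral_zero)
  qed
  have "rl 0 w t = 0" if "t \<in> {0..T}" for t
  proof (rule rl0_zero_imp_zero[OF rl0_continuous[OF w] _ _ T that])
    show "rl 0 (rl 0 w) t = 0" if "t \<in> {0..T}" for t
      using rl_rl[OF w w0, of 0 0 t] rl1[of t] that by simp
  qed (use rlneg in auto)
  then have rw: "rl 0 w t = 0" if "t \<le> T" for t
    using that rlneg[of t] by (cases "t \<ge> 0") auto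
  have "rl 0 w t = 0" for t
  proof (cases "t \<le> T")
    case False
    have "integral {T..t} w = 0"
      by (rule integral_unique, rule has_integral_spike_finite[of "{T}" _ _ "\<lambda>_. 0"]) (use wT in auto)
    then show ?thesis using rl0_split(1)[OF w, of T t] rw[of T] False by simp
  qed (rule rw)
  from AE_zero[OF w this wT] have "AE s in lborel. w s = 0" by blast
  then show ?thesis
  proof eventually_elim
    case (elim s)
    then show ?case using u by (cases "s > 0") (auto simp: w_def kern_def sqint_def)
  qed
qed

end

section \<open>The kernel operator in terms of fractional integrals\<close>

lemma lebesgue_measurable_borel_version:
  fixes f :: "'a \<Rightarrow> 'b::euclidean_space"
  assumes [measurable]: "f \<in> borel_measurable (completion M)"
  obtains g where "g \<in> borel_measurable M" "AE x in M. f x = g x"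
proof -
  have "\<exists>g\<in>borel_measurable M. AE x in M. f x \<bullet> i = g x" for i
    by (rule completion_ex_borel_measurable_real) measurable
  then obtain g where g: "\<And>i. g i \<in> borel_measurable M" "\<And>i. AE x in M. f x \<bullet> i = g i x"
    by metis
  show ?thesis
  proof (rule that[of "\<lambda>x. \<Sum>i\<in>Basis. g i x *\<^sub>R i"])
    show "(\<lambda>x. \<Sum>i\<in>Basis. g i x *\<^sub>R i) \<in> borel_measurable M"
      using g(1) by auto
    have "AE x in M. \<forall>i\<in>Basis. f x \<bullet> i = g i x"
      using g(2) by (simp add: AE_finite_all)
    then show "AE x in M. f x = (\<Sum>i\<in>Basis. g i x *\<^sub>R i)"
      by eventually_elim (metis (no_types, lifting) euclidean_representation sum.cong)
  qed
qed

text \<open>Treats the second term of the kernel: exchanging the order moves the integral of r^(a-1)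
  (r - s)^a outside, and the inner integral over s becomes G(r). For absolute convergence s is
  integrated first, where \<open>fvol_bound\<close> leaves the integrable r^(a-1/2).\<close>

lemma volume_Fubini:
  fixes v :: "real \<Rightarrow> 'b::euclidean_space"
  assumes a: "\<bar>a\<bar> < 1/2" and v: "sqint T v" and t: "0 \<le> t" "t \<le> T"
  defines "I \<equiv> \<lambda>s. LINT r|lborel. kern (a - 1) r * kern a (r - s) * kern 0 (t - r)"
  shows "integrable lborel (\<lambda>s. (kern (-a) s * I s) *\<^sub>R v s)"
    and "(LINT s|lborel. (kern (-a) s * I s) *\<^sub>R v s)
      = rl 0 (\<lambda>r. (kern (a - 1) r * indicator {..T} r) *\<^sub>R fvol a v r) t"
proof -
  note [measurable] = sqint_measurable[OF a v]
  define F where "F = (\<lambda>r s. (kern (a - 1) r * kern 0 (t - r)) *\<^sub>R ((kern a (r - s) * kern (-a) s) *\<^sub>R v s))"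
  define C where "C = \<bar>sqrt (Beta (2*a+1) (-2*a+1) * (LINT s|lborel. (norm (v s))\<^sup>2))\<bar>"
  have C: "(LINT s|lborel. norm ((kern a (r - s) * kern (-a) s) *\<^sub>R v s)) \<le> C * kern (1/2) r" for r
    unfolding C_def by (rule order_trans[OF fvol_bound(2)[OF a v]]) (auto intro!: mult_right_mono)
  have C0: "C \<ge> 0" by (simp add: C_def)
  have meas [measurable]: "(\<lambda>(r, s). F r s) \<in> borel_measurable (lborel \<Otimes>\<^sub>M lborel)"
    unfolding F_def by measurable
  have int: "integrable (lborel \<Otimes>\<^sub>M lborel) (\<lambda>(r, s). F r s)"
  proof (rule lborel_pair.Fubini_integrable)
    show "integrable lborel (\<lambda>r. LINT s|lborel. norm (case (r, s) of (r, s) \<Rightarrow> F r s))"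
    proof (rule Bochner_Integration.integrable_bound)
      show "integrable lborel (\<lambda>r. C * (kern (a - 1/2) r * indicator {..t} r))"
        using kern_has_integral[of "a - 1/2" t] a t by (intro integrable_mult_right) (auto simp: has_bochner_integral_iff)
      show "AE r in lborel. norm (LINT s|lborel. norm (case (r, s) of (r, s) \<Rightarrow> F r s))
          \<le> norm (C * (kern (a - 1/2) r * indicator {..t} r))"
      proof (rule AE_I2)
        fix r
        have "(LINT s|lborel. norm (F r s))
            = (kern (a - 1) r * kern 0 (t - r)) * (LINT s|lborel. norm ((kern a (r - s) * kern (-a) s) *\<^sub>R v s))"
          unfolding F_def norm_scaleR[of "kern (a - 1) r * kern 0 (t - r)"]
          by (simp only: integral_mult_right_zero) (simp add: abs_mult)
        also have "\<dots> \<le> (kern (a - 1) r * kern 0 (t - r)) * (C * kern (1/2) r)"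
          by (intro mult_left_mono C) auto
        also have "\<dots> = C * ((kern (a - 1) r * kern (1/2) r) * kern 0 (t - r))"
          by (simp add: algebra_simps)
        also have "kern (a - 1) r * kern (1/2) r = kern (a - 1/2) r"
          by (simp add: kern_mult)
        also have "C * (kern (a - 1/2) r * kern 0 (t - r)) \<le> C * (kern (a - 1/2) r * indicator {..t} r)"
          by (intro mult_left_mono C0) (auto simp: kern_def split: split_indicator)
        finally show "norm (LINT s|lborel. norm (case (r, s) of (r, s) \<Rightarrow> F r s))
          \<le> norm (C * (kern (a - 1/2) r * indicator {..t} r))"
          using C0 by simp
      qed
    qed measurable
    show "AE r in lborel. integrable lborel (\<lambda>s. case (r, s) of (r, s) \<Rightarrow> F r s)"
      unfolding F_def by (auto intro!: integrable_scaleR_right fvol_bound(1)[OF a v] simp del: scaleR_scaleR)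
  qed simp
  have Is: "(LINT r|lborel. F r s) = (kern (-a) s * I s) *\<^sub>R v s" for s
  proof -
    have "F r s = (kern (-a) s * (kern (a - 1) r * kern a (r - s) * kern 0 (t - r))) *\<^sub>R v s" for r
      by (simp add: F_def mult_ac)
    moreover have "(LINT r|lborel. (kern (-a) s * (kern (a - 1) r * kern a (r - s) * kern 0 (t - r))) *\<^sub>R v s)
        = (kern (-a) s * I s) *\<^sub>R v s"
    proof (cases "kern (-a) s = 0 \<or> v s = 0")
      case False
      \<comment> \<open>For r > s > 0 the weight r^(a-1) is at most s^(a-1), which leaves a Beta
        integral in r.\<close>
      have bnd: "integrable lborel (\<lambda>r. kern (a - 1) r * kern a (r - s) * kern 0 (t - r))"
      proof (rule Bochner_Integration.integrable_bound)
        have s: "s > 0" using False by (auto simp: kern_def split: if_splits)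
        show "integrable lborel (\<lambda>r. (s powr (a - 1)) * (kern a (r - s) * kern 0 (t - r)))"
          using kern_beta[of 0 a t s] a
          by (intro integrable_mult_right) (auto simp: has_bochner_integral_iff mult.commute)
        show "AE r in lborel. norm (kern (a - 1) r * kern a (r - s) * kern 0 (t - r))
            \<le> norm ((s powr (a - 1)) * (kern a (r - s) * kern 0 (t - r)))"
        proof (rule AE_I2)
          fix r
          have "kern (a - 1) r \<le> s powr (a - 1)" if "r > s"
            using that s a powr_mono2'[of "a - 1" s r] by (auto simp: kern_def)
          then show "norm (kern (a - 1) r * kern a (r - s) * kern 0 (t - r))
            \<le> norm ((s powr (a - 1)) * (kern a (r - s) * kern 0 (t - r)))"
            by (cases "r > s") (auto simp: abs_mult mult.assoc intro!: mult_right_mono)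
        qed
      qed measurable
      then show ?thesis
        unfolding I_def by (simp add: integral_scaleR_left)
    qed auto
    ultimately show ?thesis by simp
  qed
  have "(LINT r|lborel. LINT s|lborel. F r s)
      = rl 0 (\<lambda>r. (kern (a - 1) r * indicator {..T} r) *\<^sub>R fvol a v r) t"
  proof -
    have "(LINT s|lborel. F r s) = kern 0 (t - r) *\<^sub>R (kern (a - 1) r * indicator {..T} r) *\<^sub>R fvol a v r" for r
    proof -
      have "(LINT s|lborel. F r s) = (kern (a - 1) r * kern 0 (t - r)) *\<^sub>R fvol a v r"
        unfolding F_def fvol_def rl_def[of a] scaleR_scaleR[of "kern a _"]
        by (rule integral_scaleR_right)
      then show ?thesis using t by (auto simp: kern_def split: split_indicator)
    qed
    then show ?thesis by (simp only: rl_def)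
  qed
  then show "(LINT s|lborel. (kern (-a) s * I s) *\<^sub>R v s)
      = rl 0 (\<lambda>r. (kern (a - 1) r * indicator {..T} r) *\<^sub>R fvol a v r) t"
    using lborel_pair.Fubini_integral[OF int] by (simp only: Is)
  show "integrable lborel (\<lambda>s. (kern (-a) s * I s) *\<^sub>R v s)"
    using lborel_pair.integrable_snd[OF int] by (simp only: Is)
qed

lemma K_kernel_eq:
  assumes "0 < s" "s < t" and a: "a = H - 1/2"
  shows "K_kernel H t s = c_H H * (t powr a * (kern a (t - s) * kern (-a) s)
     - a * (kern (-a) s * (LINT r|lborel. kern (a - 1) r * kern a (r - s) * kern 0 (t - r))))"
proof -
  let ?I = "LINT r|lborel. kern (a - 1) r * kern a (r - s) * kern 0 (t - r)"
  have exps: "H - 3/2 = a - 1" "1/2 - H = -a" "H - 1/2 = a" using a by auto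
  have "(LINT u:{s..t}|lebesgue. u powr (a - 1) * (u - s) powr a)
      = (LINT u|lborel. indicator {s..t} u *\<^sub>R (u powr (a - 1) * (u - s) powr a))"
    unfolding set_lebesgue_integral_def by (rule integral_completion) measurable
  also have "\<dots> = ?I"
    using AE_lborel_singleton[of t] assms(1,2)
    by (intro integral_cong_AE) (auto elim!: eventually_mono simp: kern_def split: split_indicator)
  finally have 1: "(LINT u:{s..t}|lebesgue. u powr (a - 1) * (u - s) powr a) = ?I" .
  have 2: "(t / s) powr a = t powr a * s powr (-a)"
    using assms(1,2) by (simp add: powr_divide powr_minus_divide)
  have 3: "kern a (t - s) = (t - s) powr a" "kern (-a) s = s powr (-a)"
    using assms(1,2) by (auto simp: kern_def)
  show ?thesis
    unfolding K_kernel_def exps 1 2 3 by (simp only: mult_ac)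
qed

text \<open>In the form of \<open>K_kernel_eq\<close> the first term of the kernel integrates to t^a
  G(t) and the second is \<open>volume_Fubini\<close>. Passing from u to v changes the integrand on
  a null set only.\<close>

lemma K_op_eq_kop:
  fixes u v :: "real \<Rightarrow> real^'n"
  assumes H: "0 < H" "H < 1" and u: "u \<in> L2 T" and v: "sqint T v"
    and uv: "AE s in lborel. s \<in> {0..T} \<longrightarrow> u s = v s" and t: "t \<in> {0..T}"
  shows "K_op H u t = c_H H *\<^sub>R kop T (H - 1/2) v t"
proof -
  define a where "a = H - 1/2"
  have a: "\<bar>a\<bar> < 1/2" using H by (auto simp: a_def abs_if)
  note [measurable] = sqint_measurable[OF a v]
  define I where "I = (\<lambda>s. LINT r|lborel. kern (a - 1) r * kern a (r - s) * kern 0 (t - r))"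
  define k where "k = (\<lambda>s. c_H H * (t powr a * (kern a (t - s) * kern (-a) s) - a * (kern (-a) s * I s)))"
  have [measurable]: "k \<in> borel_measurable borel"
    unfolding k_def I_def by measurable
  have [measurable]: "k \<in> borel_measurable lebesgue" by (rule measurable_completion) simp
  have u_m: "(\<lambda>s. indicator {0..T} s *\<^sub>R u s) \<in> borel_measurable lebesgue"
    using u by (simp add: L2_def set_borel_measurable_def)
  have outside: "k s *\<^sub>R v s = 0" if "s \<notin> {0<..<t}" for s
  proof (cases "s \<le> 0")
    case False
    with that have "s \<ge> t" by auto
    then have "kern (a - 1) r * kern a (r - s) * kern 0 (t - r) = 0" for r
      by (cases "r < t") auto
    then have "I s = 0" by (simp only: I_def integral_zero)
    then show ?thesis using \<open>s \<ge> t\<close> by (simp add: k_def)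
  qed (simp add: k_def)
  have "K_op H u t = (LINT s|lebesgue. indicator {0<..<t} s *\<^sub>R (k s *\<^sub>R (indicator {0..T} s *\<^sub>R u s)))"
    unfolding K_op_def set_lebesgue_integral_def using t
    by (intro Bochner_Integration.integral_cong)
      (auto split: split_indicator simp: K_kernel_eq[OF _ _ a_def] k_def I_def)
  also have "\<dots> = (LINT s|lebesgue. k s *\<^sub>R v s)"
  proof (rule integral_cong_AE)
    have "AE s in lebesgue. s \<in> {0..T} \<longrightarrow> u s = v s"
      using uv by (rule AE_completion)
    then show "AE s in lebesgue. indicator {0<..<t} s *\<^sub>R (k s *\<^sub>R (indicator {0..T} s *\<^sub>R u s)) = k s *\<^sub>R v s"
    proof eventually_elim
      case (elim s)
      then show ?case using outside[of s] t by (auto split: split_indicator)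
    qed
    show "(\<lambda>s. indicator {0<..<t} s *\<^sub>R (k s *\<^sub>R (indicator {0..T} s *\<^sub>R u s))) \<in> borel_measurable lebesgue"
      by (intro borel_measurable_scaleR u_m borel_measurable_indicator) auto
    show "(\<lambda>s. k s *\<^sub>R v s) \<in> borel_measurable lebesgue"
      by (rule measurable_completion) measurable
  qed
  also have "\<dots> = (LINT s|lborel. k s *\<^sub>R v s)"
    by (rule integral_completion) measurable
  also have "\<dots> = (LINT s|lborel. c_H H *\<^sub>R (t powr a *\<^sub>R ((kern a (t - s) * kern (-a) s) *\<^sub>R v s)
      - a *\<^sub>R ((kern (-a) s * I s) *\<^sub>R v s)))"
    by (simp add: k_def algebra_simps)
  also have "\<dots> = c_H H *\<^sub>R kop T a v t"
    using volume_Fubini[OF a v, of t] fvol_bound(1)[OF a v, of t] t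
    by (simp del: scaleR_scaleR add: kop_def I_def fvol_def rl_def[of a] Bochner_Integration.integral_diff)
      (simp add: rl_def)
  finally show ?thesis by (simp add: a_def)
qed

section \<open>Abel's equation with Hoelder continuous data\<close>

lemma kern_tail:
  assumes "p < -1" "c > 0"
  shows "has_bochner_integral lborel (\<lambda>y. kern p y * indicator {c..} y) (- (c powr (p + 1)) / (p + 1))"
proof -
  have "(kern p has_integral (- (c powr (p + 1)) / (p + 1))) {c..}"
    by (rule has_integral_spike_finite[OF _ _ has_integral_powr_to_inf[OF assms], of "{}"])
      (use assms in \<open>auto simp: kern_def\<close>)
  then have I: "((\<lambda>y. if y \<in> {c..} then kern p y else 0) has_integral (- (c powr (p + 1)) / (p + 1))) UNIV"
    by (simp only: has_integral_restrict_UNIV)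
  also have "(\<lambda>y. if y \<in> {c..} then kern p y else 0) = (\<lambda>y. kern p y * indicator {c..} y)"
    by (auto simp: fun_eq_iff)
  finally have I: "((\<lambda>y. kern p y * indicator {c..} y) has_integral (- (c powr (p + 1)) / (p + 1))) UNIV" .
  then have "integral\<^sup>N lborel (\<lambda>y. ennreal (kern p y * indicator {c..} y))
      = ennreal (- (c powr (p + 1)) / (p + 1))"
    by (intro nn_integral_has_integral_lborel) auto
  then show ?thesis
    using has_integral_nonneg[OF I] by (intro has_bochner_integral_nn_integral) auto
qed

text \<open>Weakens Lipschitz bounds on an interval of length T to Hoelder bounds of exponent 1/2;
  all factors \<open>sqrt T\<close> below come from here or from bounding a function by its
  increment from 0.\<close>

lemma abs_le_sqrt_mult_sqrt:
  assumes "\<bar>y\<bar> \<le> T"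
  shows "\<bar>y\<bar> \<le> sqrt T * sqrt \<bar>y\<bar>"
proof -
  have "\<bar>y\<bar> = sqrt \<bar>y\<bar> * sqrt \<bar>y\<bar>" by simp
  also have "\<dots> \<le> sqrt T * sqrt \<bar>y\<bar>" using assms by (intro mult_right_mono) auto
  finally show ?thesis .
qed

lemma half_holder_on_continuous:
  assumes "\<And>s r. s \<in> S \<Longrightarrow> r \<in> S \<Longrightarrow> norm (f s - f r) \<le> A * sqrt \<bar>s - r\<bar>"
  shows "continuous_on S f"
  unfolding continuous_on_eq_continuous_within continuous_within
proof
  fix x assume x: "x \<in> S"
  have "((\<lambda>y. A * sqrt \<bar>y - x\<bar>) \<longlongrightarrow> A * sqrt \<bar>x - x\<bar>) (at x within S)" by (intro tendsto_intros)
  then have "((\<lambda>y. A * sqrt \<bar>y - x\<bar>) \<longlongrightarrow> 0) (at x within S)" by simp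
  moreover have "\<forall>\<^sub>F y in at x within S. norm (f y - f x) \<le> A * sqrt \<bar>y - x\<bar>"
    using assms x by (auto simp: eventually_at_filter)
  ultimately have "((\<lambda>y. f y - f x) \<longlongrightarrow> 0) (at x within S)"
    by (rule Lim_null_comparison[rotated])
  then show "(f \<longlongrightarrow> f x) (at x within S)" by (rule LIM_zero_cancel)
qed

text \<open>Required on the whole line because the Marchaud integral evaluates f at t - y for every
  y > 0.\<close>

definition half_holder :: "real \<Rightarrow> (real \<Rightarrow> 'b::real_normed_vector) \<Rightarrow> bool" where
  "half_holder A f \<longleftrightarrow> (\<forall>x y. norm (f x - f y) \<le> A * sqrt \<bar>x - y\<bar>)"

lemma half_holderD: "half_holder A f \<Longrightarrow> norm (f x - f y) \<le> A * sqrt \<bar>x - y\<bar>"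
  by (auto simp: half_holder_def)

lemma half_holder_continuous: "half_holder A f \<Longrightarrow> continuous_on S f"
  by (rule half_holder_on_continuous) (rule half_holderD)

context
  fixes a A \<tau> T :: real and f :: "real \<Rightarrow> 'b::euclidean_space"
  assumes f: "half_holder A f" and f0: "\<And>t. t \<le> \<tau> \<Longrightarrow> f t = 0" and \<tau>: "0 \<le> \<tau>" and T: "0 < T"
begin

lemma half_holder_nonneg: "0 \<le> A"
  using order_trans[OF norm_ge_zero half_holderD[OF f, of 1 0]] by simp

lemma half_holder_measurable [measurable]: "f \<in> borel_measurable borel"
  by (intro borel_measurable_continuous_onI half_holder_continuous[OF f])

lemma half_holder_bound: "t \<le> T \<Longrightarrow> norm (f t) \<le> A * sqrt T"
proof -
  assume t: "t \<le> T"
  show ?thesis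
  proof (cases "t \<le> 0")
    case True
    then show ?thesis using f0[of t] \<tau> half_holder_nonneg T by auto
  next
    case False
    have "norm (f t) \<le> A * sqrt t"
      using half_holderD[OF f, of t 0] f0[of 0] \<tau> False by simp
    also have "\<dots> \<le> A * sqrt T"
      using t half_holder_nonneg by (intro mult_left_mono) auto
    finally show ?thesis .
  qed
qed

lemma half_holder_cut_integrable: "integrable lborel (\<lambda>t. indicator {..T} t *\<^sub>R f t)"
proof (rule Bochner_Integration.integrable_bound)
  show "integrable lborel (\<lambda>t. (A * sqrt T) * (indicator {0..T} t :: real))"
    by (intro integrable_mult_right integrable_real_indicator) (use T in auto)
  have "norm (indicator {..T} t *\<^sub>R f t) \<le> norm ((A * sqrt T) * (indicator {0..T} t :: real))" for t
    using half_holder_bound[of t] f0[of t] \<tau> half_holder_nonneg T by (cases "t < 0") (auto split: split_indicator)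
  then show "AE t in lborel. norm (indicator {..T} t *\<^sub>R f t) \<le> norm ((A * sqrt T) * (indicator {0..T} t :: real))"
    by simp
qed measurable

text \<open>Here \<open>w\<close> is the Marchaud derivative of \<open>f\<close>, extended by \<open>0\<close> to the negative axis. That its primitive
  is \<open>rl (-a) f\<close> follows from two applications of Fubini's theorem, since
  \<open>\<integral>\<^sub>0\<^sup>x (f t - f (t - y)) dt\<close> is the integral of \<open>f\<close> over \<open>{x - y..x}\<close>; nothing has to be differentiated.\<close>

lemma marchaud_pos:
  assumes a: "0 < a" "a < 1/2"
  defines "w \<equiv> \<lambda>t. indicator {..T} t *\<^sub>R (a *\<^sub>R (LINT y|lborel. kern (-a-1) y *\<^sub>R (f t - f (t - y))))"
  shows "w \<in> borel_measurable borel"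
    and "t \<le> \<tau> \<Longrightarrow> w t = 0"
    and "norm (w t) \<le> a * (T powr (1/2 - a) / (1/2 - a) + sqrt T * (T powr (-a) / a)) * A"
    and "x \<in> {0..T} \<Longrightarrow> rl 0 w x = rl (-a) (\<lambda>t. indicator {..T} t *\<^sub>R f t) x"
proof -
  show w_meas [measurable]: "w \<in> borel_measurable borel" unfolding w_def by measurable
  show w0: "w t = 0" if "t \<le> \<tau>" for t
  proof -
    have "kern (-a-1) y *\<^sub>R (f t - f (t - y)) = 0" for y
      using that f0[of t] f0[of "t - y"] by (cases "y > 0") auto
    then show ?thesis by (simp only: w_def integral_zero scaleR_zero_right)
  qed
  \<comment> \<open>For y <= T the Hoelder bound turns y^(-a-1) into y^(-a-1/2), integrable at 0
    because a < 1/2. For y > T the value f(t - y) is 0 and f(t) is bounded, while y^(-a-1) is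
    integrable at infinity because a > 0. The range y > t as a whole supplies the usual boundary
    term t^(-a) f(t).\<close>
  let ?h = "\<lambda>y. A * (kern (-a-1/2) y * indicator {..T} y + sqrt T * (kern (-a-1) y * indicator {T..} y))"
  let ?C = "T powr (1/2 - a) / (1/2 - a) + sqrt T * (T powr (-a) / a)"
  have h: "has_bochner_integral lborel ?h (A * ?C)"
  proof -
    have "has_bochner_integral lborel (\<lambda>y. kern (-a-1/2) y * indicator {..T} y) (T powr (1/2 - a) / (1/2 - a))"
      using kern_has_integral[of "-a-1/2" T] a T by (simp add: algebra_simps)
    moreover have "has_bochner_integral lborel (\<lambda>y. kern (-a-1) y * indicator {T..} y) (T powr (-a) / a)"
      using kern_tail[of "-a-1" T] a T by simp
    ultimately show ?thesis
      by (intro has_bochner_integral_mult_right has_bochner_integral_add)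
  qed
  have le: "norm (kern (-a-1) y *\<^sub>R (f t - f (t - y))) \<le> ?h y" if t: "t \<le> T" for t y
  proof (cases "0 < y")
    case y: True
    show ?thesis
    proof (cases "y \<le> T")
      case True
      have "kern (-a-1) y * norm (f t - f (t - y)) \<le> kern (-a-1) y * (A * sqrt y)"
        using half_holderD[OF f, of t "t - y"] y by (intro mult_left_mono) auto
      also have "\<dots> = A * (kern (-a-1) y * kern (1/2) y)"
        using y by (simp add: kern_def powr_half_sqrt)
      also have "kern (-a-1) y * kern (1/2) y = kern (-a-1/2) y"
        by (simp only: kern_mult) (rule arg_cong2[where f = kern], auto)
      also have "A * kern (-a-1/2) y \<le> ?h y"
        using True half_holder_nonneg T by (intro mult_left_mono) auto
      finally show ?thesis by simp
    next
      case False
      then have "f (t - y) = 0" using t \<tau> by (intro f0) auto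
      then have "kern (-a-1) y * norm (f t - f (t - y)) \<le> kern (-a-1) y * (A * sqrt T)"
        using half_holder_bound[OF t] by (intro mult_left_mono) auto
      then show ?thesis using False by (simp add: mult_ac)
    qed
  qed (use half_holder_nonneg in simp)
  have inner: "integrable lborel (\<lambda>y. kern (-a-1) y *\<^sub>R (f t - f (t - y)))" if "t \<le> T" for t
  proof (rule Bochner_Integration.integrable_bound)
    show "integrable lborel ?h" using h by (simp add: has_bochner_integral_iff)
    show "AE y in lborel. norm (kern (-a-1) y *\<^sub>R (f t - f (t - y))) \<le> norm (?h y)"
      using le[OF that] by (intro AE_I2) (metis abs_ge_self order_trans real_norm_def)
  qed measurable
  have innernorm: "(LINT y|lborel. norm (kern (-a-1) y *\<^sub>R (f t - f (t - y)))) \<le> A * ?C" if "t \<le> T" for t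
  proof -
    have "(LINT y|lborel. norm (kern (-a-1) y *\<^sub>R (f t - f (t - y)))) \<le> integral\<^sup>L lborel ?h"
      using h inner[OF that] le[OF that] by (intro integral_mono) (auto simp only: has_bochner_integral_iff intro!: integrable_norm)
    then show ?thesis using h by (simp only: has_bochner_integral_iff)
  qed
  have C0: "0 \<le> ?C" using a T by auto
  show "norm (w t) \<le> a * ?C * A"
  proof (cases "t \<le> T")
    case True
    have "norm (w t) = a * norm (LINT y|lborel. kern (-a-1) y *\<^sub>R (f t - f (t - y)))"
      using True a by (simp add: w_def)
    also have "\<dots> \<le> a * (A * ?C)"
      using a by (intro mult_left_mono order_trans[OF integral_norm_bound innernorm[OF True]]) auto
    finally show ?thesis by (simp add: mult_ac)
  next
    case False
    then have "norm (w t) = 0" by (simp add: w_def)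
    also have "0 \<le> a * ?C * A" using a half_holder_nonneg C0 by (intro mult_nonneg_nonneg) auto
    finally show ?thesis .
  qed
  show "rl 0 w x = rl (-a) (\<lambda>t. indicator {..T} t *\<^sub>R f t) x" if x: "x \<in> {0..T}"
  proof -
    define F where "F = (\<lambda>t y. kern 0 (x - t) *\<^sub>R (kern (-a-1) y *\<^sub>R (f t - f (t - y))))"
    \<comment> \<open>The same double integral after the shift by y: f(s) survives for x - y <= s <
      x. Integrating over y >= x - s then yields (x - s)^(-a) / a, the kernel of
      \<open>rl (-a)\<close>; this is why w carries the factor a.\<close>
    define G where "G = (\<lambda>s y. (kern 0 (x - s) * (indicator {x - s..} y * kern (-a-1) y)) *\<^sub>R f s)"
    have [measurable]: "(\<lambda>(t, y). F t y) \<in> borel_measurable (lborel \<Otimes>\<^sub>M lborel)"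
      unfolding F_def by measurable
    have [measurable]: "Measurable.pred (lborel \<Otimes>\<^sub>M lborel) (\<lambda>z. x - fst z \<le> snd z)" by measurable
    have G_alt: "G = (\<lambda>s y. (kern 0 (x - s) * ((if x - s \<le> y then 1 else 0) * kern (-a-1) y)) *\<^sub>R f s)"
      by (auto simp: G_def fun_eq_iff)
    have [measurable]: "(\<lambda>(s, y). G s y) \<in> borel_measurable (lborel \<Otimes>\<^sub>M lborel)"
      unfolding G_alt by measurable
    have Fnull: "F t y = 0" if "t \<notin> {0..x}" for t y
    proof (cases "t < 0 \<and> y > 0")
      case True
      then show ?thesis using f0[of t] f0[of "t - y"] \<tau> by (simp add: F_def)
    next
      case False
      then show ?thesis using that by (auto simp: F_def)
    qed
    have intF: "integrable (lborel \<Otimes>\<^sub>M lborel) (\<lambda>(t, y). F t y)"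
    proof (rule lborel_pair.Fubini_integrable)
      show "integrable lborel (\<lambda>t. LINT y|lborel. norm (case (t, y) of (t, y) \<Rightarrow> F t y))"
      proof (rule Bochner_Integration.integrable_bound)
        show "integrable lborel (\<lambda>t. (A * ?C) * (indicator {0..T} t :: real))"
          by (intro integrable_mult_right integrable_real_indicator) (use T in auto)
        have "norm (LINT y|lborel. norm (F t y)) \<le> norm ((A * ?C) * (indicator {0..T} t :: real))" for t
        proof (cases "t \<in> {0..x}")
          case True
          then have t: "t \<le> T" using x by auto
          have "(LINT y|lborel. norm (F t y)) = kern 0 (x - t) * (LINT y|lborel. norm (kern (-a-1) y *\<^sub>R (f t - f (t - y))))"
            unfolding F_def norm_scaleR[of "kern 0 _"] abs_of_nonneg[OF kern_nonneg] by (rule integral_mult_right_zero)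
          also have "\<dots> \<le> 1 * (A * ?C)"
            using innernorm[OF t] by (intro mult_mono) (auto simp: kern_def)
          finally show ?thesis using True x by auto
        next
          case False
          then show ?thesis by (simp add: Fnull)
        qed
        then show "AE t in lborel. norm (LINT y|lborel. norm (case (t, y) of (t, y) \<Rightarrow> F t y))
            \<le> norm ((A * ?C) * (indicator {0..T} t :: real))" by simp
      qed measurable
      have "integrable lborel (F t)" for t
      proof (cases "t \<le> T")
        case True
        then show ?thesis unfolding F_def by (intro integrable_scaleR_right inner)
      next
        case False
        then have "F t = (\<lambda>y. 0)" using x by (intro ext Fnull) auto
        then show ?thesis by simp
      qed
      then show "AE t in lborel. integrable lborel (\<lambda>y. case (t, y) of (t, y) \<Rightarrow> F t y)" by simp
    qed simp
    have Gin: "has_bochner_integral lborel (\<lambda>y. G s y) ((1 / a) *\<^sub>R (kern (-a) (x - s) *\<^sub>R (indicator {..T} s *\<^sub>R f s)))"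
      and Gnorm: "(LINT y|lborel. norm (G s y)) = (1 / a) * (kern (-a) (x - s) * norm (indicator {..T} s *\<^sub>R f s))" for s
    proof -
      have *: "has_bochner_integral lborel (\<lambda>y. kern 0 (x - s) * (indicator {x - s..} y * kern (-a-1) y))
          ((1 / a) * (kern (-a) (x - s) * indicator {..T} s))"
      proof (cases "s < x")
        case True
        then have "has_bochner_integral lborel (\<lambda>y. kern (-a-1) y * indicator {x - s..} y) ((x - s) powr (-a) / a)"
          using kern_tail[of "-a-1" "x - s"] a by simp
        then show ?thesis using True x by (simp add: kern_def[of 0] kern_def[of "-a"] mult.commute)
      qed (simp add: has_bochner_integral_zero)
      show "has_bochner_integral lborel (\<lambda>y. G s y) ((1 / a) *\<^sub>R (kern (-a) (x - s) *\<^sub>R (indicator {..T} s *\<^sub>R f s)))"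
        using has_bochner_integral_scaleR_left[OF *, of "f s"] by (simp add: G_def mult.assoc)
      have "has_bochner_integral lborel (\<lambda>y. (kern 0 (x - s) * (indicator {x - s..} y * kern (-a-1) y)) * norm (f s))
          ((1 / a) * (kern (-a) (x - s) * indicator {..T} s) * norm (f s))"
        using * by (rule has_bochner_integral_mult_left)
      from has_bochner_integral_integral_eq[OF this]
      show "(LINT y|lborel. norm (G s y)) = (1 / a) * (kern (-a) (x - s) * norm (indicator {..T} s *\<^sub>R f s))"
        by (simp add: G_def abs_mult mult.assoc)
    qed
    have intG: "integrable (lborel \<Otimes>\<^sub>M lborel) (\<lambda>(s, y). G s y)"
    proof (rule lborel_pair.Fubini_integrable)
      show "integrable lborel (\<lambda>s. LINT y|lborel. norm (case (s, y) of (s, y) \<Rightarrow> G s y))"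
      proof (rule Bochner_Integration.integrable_bound)
        show "integrable lborel (\<lambda>s. (1 / a * (A * sqrt T)) * (kern (-a) (x - s) * indicator {..x} (x - s)))"
          using kern_reflected[of "-a" x x] a x by (intro integrable_mult_right) (auto simp: has_bochner_integral_iff)
        have "norm (LINT y|lborel. norm (G s y)) \<le> norm ((1 / a * (A * sqrt T)) * (kern (-a) (x - s) * indicator {..x} (x - s)))" for s
        proof -
          have "kern (-a) (x - s) * norm (indicator {..T} s *\<^sub>R f s) \<le> (A * sqrt T) * (kern (-a) (x - s) * indicator {..x} (x - s))"
          proof (cases "s < 0 \<or> s \<ge> x")
            case True
            then show ?thesis using f0[of s] \<tau> half_holder_nonneg T by auto
          next
            case False
            then show ?thesis using half_holder_bound[of s] x by (auto simp: mult.commute[of "kern (-a) (x - s)"] intro!: mult_right_mono)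
          qed
          then show ?thesis
            unfolding Gnorm using a half_holder_nonneg T by (simp add: divide_right_mono)
        qed
        then show "AE s in lborel. norm (LINT y|lborel. norm (case (s, y) of (s, y) \<Rightarrow> G s y))
          \<le> norm ((1 / a * (A * sqrt T)) * (kern (-a) (x - s) * indicator {..x} (x - s)))" by simp
      qed measurable
      show "AE s in lborel. integrable lborel (\<lambda>y. case (s, y) of (s, y) \<Rightarrow> G s y)"
        using Gin by (auto simp: has_bochner_integral_iff)
    qed simp
    have FG: "(LINT t|lborel. F t y) = (LINT s|lborel. G s y)" for y
    proof (cases "0 < y")
      case False
      then show ?thesis by (simp add: F_def G_def)
    next
      case y: True
      have i1: "integrable lborel (\<lambda>t. indicator {..<z} t *\<^sub>R f t)" if "z \<le> T" for z
      proof (rule Bochner_Integration.integrable_bound[OF half_holder_cut_integrable])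
      qed (use that in \<open>auto split: split_indicator\<close>)
      have "(LINT t|lborel. F t y) = kern (-a-1) y *\<^sub>R (LINT t|lborel. indicator {..<x} t *\<^sub>R f t - indicator {..<x} t *\<^sub>R f (t - y))"
        unfolding F_def by (subst integral_scaleR_right[symmetric])
          (auto intro!: Bochner_Integration.integral_cong simp: kern_def algebra_simps split: split_indicator)
      also have "(LINT t|lborel. indicator {..<x} t *\<^sub>R f t - indicator {..<x} t *\<^sub>R f (t - y))
          = (LINT t|lborel. indicator {..<x} t *\<^sub>R f t) - (LINT t|lborel. indicator {..<x} t *\<^sub>R f (t - y))"
      proof (rule Bochner_Integration.integral_diff)
        show "integrable lborel (\<lambda>t. indicator {..<x} t *\<^sub>R f t)" using i1 x by auto
        have "integrable lborel (\<lambda>t. indicator {..<x - y} (- y + 1 * t) *\<^sub>R f (- y + 1 * t))"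
          using x y by (intro lborel_integrable_real_affine i1) auto
        also have "(\<lambda>t. indicator {..<x - y} (- y + 1 * t) *\<^sub>R f (- y + 1 * t)) = (\<lambda>t. indicator {..<x} t *\<^sub>R f (t - y))"
          by (auto simp: fun_eq_iff split: split_indicator)
        finally show "integrable lborel (\<lambda>t. indicator {..<x} t *\<^sub>R f (t - y))" .
      qed
      also have "(LINT t|lborel. indicator {..<x} t *\<^sub>R f (t - y)) = (LINT t|lborel. indicator {..<x - y} t *\<^sub>R f t)"
        by (subst lborel_integral_real_affine[where c = 1 and t = "-y"])
          (auto intro!: Bochner_Integration.integral_cong split: split_indicator)
      also have "(LINT t|lborel. indicator {..<x} t *\<^sub>R f t) - (LINT t|lborel. indicator {..<x - y} t *\<^sub>R f t)
          = (LINT t|lborel. indicator {..<x} t *\<^sub>R f t - indicator {..<x - y} t *\<^sub>R f t)"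
        using x y by (intro Bochner_Integration.integral_diff[symmetric] i1) auto
      also have "kern (-a-1) y *\<^sub>R \<dots>
          = (LINT t|lborel. kern (-a-1) y *\<^sub>R (indicator {..<x} t *\<^sub>R f t - indicator {..<x - y} t *\<^sub>R f t))"
        by (rule integral_scaleR_right[symmetric])
      also have "\<dots> = (LINT s|lborel. G s y)"
        unfolding G_def using y
        by (intro Bochner_Integration.integral_cong) (auto simp: kern_def[of 0] split: split_indicator)
      finally show ?thesis .
    qed
    have "rl 0 w x = a *\<^sub>R (LINT t|lborel. LINT y|lborel. F t y)"
    proof -
      have "kern 0 (x - t) *\<^sub>R w t = a *\<^sub>R (LINT y|lborel. F t y)" for t
      proof (cases "t < x")
        case True
        then show ?thesis using x by (simp add: F_def w_def kern_def[of 0])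
      qed (simp add: F_def)
      then have "rl 0 w x = (LINT t|lborel. a *\<^sub>R (LINT y|lborel. F t y))"
        by (simp only: rl_def)
      then show ?thesis by (simp only: integral_scaleR_right)
    qed
    also have "(LINT t|lborel. LINT y|lborel. F t y) = (LINT s|lborel. LINT y|lborel. G s y)"
      using lborel_pair.Fubini_integral[OF intF] lborel_pair.Fubini_integral[OF intG] by (simp only: FG)
    also have "a *\<^sub>R \<dots> = rl (-a) (\<lambda>t. indicator {..T} t *\<^sub>R f t) x"
      unfolding has_bochner_integral_integral_eq[OF Gin] rl_def using a by (simp del: scaleR_scaleR add: integral_scaleR_right) simp
    finally show ?thesis .
  qed
qed

end

declare half_holder_measurable [measurable del]

text \<open>For a < 0 no differentiation is involved: \<open>rl (-a)\<close> has order 1 - a > 1, so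
  its derivative is again a fractional integral, of order -a. The semigroup law with orders p = 0
  and q = -a - 1 gives the constant \<open>Beta 1 (-a)\<close>.\<close>

lemma marchaud_neg:
  fixes f :: "real \<Rightarrow> 'b::euclidean_space"
  assumes f: "half_holder A f" "\<And>t. t \<le> \<tau> \<Longrightarrow> f t = 0" "0 \<le> \<tau>" and T: "0 < T"
    and a: "- 1/2 < a" "a < 0"
  defines "g \<equiv> \<lambda>t. indicator {..T} t *\<^sub>R f t"
  defines "w \<equiv> \<lambda>t. indicator {..T} t *\<^sub>R ((1 / Beta 1 (-a)) *\<^sub>R rl (-a-1) g t)"
  shows "w \<in> borel_measurable borel"
    and "t \<le> \<tau> \<Longrightarrow> w t = 0"
    and "norm (w t) \<le> (1 / Beta 1 (-a)) * (sqrt T * (T powr (-a) / (-a))) * A"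
    and "x \<in> {0..T} \<Longrightarrow> rl 0 w x = rl (-a) g x"
proof -
  have A: "0 \<le> A" using half_holder_nonneg[OF f T] .
  have [measurable]: "f \<in> borel_measurable borel" using half_holder_measurable[OF f T] .
  have gm [measurable]: "g \<in> borel_measurable borel" unfolding g_def by measurable
  have g: "integrable lborel g" unfolding g_def by (rule half_holder_cut_integrable[OF f T])
  have g0: "g t = 0" if "t \<le> 0" for t using that f by (simp add: g_def)
  have B: "Beta 1 (-a) > 0" using a by (intro Beta_real_pos) auto
  show "w \<in> borel_measurable borel" unfolding w_def by measurable
  show "w t = 0" if "t \<le> \<tau>" for t
  proof -
    have "kern (-a-1) (t - s) *\<^sub>R g s = 0" for s
      using that f(2)[of s] by (cases "s < t") (auto simp: g_def)
    then show ?thesis by (simp only: w_def rl_def integral_zero scaleR_zero_right)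
  qed
  show "norm (w t) \<le> (1 / Beta 1 (-a)) * (sqrt T * (T powr (-a) / (-a))) * A" for t
  proof (cases "t \<le> T")
    case True
    let ?h = "\<lambda>s. (A * sqrt T) * (kern (-a-1) (t - s) * indicator {..T} (t - s))"
    have h: "has_bochner_integral lborel ?h ((A * sqrt T) * (T powr (-a) / (-a)))"
      using kern_reflected[of "-a-1" T t] a T by (intro has_bochner_integral_mult_right) auto
    have le: "norm (kern (-a-1) (t - s) *\<^sub>R g s) \<le> ?h s" for s
    proof (cases "s \<le> 0 \<or> s \<ge> t")
      case False
      then have "norm (g s) \<le> A * sqrt T"
        using half_holder_bound[OF f T, of s] True by (simp add: g_def)
      then have "kern (-a-1) (t - s) * norm (g s) \<le> kern (-a-1) (t - s) * (A * sqrt T)"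
        by (rule mult_left_mono) simp
      moreover have "indicator {..T} (t - s) = (1::real)" using False True by simp
      ultimately show ?thesis by (simp only: norm_scaleR abs_of_nonneg[OF kern_nonneg] mult_1_right mult.commute[of "A * sqrt T"])
    next
      case True
      then have "kern (-a-1) (t - s) *\<^sub>R g s = 0" using g0[of s] by auto
      moreover have "0 \<le> ?h s" using A T by (intro mult_nonneg_nonneg) auto
      ultimately show ?thesis by (simp only: norm_zero)
    qed
    have "norm (rl (-a-1) g t) \<le> integral\<^sup>L lborel ?h"
      unfolding rl_def
    proof (rule Bochner_Integration.integral_norm_bound_integral)
      show "integrable lborel ?h" using h by (simp add: has_bochner_integral_iff)
      then show "integrable lborel (\<lambda>s. kern (-a-1) (t - s) *\<^sub>R g s)"
      proof (rule Bochner_Integration.integrable_bound)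
        show "AE s in lborel. norm (kern (-a-1) (t - s) *\<^sub>R g s) \<le> norm (?h s)"
          by (intro AE_I2 order_trans[OF le]) simp
      qed measurable
    qed (rule le)
    also have "\<dots> = (A * sqrt T) * (T powr (-a) / (-a))" using h by (simp only: has_bochner_integral_iff)
    finally have "(1 / Beta 1 (-a)) * norm (rl (-a-1) g t) \<le> (1 / Beta 1 (-a)) * ((A * sqrt T) * (T powr (-a) / (-a)))"
      using B by (intro mult_left_mono) auto
    moreover have "norm (w t) = (1 / Beta 1 (-a)) * norm (rl (-a-1) g t)"
      using True B by (simp add: w_def)
    ultimately have "norm (w t) \<le> (1 / Beta 1 (-a)) * ((A * sqrt T) * (T powr (-a) / (-a)))"
      by (simp only:)
    then show ?thesis by (simp add: mult_ac)
  next
    case False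
    have "0 \<le> (1 / Beta 1 (-a)) * (sqrt T * (T powr (-a) / (-a))) * A"
      using A B T a by (intro mult_nonneg_nonneg divide_nonneg_pos) auto
    then show ?thesis using False by (simp add: w_def)
  qed
  show "rl 0 w x = rl (-a) g x" if x: "x \<in> {0..T}" for x
  proof -
    have "kern 0 (x - t) *\<^sub>R w t = (1 / Beta 1 (-a)) *\<^sub>R (kern 0 (x - t) *\<^sub>R rl (-a-1) g t)" for t
      using x by (cases "t < x") (auto simp: w_def)
    then have "rl 0 w x = (1 / Beta 1 (-a)) *\<^sub>R rl 0 (rl (-a-1) g) x"
      by (simp only: rl_def[of 0] integral_scaleR_right)
    also have "\<dots> = rl (-a) g x"
      using rl_rl[OF g g0, of 0 "-a-1" x] a B by simp
    finally show ?thesis .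
  qed
qed

text \<open>Unites the three signs of a: w is a derivative of \<open>rl (-a) f\<close>, namely a
  fractional integral, f itself, or the Marchaud derivative. That C is chosen before A, \<tau> and f
  is what later makes the cost quadratic in the size of the perturbation.\<close>

lemma marchaud:
  fixes a T :: real
  assumes a: "\<bar>a\<bar> < 1/2" and T: "0 < T"
  obtains C where "0 \<le> C"
    "\<And>A \<tau> (f :: real \<Rightarrow> 'b::euclidean_space). half_holder A f \<Longrightarrow> (\<And>t. t \<le> \<tau> \<Longrightarrow> f t = 0) \<Longrightarrow> 0 \<le> \<tau> \<Longrightarrow>
       \<exists>w \<in> borel_measurable borel. (\<forall>t. t \<le> \<tau> \<or> t > T \<longrightarrow> w t = 0) \<and> (\<forall>t. norm (w t) \<le> C * A) \<and>
         (\<forall>x\<in>{0..T}. rl 0 w x = rl (-a) (\<lambda>t. indicator {..T} t *\<^sub>R f t) x)"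
proof (cases a "0::real" rule: linorder_cases)
  case less
  have "0 \<le> (1 / Beta 1 (-a)) * (sqrt T * (T powr (-a) / (-a)))"
    using less T Beta_real_pos[of 1 "-a"] by (intro mult_nonneg_nonneg divide_nonneg_pos) auto
  then show ?thesis
  proof (rule that)
    fix A \<tau> and f :: "real \<Rightarrow> 'b"
    assume f: "half_holder A f" "\<And>t. t \<le> \<tau> \<Longrightarrow> f t = 0" "0 \<le> \<tau>"
    have "- 1/2 < a" using a by auto
    from marchaud_neg[OF f T this less] show "\<exists>w \<in> borel_measurable borel. (\<forall>t. t \<le> \<tau> \<or> t > T \<longrightarrow> w t = 0) \<and>
        (\<forall>t. norm (w t) \<le> (1 / Beta 1 (-a)) * (sqrt T * (T powr (-a) / (-a))) * A) \<and>
        (\<forall>x\<in>{0..T}. rl 0 w x = rl (-a) (\<lambda>t. indicator {..T} t *\<^sub>R f t) x)"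
      by (intro bexI[of _ "\<lambda>t. indicator {..T} t *\<^sub>R ((1 / Beta 1 (-a)) *\<^sub>R rl (-a-1) (\<lambda>t. indicator {..T} t *\<^sub>R f t) t)"])
        (auto simp only: indicator_simps atMost_iff not_le scaleR_zero_left)
  qed
next
  case equal
  have "0 \<le> sqrt T" using T by simp
  then show ?thesis
  proof (rule that)
    fix A \<tau> and f :: "real \<Rightarrow> 'b"
    assume f: "half_holder A f" "\<And>t. t \<le> \<tau> \<Longrightarrow> f t = 0" "0 \<le> \<tau>"
    have [measurable]: "f \<in> borel_measurable borel" using half_holder_measurable[OF f T] .
    have "norm (indicator {..T} t *\<^sub>R f t) \<le> sqrt T * A" for t
      using half_holder_bound[OF f T, of t] half_holder_nonneg[OF f T] T by (cases "t \<le> T") (auto simp: mult.commute)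
    then show "\<exists>w \<in> borel_measurable borel. (\<forall>t. t \<le> \<tau> \<or> t > T \<longrightarrow> w t = 0) \<and> (\<forall>t. norm (w t) \<le> sqrt T * A) \<and>
        (\<forall>x\<in>{0..T}. rl 0 w x = rl (-a) (\<lambda>t. indicator {..T} t *\<^sub>R f t) x)"
      using f(2) equal by (intro bexI[of _ "\<lambda>t. indicator {..T} t *\<^sub>R f t"]) auto
  qed
next
  case greater
  have "0 \<le> a * (T powr (1/2 - a) / (1/2 - a) + sqrt T * (T powr (-a) / a))"
    using a greater T by (intro mult_nonneg_nonneg add_nonneg_nonneg) auto
  then show ?thesis
  proof (rule that)
    fix A \<tau> and f :: "real \<Rightarrow> 'b"
    assume f: "half_holder A f" "\<And>t. t \<le> \<tau> \<Longrightarrow> f t = 0" "0 \<le> \<tau>"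
    have "a < 1/2" using a by auto
    from marchaud_pos[OF f T greater this]
    show "\<exists>w \<in> borel_measurable borel. (\<forall>t. t \<le> \<tau> \<or> t > T \<longrightarrow> w t = 0) \<and>
        (\<forall>t. norm (w t) \<le> a * (T powr (1/2 - a) / (1/2 - a) + sqrt T * (T powr (-a) / a)) * A) \<and>
        (\<forall>x\<in>{0..T}. rl 0 w x = rl (-a) (\<lambda>t. indicator {..T} t *\<^sub>R f t) x)"
      by (intro bexI[of _ "\<lambda>t. indicator {..T} t *\<^sub>R (a *\<^sub>R (LINT y|lborel. kern (-a-1) y *\<^sub>R (f t - f (t - y))))"])
        (auto simp only: indicator_simps atMost_iff not_le scaleR_zero_left)
  qed
qed

section \<open>Solving the Volterra equation for densities vanishing near 0\<close>

lemma powr_bound_interval: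
  fixes s \<tau> T p :: real
  assumes "0 < \<tau>" "\<tau> \<le> s" "s \<le> T"
  shows "s powr p \<le> \<tau> powr p + T powr p"
  using assms powr_mono2[of p s T] powr_mono2'[of p \<tau> s] by (cases "p \<ge> 0") (auto intro: order_trans)

lemma powr_lipschitz_interval:
  fixes s r \<tau> T p :: real
  assumes "0 < \<tau>" "s \<in> {\<tau>..T}" "r \<in> {\<tau>..T}"
  shows "\<bar>s powr p - r powr p\<bar> \<le> \<bar>p\<bar> * (\<tau> powr (p - 1) + T powr (p - 1)) * \<bar>s - r\<bar>"
proof -
  have "norm (s powr p - r powr p) \<le> (\<bar>p\<bar> * (\<tau> powr (p - 1) + T powr (p - 1))) * norm (s - r)"
  proof (rule field_differentiable_bound[of "{\<tau>..T}" _ "\<lambda>x. p * x powr (p - 1)"])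
    fix z assume z: "z \<in> {\<tau>..T}"
    then show "((\<lambda>x. x powr p) has_field_derivative p * z powr (p - 1)) (at z within {\<tau>..T})"
      using assms by (auto intro!: derivative_eq_intros)
    show "norm (p * z powr (p - 1)) \<le> \<bar>p\<bar> * (\<tau> powr (p - 1) + T powr (p - 1))"
      using powr_bound_interval[of \<tau> z T "p - 1"] z assms by (auto simp: abs_mult intro: mult_left_mono)
  qed (use assms in auto)
  then show ?thesis by simp
qed

text \<open>On [\<tau>,T] the weight is bounded and Lipschitz, so the product stays Hoelder
  continuous. Clamping time to [\<tau>,T] does not increase distances, and since f vanishes at
  \<tau> it extends the product by 0 to the left. The last factor T combines \<open>sqrt T\<close>
  from weakening the Lipschitz bound with \<open>sqrt T\<close> from the bound on f.\<close>

lemma half_holder_weighted_extension: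
  fixes f :: "real \<Rightarrow> 'b::real_normed_vector"
  assumes f: "\<And>s r. s \<in> {0..T} \<Longrightarrow> r \<in> {0..T} \<Longrightarrow> norm (f s - f r) \<le> A * sqrt \<bar>s - r\<bar>"
    and f0: "\<And>s. s \<in> {0..\<tau>} \<Longrightarrow> f s = 0" and \<tau>: "0 < \<tau>" "\<tau> < T"
  shows "half_holder ((\<tau> powr p + T powr p + \<bar>p\<bar> * (\<tau> powr (p - 1) + T powr (p - 1)) * T) * A)
     (\<lambda>t. max \<tau> (min t T) powr p *\<^sub>R f (max \<tau> (min t T)))"
  unfolding half_holder_def
proof (intro allI)
  fix x y :: real
  define s r where "s = max \<tau> (min x T)" and "r = max \<tau> (min y T)"
  let ?M = "\<tau> powr p + T powr p" and ?L = "\<bar>p\<bar> * (\<tau> powr (p - 1) + T powr (p - 1))"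
  have sr: "s \<in> {\<tau>..T}" "r \<in> {\<tau>..T}" "\<bar>s - r\<bar> \<le> \<bar>x - y\<bar>"
    using \<tau> by (auto simp: s_def r_def max_def min_def)
  have A: "0 \<le> A"
    using order_trans[OF norm_ge_zero f[of 0 T]] \<tau> by (auto simp: zero_le_mult_iff)
  have fr: "norm (f r) \<le> A * sqrt T"
  proof -
    have "norm (f r) \<le> A * sqrt r" using f[of r 0] f0[of 0] sr \<tau> by simp
    also have "\<dots> \<le> A * sqrt T" using sr A by (intro mult_left_mono) auto
    finally show ?thesis .
  qed
  have "norm (s powr p *\<^sub>R f s - r powr p *\<^sub>R f r) = norm (s powr p *\<^sub>R (f s - f r) + (s powr p - r powr p) *\<^sub>R f r)"
    by (simp add: algebra_simps)
  also have "\<dots> \<le> s powr p * norm (f s - f r) + \<bar>s powr p - r powr p\<bar> * norm (f r)"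
    by (rule order_trans[OF norm_triangle_ineq]) simp
  also have "\<dots> \<le> ?M * (A * sqrt \<bar>s - r\<bar>) + (?L * \<bar>s - r\<bar>) * (A * sqrt T)"
    using powr_bound_interval[of \<tau> s T p] powr_lipschitz_interval[of \<tau> s T r p] f[of s r] fr sr \<tau> A
    by (intro add_mono mult_mono) auto
  also have "\<dots> \<le> ?M * (A * sqrt \<bar>s - r\<bar>) + ?L * T * A * sqrt \<bar>s - r\<bar>"
  proof -
    have T2: "sqrt T * sqrt T = T" using \<tau> by simp
    have "\<bar>s - r\<bar> \<le> sqrt T * sqrt \<bar>s - r\<bar>"
      by (rule abs_le_sqrt_mult_sqrt) (use sr \<tau> in auto)
    then have "?L * \<bar>s - r\<bar> * (A * sqrt T) \<le> ?L * (sqrt T * sqrt \<bar>s - r\<bar>) * (A * sqrt T)"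
      using A \<tau> by (intro mult_right_mono mult_left_mono) auto
    also have "\<dots> = ?L * (sqrt T * sqrt T) * A * sqrt \<bar>s - r\<bar>"
      by (simp only: mult_ac)
    finally show ?thesis unfolding T2 by simp
  qed
  also have "\<dots> = (?M + ?L * T) * A * sqrt \<bar>s - r\<bar>"
    by (simp only: distrib_right mult.assoc)
  also have "\<dots> \<le> (?M + ?L * T) * A * sqrt \<bar>x - y\<bar>"
    using sr A \<tau> by (intro mult_left_mono) auto
  finally show "norm (max \<tau> (min x T) powr p *\<^sub>R f (max \<tau> (min x T)) - max \<tau> (min y T) powr p *\<^sub>R f (max \<tau> (min y T)))
      \<le> (?M + ?L * T) * A * sqrt \<bar>x - y\<bar>"
    by (simp only: s_def r_def)
qed

lemma rl_scaleR: "rl p (\<lambda>t. c *\<^sub>R w t) x = c *\<^sub>R rl p w x"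
  unfolding rl_def integral_scaleR_right[symmetric] by (simp add: scaleR_left_commute mult.commute)

text \<open>The weights cancel, so the left side is \<open>rl a w\<close>. As the hypothesis only
  speaks of the primitive of w, the primitives of both sides are compared:
  \<open>rl 0 (rl a w)\<close> = \<open>rl a (rl 0 w)\<close> = \<open>rl a (rl (-a) g)\<close>,
  which is the Beta factor times \<open>rl 1 g\<close> = \<open>rl 0 (rl 0 g)\<close>. Both sides
  are continuous, so they agree.\<close>

lemma fvol_inversion:
  fixes w g :: "real \<Rightarrow> 'b::euclidean_space"
  assumes a: "\<bar>a\<bar> < 1/2" and T: "0 < T"
    and v: "sqint T (\<lambda>s. kern a s *\<^sub>R w s)"
    and w: "integrable lborel w" "\<And>t. t \<le> 0 \<Longrightarrow> w t = 0"
    and g: "integrable lborel g" "\<And>t. t \<le> 0 \<Longrightarrow> g t = 0"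
    and wg: "\<And>x. x \<in> {0..T} \<Longrightarrow> rl 0 w x = rl (-a) g x"
    and t: "t \<in> {0..T}"
  shows "fvol a (\<lambda>s. kern a s *\<^sub>R w s) t = Beta (a + 1) (1 - a) *\<^sub>R rl 0 g t"
proof -
  have fv: "fvol a (\<lambda>s. kern a s *\<^sub>R w s) = rl a w"
  proof -
    have "kern (-a) s *\<^sub>R (kern a s *\<^sub>R w s) = w s" for s
      using w(2)[of s] by (cases "s > 0") (auto simp: kern_mult kern_def[of 0])
    then show ?thesis unfolding fvol_def by (simp only:)
  qed
  have neg: "rl p h t = 0" if "\<And>t. t \<le> 0 \<Longrightarrow> h t = 0" "t \<le> 0" for p t and h :: "real \<Rightarrow> 'b"
  proof -
    have "kern p (t - s) *\<^sub>R h s = 0" for s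
      using that by (cases "s < t") auto
    then show ?thesis by (simp only: rl_def integral_zero)
  qed
  have rl_diff: "rl 0 (\<lambda>t. rl a w t - Beta (a + 1) (1 - a) *\<^sub>R rl 0 g t) t
      = rl 0 (rl a w) t - Beta (a + 1) (1 - a) *\<^sub>R rl 0 (rl 0 g) t" if t: "t \<in> {0..T}" for t
  proof -
    have int: "integrable lborel (\<lambda>s. kern 0 (t - s) *\<^sub>R h s)"
      if "continuous_on {0..T} h" "\<And>t. t \<le> 0 \<Longrightarrow> h t = 0" for h :: "real \<Rightarrow> 'b"
    proof -
      have "set_integrable lborel {0..t} h"
        by (rule borel_integrable_atLeastAtMost', rule continuous_on_subset[OF that(1)]) (use t in auto)
      then have "integrable lborel (\<lambda>s. indicator {0..t} s *\<^sub>R h s)" by (simp add: set_integrable_def)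
      then have "integrable lborel (\<lambda>s. indicator {0..<t} s *\<^sub>R (indicator {0..t} s *\<^sub>R h s))"
        by (rule integrable_mult_indicator[rotated]) auto
      also have "(\<lambda>s. indicator {0..<t} s *\<^sub>R (indicator {0..t} s *\<^sub>R h s)) = (\<lambda>s. kern 0 (t - s) *\<^sub>R h s)"
      proof
        fix s
        show "indicator {0..<t} s *\<^sub>R (indicator {0..t} s *\<^sub>R h s) = kern 0 (t - s) *\<^sub>R h s"
          using that(2)[of s] by (cases "s \<le> 0") (auto simp: kern_def split: split_indicator)
      qed
      finally show ?thesis .
    qed
    have "integrable lborel (\<lambda>s. kern 0 (t - s) *\<^sub>R rl a w s)"
      using int[of "rl a w"] fvol_continuous[OF a v T] neg[OF w(2)] by (simp add: fv)
    moreover have "integrable lborel (\<lambda>s. kern 0 (t - s) *\<^sub>R rl 0 g s)"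
      using int[of "rl 0 g"] rl0_continuous[OF g(1)] neg[OF g(2)] by simp
    ultimately have "(LINT s|lborel. kern 0 (t - s) *\<^sub>R rl a w s - Beta (a + 1) (1 - a) *\<^sub>R (kern 0 (t - s) *\<^sub>R rl 0 g s))
      = rl 0 (rl a w) t - Beta (a + 1) (1 - a) *\<^sub>R rl 0 (rl 0 g) t"
      unfolding rl_def[of 0 "rl a w"] rl_def[of 0 "rl 0 g"] integral_scaleR_right[symmetric]
      by (intro Bochner_Integration.integral_diff integrable_scaleR_right)
    moreover have "kern 0 (t - s) *\<^sub>R (rl a w s - Beta (a + 1) (1 - a) *\<^sub>R rl 0 g s)
      = kern 0 (t - s) *\<^sub>R rl a w s - Beta (a + 1) (1 - a) *\<^sub>R (kern 0 (t - s) *\<^sub>R rl 0 g s)" for s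
      by (simp add: algebra_simps)
    ultimately show ?thesis by (simp only: rl_def[of 0 "\<lambda>t. rl a w t - Beta (a + 1) (1 - a) *\<^sub>R rl 0 g t"])
  qed
  have "rl a w t - Beta (a + 1) (1 - a) *\<^sub>R rl 0 g t = 0"
  proof (rule rl0_zero_imp_zero[OF _ _ _ T t])
    show "continuous_on {0..T} (\<lambda>t. rl a w t - Beta (a + 1) (1 - a) *\<^sub>R rl 0 g t)"
      using fvol_continuous[OF a v T] by (intro continuous_intros rl0_continuous g) (simp add: fv)
    show "rl a w t - Beta (a + 1) (1 - a) *\<^sub>R rl 0 g t = 0" if "t < 0" for t
      using that neg[where t = t and h = w, OF w(2)] neg[where t = t and h = g, OF g(2)] by simp
    fix t assume t: "t \<in> {0..T}"
    have "rl 0 (rl a w) t = rl a (rl 0 w) t"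
      using rl_rl[OF w, where p = 0 and q = a and t = t] rl_rl[OF w, where p = a and q = 0 and t = t] a Beta_commute[of 1 "a + 1"] by (auto simp: add.commute)
    also have "\<dots> = rl a (rl (-a) g) t"
    proof -
      have "kern a (t - s) *\<^sub>R rl 0 w s = kern a (t - s) *\<^sub>R rl (-a) g s" for s
        using wg[of s] t neg[where t = s and h = w, OF w(2)] neg[where t = s and h = g, OF g(2)] by (cases "s < 0"; cases "s < t") auto
      then show ?thesis by (simp only: rl_def[of a])
    qed
    also have "\<dots> = Beta (a + 1) (1 - a) *\<^sub>R rl 1 g t"
      using rl_rl[OF g, where p = a and q = "-a" and t = t] a by auto
    also have "rl 1 g t = rl 0 (rl 0 g) t"
    proof -
      have "Gamma (2::real) = 1" using Gamma_fact[of 1, where 'a = real] by (simp del: Gamma_fact)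
      then show ?thesis using rl_rl[OF g, where p = 0 and q = 0 and t = t] by (simp add: Beta_def)
    qed
    finally show "rl 0 (\<lambda>t. rl a w t - Beta (a + 1) (1 - a) *\<^sub>R rl 0 g t) t = 0"
      using rl_diff[OF t] by simp
  qed
  then show ?thesis by (simp add: fv)
qed

text \<open>Up to \<tau> both sides are 0. After \<tau> the derivative of \<open>kop\<close> is t^a
  G' = t^a g = f, the terms a t^(a-1) G having cancelled, so both sides have the same
  derivative.\<close>

lemma kop_of_fvol:
  fixes f :: "real \<Rightarrow> 'b::euclidean_space"
  assumes a: "\<bar>a\<bar> < 1/2" and v: "sqint T v" and \<tau>: "0 < \<tau>" "\<tau> < T"
    and f: "continuous_on {0..T} f" "\<And>s. s \<in> {0..\<tau>} \<Longrightarrow> f s = 0"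
    and g: "integrable lborel g" "continuous_on {\<tau>..T} g" "\<And>s. s \<in> {\<tau>..T} \<Longrightarrow> g s = s powr (-a) *\<^sub>R f s" "\<And>s. s \<le> \<tau> \<Longrightarrow> g s = 0"
    and fv: "\<And>t. t \<in> {0..T} \<Longrightarrow> fvol a v t = rl 0 g t"
    and t: "t \<in> {0..T}"
  shows "kop T a v t = integral {0..t} f"
proof -
  have T: "0 < T" using \<tau> by simp
  define w where "w = (\<lambda>r. (kern (a - 1) r * indicator {..T} r) *\<^sub>R fvol a v r)"
  have w: "integrable lborel w" unfolding w_def by (rule volume_integrable[OF a v T])
  have g0: "rl 0 g t = 0" if "t \<le> \<tau>" for t
  proof -
    have "kern 0 (t - s) *\<^sub>R g s = 0" for s
      using that g(4)[of s] by (cases "s < t") auto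
    then show ?thesis by (simp only: rl_def integral_zero)
  qed
  have w0: "rl 0 w t = 0" if "t \<le> \<tau>" for t
  proof -
    have "kern 0 (t - s) *\<^sub>R w s = 0" for s
      using that fv[of s] g0[of s] \<tau> by (cases "0 < s \<and> s < t") (auto simp: w_def not_less)
    then show ?thesis by (simp only: rl_def integral_zero)
  qed
  have k0: "kop T a v t = 0" if "t \<in> {0..\<tau>}" for t
    using that fv[of t] g0[of t] w0[of t] \<tau> by (simp add: kop_def flip: w_def)
  have i0: "integral {0..t} f = 0" if "t \<in> {0..\<tau>}" for t
  proof -
    have "integral {0..t} f = integral {0..t} (\<lambda>_. 0)"
      using that f(2) by (intro integral_cong) auto
    then show ?thesis by simp
  qed
  show ?thesis
  proof (cases "t \<le> \<tau>")
    case True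
    then show ?thesis using k0 i0 t by auto
  next
    case False
    have "kop T a v t - integral {0..t} f = kop T a v \<tau> - integral {0..\<tau>} f"
    proof (rule has_derivative_zero_unique[of "{\<tau>..T}"])
      fix x assume x: "x \<in> {\<tau>..T}"
      have fx: "fvol a v x = rl 0 g x" using fv[of x] x \<tau> by auto
      have fvd: "(fvol a v has_vector_derivative g x) (at x within {\<tau>..T})"
        using rl0_has_vector_derivative[OF g(1,2) x]
        by (rule has_vector_derivative_transform[OF x, rotated]) (use fv \<tau> in auto)
      have cw: "continuous_on {\<tau>..T} w"
      proof -
        have "continuous_on {\<tau>..T} (\<lambda>r. r powr (a - 1) *\<^sub>R fvol a v r)"
          by (intro continuous_intros continuous_on_subset[OF fvol_continuous[OF a v T]]) (use \<tau> in auto)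
        then show ?thesis
          by (rule continuous_on_eq) (use \<tau> in \<open>auto simp: w_def kern_def\<close>)
      qed
      have "(rl 0 w has_vector_derivative w x) (at x within {\<tau>..T})"
        by (rule rl0_has_vector_derivative[OF w cw x])
      note dw = bounded_linear.has_vector_derivative[OF bounded_linear_scaleR_right[of a] this]
      have dp: "((\<lambda>x. x powr a) has_real_derivative (a * x powr (a-1))) (at x within {\<tau>..T})"
        using x \<tau> by (auto intro!: derivative_eq_intros)
      have "((\<lambda>u. integral {0..u} f) has_vector_derivative f x) (at x within {\<tau>..T})"
        using integral_has_vector_derivative[OF f(1), of x] x \<tau>
        by (auto intro: has_vector_derivative_within_subset)
      note d1 = this
      have "((\<lambda>x. (x powr a *\<^sub>R fvol a v x - a *\<^sub>R rl 0 w x) - integral {0..x} f) has_vector_derivative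
          ((x powr a *\<^sub>R g x + (a * x powr (a-1)) *\<^sub>R fvol a v x) - a *\<^sub>R w x) - f x) (at x within {\<tau>..T})"
        by (intro has_vector_derivative_diff has_vector_derivative_scaleR fvd dp dw d1)
      also have "((x powr a *\<^sub>R g x + (a * x powr (a-1)) *\<^sub>R fvol a v x) - a *\<^sub>R w x) - f x = 0"
      proof -
        have "x powr a *\<^sub>R g x = f x"
          using g(3)[OF x] x \<tau> by (simp flip: powr_add)
        moreover have "w x = x powr (a-1) *\<^sub>R fvol a v x"
          using x \<tau> by (simp add: w_def kern_def)
        ultimately show ?thesis by simp
      qed
      finally show "((\<lambda>x. kop T a v x - integral {0..x} f) has_derivative (\<lambda>h. 0)) (at x within {\<tau>..T})"
        by (simp add: kop_def w_def has_vector_derivative_def)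
    qed (use False t \<tau> in auto)
    then show ?thesis using k0[of \<tau>] i0[of \<tau>] \<tau> by simp
  qed
qed

text \<open>Multiplying by \<open>s\<^sup>-\<^sup>a\<close> turns \<open>kop T a v = \<integral>f\<close> into the Abel equation \<open>fvol a v = \<integral> s\<^sup>-\<^sup>a f\<close>; that
  \<open>f\<close> vanishes near \<open>0\<close> keeps the weight bounded where it matters.\<close>

lemma kop_solution:
  fixes a T \<tau> :: real
  assumes a: "\<bar>a\<bar> < 1/2" and \<tau>: "0 < \<tau>" "\<tau> < T"
  obtains C where "0 \<le> C"
    "\<And>A (f :: real \<Rightarrow> 'b::euclidean_space).
       (\<And>s r. s \<in> {0..T} \<Longrightarrow> r \<in> {0..T} \<Longrightarrow> norm (f s - f r) \<le> A * sqrt \<bar>s - r\<bar>) \<Longrightarrow>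
       (\<And>s. s \<in> {0..\<tau>} \<Longrightarrow> f s = 0) \<Longrightarrow>
       \<exists>v. sqint T v \<and> (LINT s|lborel. (norm (v s))\<^sup>2) \<le> C * A\<^sup>2 \<and>
         (\<forall>t\<in>{0..T}. kop T a v t = integral {0..t} f)"
proof -
  have T: "0 < T" using \<tau> by simp
  obtain C0 where C0: "0 \<le> C0" and mar:
    "\<And>A \<tau> (f :: real \<Rightarrow> 'b). half_holder A f \<Longrightarrow> (\<And>t. t \<le> \<tau> \<Longrightarrow> f t = 0) \<Longrightarrow> 0 \<le> \<tau> \<Longrightarrow>
       \<exists>w \<in> borel_measurable borel. (\<forall>t. t \<le> \<tau> \<or> t > T \<longrightarrow> w t = 0) \<and> (\<forall>t. norm (w t) \<le> C0 * A) \<and>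
         (\<forall>x\<in>{0..T}. rl 0 w x = rl (-a) (\<lambda>t. indicator {..T} t *\<^sub>R f t) x)"
    using marchaud[OF a T] by blast
  \<comment> \<open>\<open>K * A\<close> is the Hoelder constant of the weighted extension of t^(-a)
    f, and \<open>B\<close> is the Beta factor of \<open>fvol_inversion\<close>, by which w is
    divided. \<open>D * A\<close> bounds the solution pointwise, so
    \<open>D\<^sup>2 * T * A\<^sup>2\<close> bounds the square of its norm.\<close>
  define K where "K = \<tau> powr (-a) + T powr (-a) + \<bar>-a\<bar> * (\<tau> powr (-a - 1) + T powr (-a - 1)) * T"
  define B where "B = Beta (a + 1) (1 - a)"
  have B: "B > 0" unfolding B_def using a by (intro Beta_real_pos) auto
  define D where "D = (\<tau> powr a + T powr a) * ((1 / B) * (C0 * K))"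
  show ?thesis
  proof (rule that[of "D\<^sup>2 * T"])
    show "0 \<le> D\<^sup>2 * T" using T by simp
    fix A and f :: "real \<Rightarrow> 'b"
    assume f: "\<And>s r. s \<in> {0..T} \<Longrightarrow> r \<in> {0..T} \<Longrightarrow> norm (f s - f r) \<le> A * sqrt \<bar>s - r\<bar>"
      and f0: "\<And>s. s \<in> {0..\<tau>} \<Longrightarrow> f s = 0"
    define \<phi> where "\<phi> = (\<lambda>t. max \<tau> (min t T) powr (-a) *\<^sub>R f (max \<tau> (min t T)))"
    have \<phi>: "half_holder (K * A) \<phi>"
      unfolding \<phi>_def K_def using f f0 \<tau> by (rule half_holder_weighted_extension)
    have \<phi>0: "\<phi> t = 0" if "t \<le> \<tau>" for t
      using that f0[of \<tau>] \<tau> by (auto simp: \<phi>_def max_def min_def)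
    define g where "g = (\<lambda>t. indicator {..T} t *\<^sub>R \<phi> t)"
    obtain w0 where [measurable]: "w0 \<in> borel_measurable borel" and w0: "\<And>t. t \<le> \<tau> \<or> t > T \<Longrightarrow> w0 t = 0"
        "\<And>t. norm (w0 t) \<le> C0 * (K * A)" "\<And>x. x \<in> {0..T} \<Longrightarrow> rl 0 w0 x = rl (-a) g x"
      using mar[OF \<phi> \<phi>0] \<tau> unfolding g_def by fastforce
    define w where "w = (\<lambda>s. (1 / B) *\<^sub>R w0 s)"
    have [measurable]: "w \<in> borel_measurable borel" unfolding w_def by measurable
    have w: "w t = 0" if "t \<le> \<tau> \<or> t > T" for t using w0(1)[OF that] by (simp add: w_def)
    have wb: "norm (w t) \<le> (1 / B) * (C0 * (K * A))" for t
      using w0(2)[of t] B by (simp add: w_def divide_right_mono)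
    have bounded_int: "integrable lborel h"
      if [measurable]: "h \<in> borel_measurable borel" and "\<And>t. norm (h t) \<le> M" "\<And>t. t \<notin> {0..T} \<Longrightarrow> h t = 0"
      for h :: "real \<Rightarrow> 'c::{banach, second_countable_topology}" and M
    proof (rule Bochner_Integration.integrable_bound)
      show "integrable lborel (\<lambda>t. M * (indicator {0..T} t :: real))"
        by (intro integrable_mult_right integrable_real_indicator) (use T in auto)
      have "norm (h t) \<le> norm (M * (indicator {0..T} t :: real))" for t
        using that(2)[of t] that(3)[of t] by (cases "t \<in> {0..T}") auto
      then show "AE t in lborel. norm (h t) \<le> norm (M * (indicator {0..T} t :: real))" by simp
    qed measurable
    have wint: "integrable lborel w" and w0int: "integrable lborel w0"
      using w \<tau> w0(1) by (auto intro!: bounded_int[OF _ wb] bounded_int[OF _ w0(2)])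
    define v where "v = (\<lambda>s. kern a s *\<^sub>R w s)"
    have [measurable]: "v \<in> borel_measurable borel" unfolding v_def by measurable
    have vb: "norm (v s) \<le> D * A * indicator {0..T} s" for s
    proof (cases "s \<le> \<tau> \<or> s > T")
      case True
      have "0 \<le> (\<tau> powr a + T powr a) * ((1 / B) * (C0 * (K * A)))"
        using order_trans[OF norm_ge_zero wb[of s]] by (rule mult_nonneg_nonneg[rotated]) simp
      then have "0 \<le> D * A * indicator {0..T} s" by (auto simp: D_def mult_ac split: split_indicator)
      then show ?thesis using w[OF True] by (simp only: v_def scaleR_zero_right norm_zero)
    next
      case False
      then have "kern a s \<le> \<tau> powr a + T powr a"
        using powr_bound_interval[of \<tau> s T a] \<tau> by (auto simp: kern_def)
      then have "kern a s * norm (w s) \<le> (\<tau> powr a + T powr a) * ((1 / B) * (C0 * (K * A)))"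
        using wb[of s] by (intro mult_mono) auto
      moreover have "indicator {0..T} s = (1::real)" using False \<tau> by auto
      ultimately show ?thesis by (simp add: v_def D_def mult_ac)
    qed
    have v0: "v t = 0" if "t \<notin> {0<..T}" for t
      using w[of t] that \<tau> by (auto simp: v_def)
    have v2: "(norm (v s))\<^sup>2 \<le> (D * A)\<^sup>2 * indicator {0..T} s" for s
      using power_mono[OF vb[of s], of 2] by (auto simp: power_mult_distrib split: split_indicator)
    have iD: "has_bochner_integral lborel (\<lambda>s. (D * A)\<^sup>2 * indicator {0..T} s) ((D * A)\<^sup>2 * T)"
      using has_bochner_integral_real_indicator[of "{0..T}" lborel] T
      by (intro has_bochner_integral_mult_right) auto
    have vi: "integrable lborel (\<lambda>s. (norm (v s))\<^sup>2)"
    proof (rule Bochner_Integration.integrable_bound)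
      show "integrable lborel (\<lambda>s. (D * A)\<^sup>2 * indicator {0..T} s)"
        using iD by (simp add: has_bochner_integral_iff)
      show "AE s in lborel. norm ((norm (v s))\<^sup>2) \<le> norm ((D * A)\<^sup>2 * indicator {0..T} s)"
        using v2 by (auto intro!: AE_I2 order_trans[OF v2])
    qed measurable
    have sq: "sqint T v" unfolding sqint_def using vi v0 by auto
    have "(LINT s|lborel. (norm (v s))\<^sup>2) \<le> (LINT s|lborel. (D * A)\<^sup>2 * indicator {0..T} s)"
      using iD vi v2 by (intro integral_mono) (auto simp: has_bochner_integral_iff)
    also have "\<dots> = D\<^sup>2 * T * A\<^sup>2"
      using iD by (simp only: has_bochner_integral_iff power_mult_distrib mult_ac)
    finally have nv: "(LINT s|lborel. (norm (v s))\<^sup>2) \<le> D\<^sup>2 * T * A\<^sup>2" .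
    have gint: "integrable lborel g" unfolding g_def
      by (rule half_holder_cut_integrable[OF \<phi> \<phi>0 _ T]) (use \<tau> in auto)
    have g0: "g t = 0" if "t \<le> \<tau>" for t using that \<phi>0 by (simp add: g_def)
    have rlw: "rl 0 w x = rl (-a) (\<lambda>t. (1 / B) *\<^sub>R g t) x" if "x \<in> {0..T}" for x
    proof -
      have "rl 0 w x = (1 / B) *\<^sub>R rl 0 w0 x"
        unfolding w_def by (rule rl_scaleR)
      also have "\<dots> = rl (-a) (\<lambda>t. (1 / B) *\<^sub>R g t) x"
        unfolding w0(3)[OF that] by (rule rl_scaleR[symmetric])
      finally show ?thesis .
    qed
    have fv: "fvol a v t = rl 0 g t" if "t \<in> {0..T}" for t
    proof -
      have "fvol a v t = Beta (a + 1) (1 - a) *\<^sub>R rl 0 (\<lambda>t. (1 / B) *\<^sub>R g t) t"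
        unfolding v_def using gint w g0 \<tau> rlw
        by (intro fvol_inversion[OF a T sq[unfolded v_def] wint _ _ _ _ that]) auto
      also have "rl 0 (\<lambda>t. (1 / B) *\<^sub>R g t) t = (1 / B) *\<^sub>R rl 0 g t"
        by (rule rl_scaleR)
      finally show ?thesis using B by (simp add: B_def)
    qed
    have fc: "continuous_on {0..T} f" using f by (rule half_holder_on_continuous)
    have "kop T a v t = integral {0..t} f" if t: "t \<in> {0..T}" for t
    proof (rule kop_of_fvol[OF a sq \<tau> fc f0 gint _ _ g0 fv t])
      show g_eq: "g s = s powr (-a) *\<^sub>R f s" if "s \<in> {\<tau>..T}" for s
        using that by (simp add: g_def \<phi>_def)
      show "continuous_on {\<tau>..T} g"
        by (rule continuous_on_eq[OF half_holder_continuous[OF \<phi>]]) (simp add: g_def)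
    qed
    then show "\<exists>v. sqint T v \<and> (LINT s|lborel. (norm (v s))\<^sup>2) \<le> D\<^sup>2 * T * A\<^sup>2 \<and>
         (\<forall>t\<in>{0..T}. kop T a v t = integral {0..t} f)"
      using sq nv by blast
  qed
qed

section \<open>The Young integral and the Cameron--Martin space\<close>

lemma bounded_bilinear_matrix_vector_mult:
  "bounded_bilinear ((*v) :: real^'n^'m \<Rightarrow> real^'n \<Rightarrow> real^'m)"
  by (auto simp: bilinear_def algebra_simps intro!: linearI simp flip: bilinear_conv_bounded_bilinear scaleR_matrix_vector_assoc)

interpretation mv: bounded_bilinear "(*v) :: real^'n^'m \<Rightarrow> real^'n \<Rightarrow> real^'m"
  by (rule bounded_bilinear_matrix_vector_mult)

lemma has_young_integral_unique:
  assumes I: "has_young_integral A g a b I" and J: "has_young_integral A g a b J"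
  shows "I = J"
proof -
  have "norm (I - J) \<le> 0 + e" if e: "e > 0" for e
  proof -
    let ?S = "\<lambda>\<D>. \<Sum>(x, k)\<in>\<D>. A x *v (g (Sup k) - g (Inf k))"
    obtain d1 where d1: "d1 > 0" "\<And>\<D>. \<D> tagged_division_of {a..b} \<Longrightarrow> (\<lambda>x. ball x d1) fine \<D> \<Longrightarrow> norm (?S \<D> - I) < e/2"
      using I e unfolding has_young_integral_def by (meson half_gt_zero)
    obtain d2 where d2: "d2 > 0" "\<And>\<D>. \<D> tagged_division_of {a..b} \<Longrightarrow> (\<lambda>x. ball x d2) fine \<D> \<Longrightarrow> norm (?S \<D> - J) < e/2"
      using J e unfolding has_young_integral_def by (meson half_gt_zero)
    have "gauge (\<lambda>x::real. ball x (min d1 d2))" using d1(1) d2(1) by (simp add: gauge_def)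
    then obtain \<D> where \<D>: "\<D> tagged_division_of {a..b}" "(\<lambda>x. ball x (min d1 d2)) fine \<D>"
      by (rule fine_division_exists_real)
    have "(\<lambda>x. ball x d1) fine \<D>" "(\<lambda>x. ball x d2) fine \<D>"
      using \<D>(2) by (auto simp: fine_def subset_iff)
    then have "norm (?S \<D> - I) < e/2" "norm (?S \<D> - J) < e/2" using d1(2) d2(2) \<D>(1) by auto
    moreover have "norm (I - J) \<le> norm (?S \<D> - J) + norm (?S \<D> - I)"
      using norm_triangle_ineq4[of "?S \<D> - J" "?S \<D> - I"] by simp
    ultimately show ?thesis by simp
  qed
  then have "norm (I - J) \<le> 0" by (rule field_le_epsilon)
  then show ?thesis by simp
qed

context
  fixes T m :: real and \<sigma> \<sigma>' :: "real \<Rightarrow> real^'n^'n"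
  assumes T: "0 < T"
    and d\<sigma>: "\<And>t. t \<in> {0..T} \<Longrightarrow> (\<sigma> has_vector_derivative \<sigma>' t) (at t within {0..T})"
    and c\<sigma>': "continuous_on {0..T} \<sigma>'"
    and m: "0 < m" and lower: "\<And>t y. t \<in> {0..T} \<Longrightarrow> m * norm y \<le> norm (\<sigma> t *v y)"
begin

lemma \<sigma>'_bound:
  obtains M where "0 < M" "\<And>t y. t \<in> {0..T} \<Longrightarrow> norm (\<sigma>' t *v y) \<le> M * norm y"
proof -
  obtain K where K: "0 < K" "\<And>(A::real^'n^'n) y. norm (A *v y) \<le> norm A * norm y * K"
    using mv.pos_bounded by blast
  have "bounded (\<sigma>' ` {0..T})"
    by (intro compact_imp_bounded compact_continuous_image c\<sigma>') auto
  then obtain B where B: "0 < B" "\<And>t. t \<in> {0..T} \<Longrightarrow> norm (\<sigma>' t) \<le> B"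
    by (auto simp: bounded_pos)
  show ?thesis
  proof (rule that)
    show "0 < B * K" using B K by simp
    fix t y assume t: "t \<in> {0..T}"
    have "norm (\<sigma>' t *v y) \<le> norm (\<sigma>' t) * norm y * K" by (rule K)
    also have "\<dots> \<le> B * norm y * K" using B(2)[OF t] K(1) by (intro mult_right_mono) auto
    finally show "norm (\<sigma>' t *v y) \<le> B * K * norm y" by (simp add: mult_ac)
  qed
qed

lemma \<sigma>'_mult_continuous: "continuous_on {0..T} g \<Longrightarrow> continuous_on {0..T} (\<lambda>s. \<sigma>' s *v g s)"
  by (intro mv.continuous_on c\<sigma>')

text \<open>Integration by parts. On each subinterval the error of the Riemann--Stieltjes sum is an integral of
  \<open>\<sigma>'\<close> against increments of \<open>g\<close>, so no ordering of the tagged division is needed.\<close>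

lemma has_young_integral_by_parts:
  assumes g: "continuous_on {0..T} g" and t: "t \<in> {0..T}"
  shows "has_young_integral \<sigma> g 0 t (\<sigma> t *v g t - \<sigma> 0 *v g 0 - integral {0..t} (\<lambda>s. \<sigma>' s *v g s))"
  unfolding has_young_integral_def
proof (intro allI impI)
  fix e :: real assume e: "e > 0"
  obtain M where M: "0 < M" "\<And>t y. t \<in> {0..T} \<Longrightarrow> norm (\<sigma>' t *v y) \<le> M * norm y"
    by (rule \<sigma>'_bound) blast
  \<comment> \<open>Chosen so that the total error, at most \<open>M * \<omega> * t\<close>, stays
    below e; the summand 1 covers t = 0.\<close>
  define \<omega> where "\<omega> = e / (M * (t + 1))"
  have \<omega>: "\<omega> > 0" using e M t by (auto simp: \<omega>_def)
  have "uniformly_continuous_on {0..T} g"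
    by (rule compact_uniformly_continuous[OF g]) simp
  then obtain d where d: "d > 0" "\<And>s r. s \<in> {0..T} \<Longrightarrow> r \<in> {0..T} \<Longrightarrow> dist r s < d \<Longrightarrow> dist (g r) (g s) < \<omega>"
    using \<omega> unfolding uniformly_continuous_on_def by metis
  \<comment> \<open>The claimed value of the integral as a function of the endpoint: its increments
    telescope over the division, so that each piece can be compared separately.\<close>
  define F where "F = (\<lambda>s. \<sigma> s *v g s - integral {0..s} (\<lambda>s. \<sigma>' s *v g s))"
  have int: "(\<lambda>s. \<sigma>' s *v h s) integrable_on {p..q}" if "{p..q} \<subseteq> {0..T}" "continuous_on {0..T} h" for p q h
    by (intro integrable_continuous_real continuous_on_subset[OF \<sigma>'_mult_continuous[OF that(2)]] that(1))
  have piece: "norm (\<sigma> x *v (g v - g u) - (F v - F u)) \<le> M * \<omega> * (v - u)"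
    if xuv: "0 \<le> u" "u \<le> x" "x \<le> v" "v \<le> T" "v - u < d" for x u v
  proof -
    have I: "integral {p..q} (\<lambda>s. \<sigma>' s *v (g s - g z)) = integral {p..q} (\<lambda>s. \<sigma>' s *v g s) - (\<sigma> q - \<sigma> p) *v g z"
      if "0 \<le> p" "p \<le> q" "q \<le> T" for p q z
    proof -
      have "((\<lambda>s. \<sigma>' s *v g z) has_integral (\<sigma> q *v g z - \<sigma> p *v g z)) {p..q}"
      proof (rule fundamental_theorem_of_calculus[OF \<open>p \<le> q\<close>])
        fix s assume s: "s \<in> {p..q}"
        have "((\<lambda>s. \<sigma> s *v g z) has_vector_derivative \<sigma>' s *v g z) (at s within {0..T})"
          using bounded_linear.has_vector_derivative[OF mv.bounded_linear_left d\<sigma>[of s]] s that by auto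
        then show "((\<lambda>s. \<sigma> s *v g z) has_vector_derivative \<sigma>' s *v g z) (at s within {p..q})"
          by (rule has_vector_derivative_within_subset) (use that in auto)
      qed
      moreover have "((\<lambda>s. \<sigma>' s *v g s) has_integral integral {p..q} (\<lambda>s. \<sigma>' s *v g s)) {p..q}"
        using int[OF _ g, of p q] that by (intro integrable_integral) auto
      ultimately have "((\<lambda>s. \<sigma>' s *v g s - \<sigma>' s *v g z) has_integral
          (integral {p..q} (\<lambda>s. \<sigma>' s *v g s) - (\<sigma> q *v g z - \<sigma> p *v g z))) {p..q}"
        by (rule has_integral_diff[rotated])
      then show ?thesis by (simp add: mv.diff_left mv.diff_right integral_unique)
    qed
    have bd: "norm (integral {p..q} (\<lambda>s. \<sigma>' s *v (g s - g z))) \<le> M * \<omega> * (q - p)"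
      if "u \<le> p" "p \<le> q" "q \<le> v" "z \<in> {u..v}" for p q z
    proof (rule integral_bound)
      show "continuous_on {p..q} (\<lambda>s. \<sigma>' s *v (g s - g z))"
        using that xuv by (intro continuous_on_subset[OF \<sigma>'_mult_continuous[of "\<lambda>s. g s - g z"]] continuous_intros g) auto
      fix s assume s: "s \<in> {p..q}"
      then have "dist (g s) (g z) < \<omega>" using that xuv by (intro d(2)) (auto simp: dist_real_def)
      then have "norm (g s - g z) \<le> \<omega>" by (simp add: dist_norm)
      then have "M * norm (g s - g z) \<le> M * \<omega>" using M by (intro mult_left_mono) auto
      with M(2)[of s "g s - g z"] s that xuv show "norm (\<sigma>' s *v (g s - g z)) \<le> M * \<omega>" by auto
    qed (use that in auto)
    have split: "integral {0..v} (\<lambda>s. \<sigma>' s *v g s) - integral {0..u} (\<lambda>s. \<sigma>' s *v g s)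
        = integral {u..x} (\<lambda>s. \<sigma>' s *v g s) + integral {x..v} (\<lambda>s. \<sigma>' s *v g s)"
    proof -
      have i1: "integral {0..u} (\<lambda>s. \<sigma>' s *v g s) + integral {u..v} (\<lambda>s. \<sigma>' s *v g s) = integral {0..v} (\<lambda>s. \<sigma>' s *v g s)"
        using xuv by (intro Henstock_Kurzweil_Integration.integral_combine int g) auto
      have i2: "integral {u..x} (\<lambda>s. \<sigma>' s *v g s) + integral {x..v} (\<lambda>s. \<sigma>' s *v g s) = integral {u..v} (\<lambda>s. \<sigma>' s *v g s)"
        using xuv by (intro Henstock_Kurzweil_Integration.integral_combine int g) auto
      show ?thesis unfolding i2 unfolding i1[symmetric] by (rule add_diff_cancel_left')
    qed
    \<comment> \<open>The subinterval is cut at its tag x, and on either half g is compared with its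
      value at the outer endpoint; the boundary terms of the two parts then cancel.\<close>
    have "\<sigma> x *v (g v - g u) - (F v - F u)
        = integral {x..v} (\<lambda>s. \<sigma>' s *v (g s - g v)) + integral {u..x} (\<lambda>s. \<sigma>' s *v (g s - g u))"
    proof -
      have "F v - F u = \<sigma> v *v g v - \<sigma> u *v g u
          - (integral {u..x} (\<lambda>s. \<sigma>' s *v g s) + integral {x..v} (\<lambda>s. \<sigma>' s *v g s))"
        unfolding split[symmetric] by (simp add: F_def)
      then show ?thesis using I[of x v v] I[of u x u] xuv by (simp add: mv.diff_left mv.diff_right)
    qed
    also have "norm \<dots> \<le> M * \<omega> * (v - x) + M * \<omega> * (x - u)"
      using xuv by (intro norm_triangle_le add_mono bd) auto
    also have "\<dots> = M * \<omega> * (v - u)" by (simp add: algebra_simps)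
    finally show ?thesis .
  qed
  show "\<exists>d>0. \<forall>\<D>. \<D> tagged_division_of {0..t} \<and> (\<lambda>x. ball x d) fine \<D> \<longrightarrow>
      norm ((\<Sum>(x, k)\<in>\<D>. \<sigma> x *v (g (Sup k) - g (Inf k)))
        - (\<sigma> t *v g t - \<sigma> 0 *v g 0 - integral {0..t} (\<lambda>s. \<sigma>' s *v g s))) < e"
  proof (intro exI[of _ "d/2"] conjI allI impI)
    fix \<D> assume "\<D> tagged_division_of {0..t} \<and> (\<lambda>x. ball x (d/2)) fine \<D>"
    then have D: "\<D> tagged_division_of {0..t}" and fin: "(\<lambda>x. ball x (d/2)) fine \<D>" by auto
    have "norm (\<Sum>(x, k)\<in>\<D>. \<sigma> x *v (g (Sup k) - g (Inf k)) - (F (Sup k) - F (Inf k)))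
        \<le> (\<Sum>(x, k)\<in>\<D>. M * \<omega> * (Sup k - Inf k))"
    proof (rule sum_norm_le)
      fix z assume z: "z \<in> \<D>"
      obtain x k where xk: "z = (x, k)" by (cases z)
      then have xk_in: "(x, k) \<in> \<D>" using z by simp
      obtain u v where k: "k = {u..v}" using tagged_division_ofD(4)[OF D xk_in] by auto
      have x: "x \<in> {u..v}" using tagged_division_ofD(2)[OF D xk_in] k by simp
      have sub: "{u..v} \<subseteq> {0..t}" using tagged_division_ofD(3)[OF D xk_in] k by simp
      have "{u..v} \<subseteq> ball x (d/2)" using fin xk_in k by (auto simp: fine_def)
      then have "u \<in> ball x (d/2)" "v \<in> ball x (d/2)" using x by (auto simp del: mem_ball)
      then have "dist x u < d/2" "dist x v < d/2" by simp_all
      then have "v - u < d" using x by (auto simp: dist_real_def)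
      then show "norm (case z of (x, k) \<Rightarrow> \<sigma> x *v (g (Sup k) - g (Inf k)) - (F (Sup k) - F (Inf k)))
          \<le> (case z of (x, k) \<Rightarrow> M * \<omega> * (Sup k - Inf k))"
        using piece[of u x v] x sub t by (auto simp: xk k)
    qed
    also have "(\<Sum>(x, k)\<in>\<D>. M * \<omega> * (Sup k - Inf k)) = M * \<omega> * t"
      using additive_tagged_division_1[OF _ D, of "\<lambda>s. M * \<omega> * s"] t by (simp add: right_diff_distrib)
    also have "(\<Sum>(x, k)\<in>\<D>. \<sigma> x *v (g (Sup k) - g (Inf k)) - (F (Sup k) - F (Inf k)))
        = (\<Sum>(x, k)\<in>\<D>. \<sigma> x *v (g (Sup k) - g (Inf k))) - (\<Sum>(x, k)\<in>\<D>. F (Sup k) - F (Inf k))"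
      by (simp add: sum_subtractf case_prod_unfold)
    also have "(\<Sum>(x, k)\<in>\<D>. F (Sup k) - F (Inf k)) = \<sigma> t *v g t - \<sigma> 0 *v g 0 - integral {0..t} (\<lambda>s. \<sigma>' s *v g s)"
      using additive_tagged_division_1[OF _ D, of F] t by (simp add: F_def)
    also have "M * \<omega> * t < e"
      using M e t by (auto simp: \<omega>_def divide_simps)
    finally show "norm ((\<Sum>(x, k)\<in>\<D>. \<sigma> x *v (g (Sup k) - g (Inf k)))
        - (\<sigma> t *v g t - \<sigma> 0 *v g 0 - integral {0..t} (\<lambda>s. \<sigma>' s *v g s))) < e" .
  qed (use d in auto)
qed

lemma young_integral_by_parts:
  assumes "continuous_on {0..T} g" "t \<in> {0..T}"
  shows "young_integral \<sigma> g 0 t = \<sigma> t *v g t - \<sigma> 0 *v g 0 - integral {0..t} (\<lambda>s. \<sigma>' s *v g s)"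
  unfolding young_integral_def
  using has_young_integral_by_parts[OF assms]
  by (rule the_equality) (rule has_young_integral_unique[OF _ has_young_integral_by_parts[OF assms]])

text \<open>Gronwall's argument: the lower bound on \<sigma> gives |g(t)| <= L y(t) with y the
  integral of |g|, so y(t) exp(-L t) is nonincreasing and starts at 0. It reduces injectivity of
  \<open>K_sigma\<close> to that of \<open>K_op\<close>.\<close>

lemma parts_eq_zero_imp_zero:
  assumes g: "continuous_on {0..T} g"
    and z: "\<And>t. t \<in> {0..T} \<Longrightarrow> \<sigma> t *v g t = integral {0..t} (\<lambda>s. \<sigma>' s *v g s)"
    and t: "t \<in> {0..T}"
  shows "g t = 0"
proof -
  obtain M where M: "0 < M" "\<And>t y. t \<in> {0..T} \<Longrightarrow> norm (\<sigma>' t *v y) \<le> M * norm y"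
    by (rule \<sigma>'_bound) blast
  define L where "L = M / m"
  define y where "y = (\<lambda>t. integral {0..t} (\<lambda>s. norm (g s)))"
  have gle: "norm (g t) \<le> L * y t" if t: "t \<in> {0..T}" for t
  proof -
    have sub: "{0..t} \<subseteq> {0..T}" using t by auto
    have "m * norm (g t) \<le> norm (integral {0..t} (\<lambda>s. \<sigma>' s *v g s))"
      using lower[OF t, of "g t"] z[OF t] by simp
    also have "\<dots> \<le> integral {0..t} (\<lambda>s. M * norm (g s))"
      using M(2) t by (intro Henstock_Kurzweil_Integration.integral_norm_bound_integral integrable_continuous_real
          continuous_on_subset[OF \<sigma>'_mult_continuous[OF g] sub] continuous_intros continuous_on_subset[OF g sub]) auto
    also have "\<dots> = M * y t" unfolding y_def by simp
    finally show ?thesis using m by (simp add: L_def field_simps)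
  qed
  have "y t * exp (- (L * t)) \<le> y 0 * exp (- (L * 0))"
  proof (rule DERIV_nonpos_imp_decreasing_open[of 0 t])
    have ycont: "continuous_on {0..T} y"
      unfolding y_def by (intro indefinite_integral_continuous_1 integrable_continuous_real continuous_intros g)
    then show "continuous_on {0..t} (\<lambda>t. y t * exp (- (L * t)))"
      using t by (intro continuous_intros continuous_on_subset[OF ycont]) auto
    fix x assume x: "0 < x" "x < t"
    have "(y has_vector_derivative norm (g x)) (at x within {0..T})"
      unfolding y_def using x t by (intro integral_has_vector_derivative continuous_intros g) auto
    moreover have "at x within {0..T} = at x"
      using x t by (intro at_within_interior) auto
    ultimately have "(y has_real_derivative norm (g x)) (at x)"
      by (simp add: has_real_derivative_iff_has_vector_derivative)
    then have "((\<lambda>t. y t * exp (- (L * t))) has_real_derivative ((norm (g x) - L * y x) * exp (- (L * x)))) (at x)"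
      by (auto intro!: derivative_eq_intros simp: algebra_simps)
    moreover have "(norm (g x) - L * y x) * exp (- (L * x)) \<le> 0"
      using gle[of x] x t by (intro mult_nonpos_nonneg) auto
    ultimately show "\<exists>z. DERIV (\<lambda>t. y t * exp (- (L * t))) x :> z \<and> z \<le> 0" by blast
  qed (use t in auto)
  then have "y t \<le> 0" by (simp add: y_def mult_le_0_iff)
  moreover have "L > 0" using M m by (simp add: L_def)
  ultimately have "L * y t \<le> 0" by (simp add: mult_nonneg_nonpos)
  with gle[OF t] have "norm (g t) \<le> 0" by linarith
  then show ?thesis by simp
qed

lemma \<sigma>_lipschitz:
  obtains M where "0 < M" "\<And>s r y. s \<in> {0..T} \<Longrightarrow> r \<in> {0..T} \<Longrightarrow> norm ((\<sigma> s - \<sigma> r) *v y) \<le> M * \<bar>s - r\<bar> * norm y"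
proof -
  obtain M where M: "0 < M" "\<And>t y. t \<in> {0..T} \<Longrightarrow> norm (\<sigma>' t *v y) \<le> M * norm y"
    by (rule \<sigma>'_bound) blast
  show ?thesis
  proof (rule that[OF M(1)])
    fix s r y assume sr: "s \<in> {0..T}" "r \<in> {0..T}"
    have "norm (\<sigma> s *v y - \<sigma> r *v y) \<le> (M * norm y) * norm (s - r)"
    proof (rule differentiable_bound[of "{0..T}" _ "\<lambda>t h. h *\<^sub>R (\<sigma>' t *v y)"])
      fix t assume t: "t \<in> {0..T}"
      show "((\<lambda>t. \<sigma> t *v y) has_derivative (\<lambda>h. h *\<^sub>R (\<sigma>' t *v y))) (at t within {0..T})"
        using bounded_linear.has_vector_derivative[OF mv.bounded_linear_left d\<sigma>[OF t]]
        by (simp add: has_vector_derivative_def)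
      show "onorm (\<lambda>h. h *\<^sub>R (\<sigma>' t *v y)) \<le> M * norm y"
        using M(2)[OF t, of y] by (intro onorm_le) (auto simp: mult.commute intro: mult_left_mono)
    qed (use sr in auto)
    then show "norm ((\<sigma> s - \<sigma> r) *v y) \<le> M * \<bar>s - r\<bar> * norm y"
      by (simp add: mv.diff_left mult_ac)
  qed
qed

text \<open>Regularity of \<sigma>^(-1) f without differentiating an inverse: \<sigma>_s (q_s - q_r)
  = (f_s - f_r) - (\<sigma>_s - \<sigma>_r) q_r, where \<sigma> is Lipschitz and |q_r| <= |f_r| / m
  <= A sqrt T / m because f vanishes at 0. The second term contributes M T / m^2 to
  \<open>K\<close>.\<close>

lemma \<sigma>_inverse_holder:
  obtains K where "0 \<le> K"
    "\<And>A \<tau> f. (\<And>s r. s \<in> {0..T} \<Longrightarrow> r \<in> {0..T} \<Longrightarrow> norm (f s - f r) \<le> A * sqrt \<bar>s - r\<bar>) \<Longrightarrow> f 0 = 0 \<Longrightarrow>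
       \<exists>q. (\<forall>s\<in>{0..T}. \<sigma> s *v q s = f s) \<and> (\<forall>s\<in>{0..T}. f s = 0 \<longrightarrow> q s = 0) \<and>
         (\<forall>s\<in>{0..T}. \<forall>r\<in>{0..T}. norm (q s - q r) \<le> (K * A) * sqrt \<bar>s - r\<bar>)"
proof -
  obtain M where M: "0 < M" "\<And>s r y. s \<in> {0..T} \<Longrightarrow> r \<in> {0..T} \<Longrightarrow> norm ((\<sigma> s - \<sigma> r) *v y) \<le> M * \<bar>s - r\<bar> * norm y"
    by (rule \<sigma>_lipschitz) blast
  have ex: "\<exists>y. \<sigma> s *v y = z" if s: "s \<in> {0..T}" for s z
  proof -
    have "inj ((*v) (\<sigma> s))"
    proof (rule injI)
      fix x y assume "\<sigma> s *v x = \<sigma> s *v y"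
      then have "m * norm (x - y) \<le> 0" using lower[OF s, of "x - y"] by (simp add: mv.diff_right)
      then show "x = y" using m by (simp add: mult_le_0_iff)
    qed
    then have "surj ((*v) (\<sigma> s))"
      by (intro linear_injective_imp_surjective bounded_linear.linear mv.bounded_linear_right) auto
    then show ?thesis by (metis surjD)
  qed
  define K where "K = 1 / m + M * T / m\<^sup>2"
  show ?thesis
  proof (rule that)
    show "0 \<le> K" using m M T by (simp add: K_def)
    fix A \<tau> and f :: "real \<Rightarrow> real^'n"
    assume f: "\<And>s r. s \<in> {0..T} \<Longrightarrow> r \<in> {0..T} \<Longrightarrow> norm (f s - f r) \<le> A * sqrt \<bar>s - r\<bar>" and f0: "f 0 = 0"
    define q where "q = (\<lambda>s. SOME y. \<sigma> s *v y = f s)"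
    have q: "\<sigma> s *v q s = f s" if "s \<in> {0..T}" for s
      unfolding q_def using ex[OF that] by (rule someI_ex)
    have qb: "norm (q s) \<le> norm (f s) / m" if "s \<in> {0..T}" for s
      using lower[OF that, of "q s"] q[OF that] m by (simp add: field_simps)
    have A: "0 \<le> A"
      using order_trans[OF norm_ge_zero f[of 0 T]] T by (auto simp: zero_le_mult_iff)
    have fb: "norm (f r) \<le> A * sqrt T" if "r \<in> {0..T}" for r
    proof -
      have "norm (f r) \<le> A * sqrt r" using f[of r 0] f0 that T by simp
      also have "\<dots> \<le> A * sqrt T" using that A by (intro mult_left_mono) auto
      finally show ?thesis .
    qed
    have "norm (q s - q r) \<le> (K * A) * sqrt \<bar>s - r\<bar>" if sr: "s \<in> {0..T}" "r \<in> {0..T}" for s r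
    proof -
      have "\<sigma> s *v (q s - q r) = (f s - f r) - (\<sigma> s - \<sigma> r) *v q r"
        using q sr by (simp add: mv.diff_left mv.diff_right)
      then have "m * norm (q s - q r) \<le> norm (f s - f r) + norm ((\<sigma> s - \<sigma> r) *v q r)"
        using lower[OF sr(1), of "q s - q r"] norm_triangle_ineq4[of "f s - f r" "(\<sigma> s - \<sigma> r) *v q r"] by simp
      also have "\<dots> \<le> A * sqrt \<bar>s - r\<bar> + M * \<bar>s - r\<bar> * (A * sqrt T / m)"
      proof (intro add_mono f sr order_trans[OF M(2)[OF sr]] mult_left_mono)
        show "norm (q r) \<le> A * sqrt T / m"
          using qb[OF sr(2)] divide_right_mono[OF fb[OF sr(2)], of m] m by simp
      qed (use M in auto)
      also have "\<dots> \<le> A * sqrt \<bar>s - r\<bar> + M * (sqrt T * sqrt \<bar>s - r\<bar>) * (A * sqrt T / m)"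
      proof -
        have "\<bar>s - r\<bar> \<le> sqrt T * sqrt \<bar>s - r\<bar>"
          by (rule abs_le_sqrt_mult_sqrt) (use sr in auto)
        then show ?thesis
          using A M m T by (intro add_left_mono mult_right_mono mult_left_mono) auto
      qed
      also have "\<dots> = m * ((K * A) * sqrt \<bar>s - r\<bar>)"
      proof -
        have "M * (sqrt T * sqrt \<bar>s - r\<bar>) * (A * sqrt T / m) = (sqrt T * sqrt T) * M * A * sqrt \<bar>s - r\<bar> / m"
          by (simp only: mult_ac times_divide_eq_right)
        moreover have "sqrt T * sqrt T = T" using T by simp
        ultimately show ?thesis using m by (simp add: K_def field_simps power2_eq_square)
      qed
      finally show ?thesis using m by simp
    qed
    moreover have "q s = 0" if "s \<in> {0..T}" "f s = 0" for s
      using qb[OF that(1)] that(2) by simp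
    ultimately show "\<exists>q. (\<forall>s\<in>{0..T}. \<sigma> s *v q s = f s) \<and> (\<forall>s\<in>{0..T}. f s = 0 \<longrightarrow> q s = 0) \<and>
         (\<forall>s\<in>{0..T}. \<forall>r\<in>{0..T}. norm (q s - q r) \<le> (K * A) * sqrt \<bar>s - r\<bar>)"
      using q by (intro exI[of _ q]) auto
  qed
qed

end

section \<open>Linearity, injectivity and inversion on the Cameron-Martin space\<close>

lemma sqint_add_scaleR:
  assumes u: "sqint T u" and v: "sqint T v"
  shows "sqint T (\<lambda>s. u s + c *\<^sub>R v s)"
proof -
  have [measurable]: "u \<in> borel_measurable borel" "v \<in> borel_measurable borel"
    using u v by (auto simp: sqint_def)
  have "integrable lborel (\<lambda>s. (norm (u s + c *\<^sub>R v s))\<^sup>2)"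
  proof (rule Bochner_Integration.integrable_bound)
    show "integrable lborel (\<lambda>s. 2 * (norm (u s))\<^sup>2 + (2 * c\<^sup>2) * (norm (v s))\<^sup>2)"
      using u v by (intro Bochner_Integration.integrable_add integrable_mult_right) (auto simp: sqint_def)
    have "(norm (u s + c *\<^sub>R v s))\<^sup>2 \<le> 2 * (norm (u s))\<^sup>2 + (2 * c\<^sup>2) * (norm (v s))\<^sup>2" for s
    proof -
      have "(norm (u s + c *\<^sub>R v s))\<^sup>2 \<le> (norm (u s) + norm (c *\<^sub>R v s))\<^sup>2"
        by (intro power_mono norm_triangle_ineq) auto
      also have "\<dots> \<le> 2 * (norm (u s))\<^sup>2 + 2 * (norm (c *\<^sub>R v s))\<^sup>2"
        using sum_squares_bound[of "norm (u s)" "norm (c *\<^sub>R v s)"] by (simp add: power2_sum)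
      finally show ?thesis by (simp add: power_mult_distrib)
    qed
    then show "AE s in lborel. norm ((norm (u s + c *\<^sub>R v s))\<^sup>2) \<le> norm (2 * (norm (u s))\<^sup>2 + (2 * c\<^sup>2) * (norm (v s))\<^sup>2)"
      by (auto intro!: AE_I2 order_trans[OF _ abs_ge_self])
  qed measurable
  then show ?thesis using u v by (auto simp: sqint_def)
qed

lemma kop_add_scaleR:
  fixes u v :: "real \<Rightarrow> 'b::euclidean_space"
  assumes a: "\<bar>a\<bar> < 1/2" and T: "0 < T" and u: "sqint T u" and v: "sqint T v"
  shows "kop T a (\<lambda>s. u s + c *\<^sub>R v s) t = kop T a u t + c *\<^sub>R kop T a v t"
proof -
  have F: "fvol a (\<lambda>s. u s + c *\<^sub>R v s) t = fvol a u t + c *\<^sub>R fvol a v t" for t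
  proof -
    have "fvol a (\<lambda>s. u s + c *\<^sub>R v s) t = (LINT s|lborel. (kern a (t - s) * kern (-a) s) *\<^sub>R u s
        + c *\<^sub>R ((kern a (t - s) * kern (-a) s) *\<^sub>R v s))"
      by (simp add: fvol_def rl_def algebra_simps)
    also have "\<dots> = (LINT s|lborel. (kern a (t - s) * kern (-a) s) *\<^sub>R u s)
        + (LINT s|lborel. c *\<^sub>R ((kern a (t - s) * kern (-a) s) *\<^sub>R v s))"
      by (intro Bochner_Integration.integral_add integrable_scaleR_right fvol_bound(1)[OF a u] fvol_bound(1)[OF a v])
    also have "\<dots> = fvol a u t + c *\<^sub>R fvol a v t"
      unfolding integral_scaleR_right by (simp add: fvol_def rl_def)
    finally show ?thesis .
  qed
  let ?w = "\<lambda>u r. (kern (a - 1) r * indicator {..T} r) *\<^sub>R fvol a u r"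
  have k0: "integrable lborel (\<lambda>s. kern 0 (t - s) *\<^sub>R w s)" if "integrable lborel w" for w :: "real \<Rightarrow> 'b"
  proof -
    have "integrable lborel (\<lambda>s. indicator {..<t} s *\<^sub>R w s)"
      by (rule integrable_mult_indicator[OF _ that]) auto
    also have "(\<lambda>s. indicator {..<t} s *\<^sub>R w s) = (\<lambda>s. kern 0 (t - s) *\<^sub>R w s)"
      by (auto simp: kern_def fun_eq_iff split: split_indicator)
    finally show ?thesis .
  qed
  have "rl 0 (?w (\<lambda>s. u s + c *\<^sub>R v s)) t = (LINT s|lborel. kern 0 (t - s) *\<^sub>R ?w u s + c *\<^sub>R (kern 0 (t - s) *\<^sub>R ?w v s))"
    unfolding rl_def F by (simp add: algebra_simps)
  also have "\<dots> = rl 0 (?w u) t + c *\<^sub>R rl 0 (?w v) t"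
    unfolding rl_def integral_scaleR_right[symmetric]
    by (intro Bochner_Integration.integral_add integrable_scaleR_right k0 volume_integrable[OF a u T] volume_integrable[OF a v T])
  finally show ?thesis unfolding kop_def F by (simp add: algebra_simps)
qed

lemma L2_borel_version:
  fixes u :: "real \<Rightarrow> real^'n"
  assumes u: "u \<in> L2 T"
  obtains v where "sqint T v" "AE s in lborel. s \<in> {0..T} \<longrightarrow> u s = v s"
    "(LINT t:{0..T}|lebesgue. (norm (u t))\<^sup>2) = (LINT s|lborel. (norm (v s))\<^sup>2)"
proof -
  have um: "(\<lambda>s. indicator {0..T} s *\<^sub>R u s) \<in> borel_measurable lebesgue"
    using u by (simp add: L2_def set_borel_measurable_def)
  obtain g where g: "g \<in> borel_measurable lborel" "AE s in lborel. indicator {0..T} s *\<^sub>R u s = g s"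
    using lebesgue_measurable_borel_version[OF um] by blast
  \<comment> \<open>The point 0 is removed as well, as \<open>sqint\<close> demands; the change is
    on a null set.\<close>
  define v where "v = (\<lambda>s. indicator {0<..T} s *\<^sub>R g s)"
  have [measurable]: "v \<in> borel_measurable borel" using g(1) unfolding v_def by measurable
  have ae: "AE s in lborel. indicator {0..T} s *\<^sub>R u s = v s"
    using g(2) AE_lborel_singleton[of 0] by eventually_elim (auto simp: v_def split: split_indicator)
  then have ae': "AE s in lebesgue. indicator {0..T} s *\<^sub>R u s = v s" by (rule AE_completion)
  have sq_eq: "indicator {0..T} s *\<^sub>R (norm (u s))\<^sup>2 = (norm (indicator {0..T} s *\<^sub>R u s))\<^sup>2" for s
    by (auto split: split_indicator)
  have i: "integrable lebesgue (\<lambda>s. (norm (indicator {0..T} s *\<^sub>R u s))\<^sup>2)"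
    using u unfolding L2_def set_integrable_def mem_Collect_eq sq_eq by (rule conjunct2)
  have um2: "(\<lambda>s. (norm (indicator {0..T} s *\<^sub>R u s))\<^sup>2) \<in> borel_measurable lebesgue"
    using i by auto
  have vm2: "(\<lambda>s. (norm (v s))\<^sup>2) \<in> borel_measurable lborel" by measurable
  have vm2': "(\<lambda>s. (norm (v s))\<^sup>2) \<in> borel_measurable lebesgue"
    by (rule measurable_completion) measurable
  have aesq: "AE s in lebesgue. (norm (indicator {0..T} s *\<^sub>R u s))\<^sup>2 = (norm (v s))\<^sup>2"
    using ae' by eventually_elim simp
  show ?thesis
  proof (rule that)
    have "integrable lebesgue (\<lambda>s. (norm (v s))\<^sup>2)"
      using i integrable_cong_AE[OF um2 vm2' aesq] by simp
    then have "integrable lborel (\<lambda>s. (norm (v s))\<^sup>2)"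
      using integrable_completion[OF vm2] by simp
    moreover have "v t = 0" if "t \<notin> {0<..T}" for t using that by (simp add: v_def)
    ultimately show "sqint T v" unfolding sqint_def by auto
    show "AE s in lborel. s \<in> {0..T} \<longrightarrow> u s = v s"
      using ae by eventually_elim auto
    have "(LINT t:{0..T}|lebesgue. (norm (u t))\<^sup>2) = (LINT s|lebesgue. (norm (v s))\<^sup>2)"
      unfolding set_lebesgue_integral_def sq_eq by (rule integral_cong_AE[OF um2 vm2' aesq])
    then show "(LINT t:{0..T}|lebesgue. (norm (u t))\<^sup>2) = (LINT s|lborel. (norm (v s))\<^sup>2)"
      using integral_completion[OF vm2] by simp
  qed
qed

lemma sqint_imp_L2:
  fixes v :: "real \<Rightarrow> real^'n"
  assumes v: "sqint T v"
  shows "v \<in> L2 T"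
proof -
  have [measurable]: "v \<in> borel_measurable borel" using v by (simp add: sqint_def)
  have 1: "indicator {0..T} s *\<^sub>R v s = v s" for s
    using v by (auto simp: sqint_def split: split_indicator)
  have 2: "indicator {0..T} s *\<^sub>R (norm (v s))\<^sup>2 = (norm (v s))\<^sup>2" for s
    using v by (auto simp: sqint_def split: split_indicator)
  have m: "(\<lambda>s. (norm (v s))\<^sup>2) \<in> borel_measurable lborel" by measurable
  have "v \<in> borel_measurable lebesgue" by (rule measurable_completion) measurable
  moreover have "integrable lebesgue (\<lambda>s. (norm (v s))\<^sup>2)"
    using v integrable_completion[OF m] by (simp add: sqint_def)
  ultimately show ?thesis
    unfolding L2_def set_borel_measurable_def set_integrable_def mem_Collect_eq 1 2 by (rule conjI)
qed

lemma c_H_pos: "0 < H \<Longrightarrow> H < 1 \<Longrightarrow> 0 < c_H H"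
  unfolding c_H_def by (intro real_sqrt_gt_zero divide_pos_pos mult_pos_pos Gamma_real_pos) auto

lemma d_H_pos: "0 < H \<Longrightarrow> H < 1 \<Longrightarrow> 0 < d_H H"
  unfolding d_H_def by (intro real_sqrt_gt_zero divide_pos_pos mult_pos_pos Gamma_real_pos) auto

context
  fixes H T m :: real and \<sigma> \<sigma>' :: "real \<Rightarrow> real^'n^'n"
  assumes H: "0 < H" "H < 1" and T: "0 < T"
    and d\<sigma>: "\<And>t. t \<in> {0..T} \<Longrightarrow> (\<sigma> has_vector_derivative \<sigma>' t) (at t within {0..T})"
    and c\<sigma>': "continuous_on {0..T} \<sigma>'"
    and m: "0 < m" and lower: "\<And>t y. t \<in> {0..T} \<Longrightarrow> m * norm y \<le> norm (\<sigma> t *v y)"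
begin

lemma abs_exponent: "\<bar>H - 1/2\<bar> < 1/2"
  using H by (auto simp: abs_if)

lemma K_op_continuous:
  assumes u: "u \<in> L2 T"
  shows "continuous_on {0..T} (K_op H u)" and "K_op H u 0 = 0"
proof -
  obtain v where v: "sqint T v" "AE s in lborel. s \<in> {0..T} \<longrightarrow> u s = v s"
    by (rule L2_borel_version[OF u])
  note eq = K_op_eq_kop[OF H u v]
  have "continuous_on {0..T} (\<lambda>t. c_H H *\<^sub>R kop T (H - 1/2) v t)"
    by (intro continuous_intros kop_continuous[OF abs_exponent v(1) T])
  then show "continuous_on {0..T} (K_op H u)"
    by (rule continuous_on_eq) (simp add: eq)
  have "{0<..<0::real} = {}" by auto
  then show "K_op H u 0 = 0" by (simp add: K_op_def set_lebesgue_integral_def)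
qed

lemma K_sigma_by_parts:
  assumes u: "u \<in> L2 T" and t: "t \<in> {0..T}"
  shows "K_sigma H \<sigma> u t = \<sigma> t *v K_op H u t - integral {0..t} (\<lambda>s. \<sigma>' s *v K_op H u s)"
  unfolding K_sigma_def
  using young_integral_by_parts[OF T d\<sigma> c\<sigma>' m lower K_op_continuous(1)[OF u] t] K_op_continuous(2)[OF u] by simp

lemma K_op_parts_integrable:
  assumes u: "u \<in> L2 T" and t: "t \<in> {0..T}"
  shows "(\<lambda>s. \<sigma>' s *v K_op H u s) integrable_on {0..t}"
  using t by (intro integrable_continuous_real continuous_on_subset[OF \<sigma>'_mult_continuous[OF T d\<sigma> c\<sigma>' m lower K_op_continuous(1)[OF u]]]) auto

text \<open>The combination is formed from the Borel representatives, on which \<open>kop\<close> is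
  linear; integration by parts carries linearity over from \<open>K_op\<close> to
  \<open>K_sigma\<close>.\<close>

lemma K_sigma_add_scaleR:
  assumes u: "u1 \<in> L2 T" "u2 \<in> L2 T"
    and v1: "sqint T v1" "AE s in lborel. s \<in> {0..T} \<longrightarrow> u1 s = v1 s"
    and v2: "sqint T v2" "AE s in lborel. s \<in> {0..T} \<longrightarrow> u2 s = v2 s"
    and t: "t \<in> {0..T}"
  shows "K_op H (\<lambda>s. v1 s + c *\<^sub>R v2 s) t = K_op H u1 t + c *\<^sub>R K_op H u2 t"
    and "K_sigma H \<sigma> (\<lambda>s. v1 s + c *\<^sub>R v2 s) t = K_sigma H \<sigma> u1 t + c *\<^sub>R K_sigma H \<sigma> u2 t"
proof -
  let ?v = "\<lambda>s. v1 s + c *\<^sub>R v2 s"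
  have v: "sqint T ?v" by (rule sqint_add_scaleR[OF v1(1) v2(1)])
  have K: "K_op H ?v t = K_op H u1 t + c *\<^sub>R K_op H u2 t" if "t \<in> {0..T}" for t
    unfolding K_op_eq_kop[OF H u(1) v1 that] K_op_eq_kop[OF H u(2) v2 that]
    using K_op_eq_kop[OF H sqint_imp_L2[OF v] v _ that] kop_add_scaleR[OF abs_exponent T v1(1) v2(1), of c t]
    by (simp add: algebra_simps)
  show "K_op H ?v t = K_op H u1 t + c *\<^sub>R K_op H u2 t" by (rule K[OF t])
  have "integral {0..t} (\<lambda>s. \<sigma>' s *v K_op H ?v s)
      = integral {0..t} (\<lambda>s. \<sigma>' s *v K_op H u1 s + c *\<^sub>R (\<sigma>' s *v K_op H u2 s))"
    using t by (intro integral_cong) (simp add: K mv.add_right mv.scaleR_right)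
  also have "\<dots> = integral {0..t} (\<lambda>s. \<sigma>' s *v K_op H u1 s) + c *\<^sub>R integral {0..t} (\<lambda>s. \<sigma>' s *v K_op H u2 s)"
    using K_op_parts_integrable[OF u(1) t] K_op_parts_integrable[OF u(2) t]
    by (simp add: Henstock_Kurzweil_Integration.integral_add integrable_cmul)
  finally show "K_sigma H \<sigma> ?v t = K_sigma H \<sigma> u1 t + c *\<^sub>R K_sigma H \<sigma> u2 t"
    unfolding K_sigma_by_parts[OF sqint_imp_L2[OF v] t] K_sigma_by_parts[OF u(1) t] K_sigma_by_parts[OF u(2) t]
    by (simp add: K[OF t] mv.add_right mv.scaleR_right algebra_simps)
qed

lemma H_space_add:
  assumes "h1 \<in> H_space H \<sigma> T" "h2 \<in> H_space H \<sigma> T"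
  shows "(\<lambda>t. h1 t + h2 t) \<in> H_space H \<sigma> T"
proof -
  obtain u1 u2 where u: "u1 \<in> L2 T" "\<And>t. t \<in> {0..T} \<Longrightarrow> h1 t = K_sigma H \<sigma> u1 t"
      "u2 \<in> L2 T" "\<And>t. t \<in> {0..T} \<Longrightarrow> h2 t = K_sigma H \<sigma> u2 t"
    using assms by (auto simp: H_space_def)
  obtain v1 where v1: "sqint T v1" "AE s in lborel. s \<in> {0..T} \<longrightarrow> u1 s = v1 s"
    by (rule L2_borel_version[OF u(1)])
  obtain v2 where v2: "sqint T v2" "AE s in lborel. s \<in> {0..T} \<longrightarrow> u2 s = v2 s"
    by (rule L2_borel_version[OF u(3)])
  show ?thesis
    unfolding H_space_def
    using sqint_imp_L2[OF sqint_add_scaleR[OF v1(1) v2(1), of 1]] K_sigma_add_scaleR(2)[OF u(1,3) v1 v2, of _ 1] u(2,4)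
    by (intro CollectI bexI[of _ "\<lambda>s. v1 s + 1 *\<^sub>R v2 s"]) auto
qed

text \<open>Stated for norms, since preimages are determined only almost everywhere and the
  functionals see only the norm. The difference of two preimages is sent to 0 by
  \<open>K_sigma\<close>, hence by \<open>K_op\<close> (Gronwall), hence vanishes almost everywhere
  (Abel).\<close>

lemma K_sigma_injective:
  assumes u: "u1 \<in> L2 T" "u2 \<in> L2 T"
    and eq: "\<And>t. t \<in> {0..T} \<Longrightarrow> K_sigma H \<sigma> u1 t = K_sigma H \<sigma> u2 t"
  shows "(LINT t:{0..T}|lebesgue. (norm (u1 t))\<^sup>2) = (LINT t:{0..T}|lebesgue. (norm (u2 t))\<^sup>2)"
proof -
  obtain v1 where v1: "sqint T v1" "AE s in lborel. s \<in> {0..T} \<longrightarrow> u1 s = v1 s"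
    and n1: "(LINT t:{0..T}|lebesgue. (norm (u1 t))\<^sup>2) = (LINT s|lborel. (norm (v1 s))\<^sup>2)"
    by (rule L2_borel_version[OF u(1)])
  obtain v2 where v2: "sqint T v2" "AE s in lborel. s \<in> {0..T} \<longrightarrow> u2 s = v2 s"
    and n2: "(LINT t:{0..T}|lebesgue. (norm (u2 t))\<^sup>2) = (LINT s|lborel. (norm (v2 s))\<^sup>2)"
    by (rule L2_borel_version[OF u(2)])
  let ?v = "\<lambda>s. v1 s + (-1) *\<^sub>R v2 s"
  have v: "sqint T ?v" by (rule sqint_add_scaleR[OF v1(1) v2(1)])
  note vL = sqint_imp_L2[OF v]
  have z: "\<sigma> t *v K_op H ?v t = integral {0..t} (\<lambda>s. \<sigma>' s *v K_op H ?v s)" if t: "t \<in> {0..T}" for t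
    using K_sigma_by_parts[OF vL t] K_sigma_add_scaleR(2)[OF u v1 v2 t, of "-1"] eq[OF t] by simp
  have "kop T (H - 1/2) ?v t = 0" if t: "t \<in> {0..T}" for t
    using parts_eq_zero_imp_zero[OF T d\<sigma> c\<sigma>' m lower K_op_continuous(1)[OF vL] z t]
      K_op_eq_kop[OF H vL v _ t] c_H_pos[OF H] by simp
  then have "AE s in lborel. ?v s = 0"
    by (rule kop_injective[OF abs_exponent v T])
  then have "AE s in lborel. (norm (v1 s))\<^sup>2 = (norm (v2 s))\<^sup>2"
    by eventually_elim simp
  then have "(LINT s|lborel. (norm (v1 s))\<^sup>2) = (LINT s|lborel. (norm (v2 s))\<^sup>2)"
    using v1(1) v2(1) by (intro integral_cong_AE) (auto simp: sqint_def)
  then show ?thesis using n1 n2 by simp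
qed

text \<open>Evaluates the choice in \<open>K_sigma_inv\<close>: any explicit preimage has the norm
  of the chosen one.\<close>

lemma K_sigma_inv_norm:
  assumes u: "u \<in> L2 T" and eq: "\<And>t. t \<in> {0..T} \<Longrightarrow> K_sigma H \<sigma> u t = h t"
  shows "(LINT t:{0..T}|lebesgue. (norm (K_sigma_inv H \<sigma> T h t))\<^sup>2) = (LINT t:{0..T}|lebesgue. (norm (u t))\<^sup>2)"
proof -
  have "K_sigma_inv H \<sigma> T h \<in> L2 T \<and> (\<forall>t\<in>{0..T}. K_sigma H \<sigma> (K_sigma_inv H \<sigma> T h) t = h t)"
    unfolding K_sigma_inv_def by (rule someI[of _ u]) (use u eq in auto)
  then show ?thesis using eq by (intro K_sigma_injective u) auto
qed

text \<open>Solve \<sigma> q = f pointwise, then K_H v equal to the integral of q. Since K_H v is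
  then C^1, the Young integral is the ordinary integral of \<sigma> q = f. C depends on \<tau> but
  not on A, f or h.\<close>

lemma K_sigma_solution:
  assumes \<tau>: "0 < \<tau>" "\<tau> < T"
  obtains C where "0 \<le> C"
    "\<And>A f h. (\<And>s r. s \<in> {0..T} \<Longrightarrow> r \<in> {0..T} \<Longrightarrow> norm (f s - f r) \<le> A * sqrt \<bar>s - r\<bar>) \<Longrightarrow>
       (\<And>s. s \<in> {0..\<tau>} \<Longrightarrow> f s = 0) \<Longrightarrow> (\<And>t. t \<in> {0..T} \<Longrightarrow> h t = integral {0..t} f) \<Longrightarrow>
       h \<in> H_space H \<sigma> T \<and> (LINT t:{0..T}|lebesgue. (norm (K_sigma_inv H \<sigma> T h t))\<^sup>2) \<le> C * A\<^sup>2"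
proof -
  obtain K where K: "0 \<le> K"
    "\<And>A \<tau> f. (\<And>s r. s \<in> {0..T} \<Longrightarrow> r \<in> {0..T} \<Longrightarrow> norm (f s - f r) \<le> A * sqrt \<bar>s - r\<bar>) \<Longrightarrow> f 0 = 0 \<Longrightarrow>
       \<exists>q. (\<forall>s\<in>{0..T}. \<sigma> s *v q s = f s) \<and> (\<forall>s\<in>{0..T}. f s = 0 \<longrightarrow> q s = 0) \<and>
         (\<forall>s\<in>{0..T}. \<forall>r\<in>{0..T}. norm (q s - q r) \<le> (K * A) * sqrt \<bar>s - r\<bar>)"
    by (rule \<sigma>_inverse_holder[OF T d\<sigma> c\<sigma>' m lower]) blast+
  obtain C0 where C0: "0 \<le> C0"
    "\<And>A (f :: real \<Rightarrow> real^'n).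
       (\<And>s r. s \<in> {0..T} \<Longrightarrow> r \<in> {0..T} \<Longrightarrow> norm (f s - f r) \<le> A * sqrt \<bar>s - r\<bar>) \<Longrightarrow>
       (\<And>s. s \<in> {0..\<tau>} \<Longrightarrow> f s = 0) \<Longrightarrow>
       \<exists>v. sqint T v \<and> (LINT s|lborel. (norm (v s))\<^sup>2) \<le> C0 * A\<^sup>2 \<and>
         (\<forall>t\<in>{0..T}. kop T (H - 1/2) v t = integral {0..t} f)"
    by (rule kop_solution[OF abs_exponent \<tau>]) blast+
  let ?c = "c_H H"
  have c: "?c > 0" by (rule c_H_pos[OF H])
  define C where "C = C0 * (K / ?c)\<^sup>2"
  show ?thesis
  proof (rule that)
    show "0 \<le> C" using C0(1) by (simp add: C_def)
    fix A and f h :: "real \<Rightarrow> real^'n"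
    assume f: "\<And>s r. s \<in> {0..T} \<Longrightarrow> r \<in> {0..T} \<Longrightarrow> norm (f s - f r) \<le> A * sqrt \<bar>s - r\<bar>"
      and f0: "\<And>s. s \<in> {0..\<tau>} \<Longrightarrow> f s = 0"
      and h: "\<And>t. t \<in> {0..T} \<Longrightarrow> h t = integral {0..t} f"
    have "f 0 = 0" using f0[of 0] \<tau> by simp
    from K(2)[OF f this] obtain q where q: "\<And>s. s \<in> {0..T} \<Longrightarrow> \<sigma> s *v q s = f s"
        "\<And>s. s \<in> {0..T} \<Longrightarrow> f s = 0 \<Longrightarrow> q s = 0"
        "\<And>s r. s \<in> {0..T} \<Longrightarrow> r \<in> {0..T} \<Longrightarrow> norm (q s - q r) \<le> (K * A) * sqrt \<bar>s - r\<bar>"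
      by blast
    have qc: "norm ((1 / ?c) *\<^sub>R q s - (1 / ?c) *\<^sub>R q r) \<le> (K / ?c * A) * sqrt \<bar>s - r\<bar>"
      if "s \<in> {0..T}" "r \<in> {0..T}" for s r
    proof -
      have "norm ((1 / ?c) *\<^sub>R q s - (1 / ?c) *\<^sub>R q r) = (1 / ?c) * norm (q s - q r)"
        using c by (simp flip: scaleR_diff_right)
      also have "\<dots> \<le> (1 / ?c) * ((K * A) * sqrt \<bar>s - r\<bar>)"
        using c by (intro mult_left_mono q(3) that) auto
      finally show ?thesis by simp
    qed
    have "(1 / ?c) *\<^sub>R q s = 0" if "s \<in> {0..\<tau>}" for s
      using that q(2)[of s] f0[of s] \<tau> by simp
    from C0(2)[of "\<lambda>s. (1 / ?c) *\<^sub>R q s", OF qc this] obtain v where v: "sqint T v"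
        "(LINT s|lborel. (norm (v s))\<^sup>2) \<le> C0 * (K / ?c * A)\<^sup>2"
        "\<And>t. t \<in> {0..T} \<Longrightarrow> kop T (H - 1/2) v t = integral {0..t} (\<lambda>s. (1 / ?c) *\<^sub>R q s)"
      by blast
    note vL = sqint_imp_L2[OF v(1)]
    have qcont: "continuous_on {0..T} q" by (rule half_holder_on_continuous[OF q(3)])
    have fcont: "continuous_on {0..T} f" by (rule half_holder_on_continuous[OF f])
    have Kv: "K_op H v t = integral {0..t} q" if t: "t \<in> {0..T}" for t
      using K_op_eq_kop[OF H vL v(1) _ t] v(3)[OF t] c by simp
    have Ks: "K_sigma H \<sigma> v t = h t" if t: "t \<in> {0..T}" for t
    proof -
      \<comment> \<open>The difference between the integrated-by-parts form of
        \<open>K_sigma H \<sigma> v\<close> and the integral of f; by the product rule its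
        derivative is \<sigma> q - f = 0.\<close>
      define E where "E = (\<lambda>t. \<sigma> t *v integral {0..t} q - integral {0..t} (\<lambda>s. \<sigma>' s *v integral {0..s} q) - integral {0..t} f)"
      have "E t = E 0"
      proof (rule has_derivative_zero_unique[of "{0..T}"])
        fix x assume x: "x \<in> {0..T}"
        have dq: "((\<lambda>t. integral {0..t} q) has_vector_derivative q x) (at x within {0..T})"
          by (rule integral_has_vector_derivative[OF qcont x])
        have "continuous_on {0..T} (\<lambda>t. integral {0..t} q)"
          by (intro indefinite_integral_continuous_1 integrable_continuous_real qcont)
        note dp = integral_has_vector_derivative[OF \<sigma>'_mult_continuous[OF T d\<sigma> c\<sigma>' m lower this] x]
        have "(E has_vector_derivative ((\<sigma> x *v q x + \<sigma>' x *v integral {0..x} q) - \<sigma>' x *v integral {0..x} q) - f x) (at x within {0..T})"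
          unfolding E_def
          by (intro has_vector_derivative_diff mv.has_vector_derivative dq dp d\<sigma> x integral_has_vector_derivative[OF fcont x])
        then show "(E has_derivative (\<lambda>h. 0)) (at x within {0..T})"
          using q(1)[OF x] by (simp add: has_vector_derivative_def)
      qed (use t T in auto)
      moreover have "E 0 = 0" by (simp add: E_def)
      moreover have "integral {0..t} (\<lambda>s. \<sigma>' s *v K_op H v s) = integral {0..t} (\<lambda>s. \<sigma>' s *v integral {0..s} q)"
        using t by (intro integral_cong) (simp add: Kv)
      ultimately show ?thesis
        using K_sigma_by_parts[OF vL t] Kv[OF t] h[OF t] by (simp add: E_def)
    qed
    have "h \<in> H_space H \<sigma> T"
      unfolding H_space_def using vL Ks by (intro CollectI bexI[of _ v]) auto
    moreover have "(LINT t:{0..T}|lebesgue. (norm (v t))\<^sup>2) = (LINT s|lborel. (norm (v s))\<^sup>2)"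
    proof -
      have 1: "indicator {0..T} s *\<^sub>R (norm (v s))\<^sup>2 = (norm (v s))\<^sup>2" for s
        using v(1) by (auto simp: sqint_def split: split_indicator)
      show ?thesis
        unfolding set_lebesgue_integral_def 1 using v(1) by (intro integral_completion) (auto simp: sqint_def)
    qed
    ultimately show "h \<in> H_space H \<sigma> T \<and> (LINT t:{0..T}|lebesgue. (norm (K_sigma_inv H \<sigma> T h t))\<^sup>2) \<le> C * A\<^sup>2"
      using K_sigma_inv_norm[OF vL Ks] v(2) by (simp add: C_def power_mult_distrib power_divide mult.assoc)
  qed
qed

end

section \<open>Calculus of drift and diffusion coefficient\<close>

text \<open>The diagonal structure is used here once and for all: the scalar derivatives are
  assembled along the diagonal matrix units, and the least of the finitely many lower bounds serves
  as m.\<close>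

lemma diffusion_derivative:
  fixes \<sigma> :: "real \<Rightarrow> real^'n^'n"
  assumes A: "assumption_A T b \<sigma>"
  obtains \<sigma>' m where "\<And>t. t \<in> {0..T} \<Longrightarrow> (\<sigma> has_vector_derivative \<sigma>' t) (at t within {0..T})"
    "continuous_on {0..T} \<sigma>'" "0 < m" "\<And>t y. t \<in> {0..T} \<Longrightarrow> m * norm y \<le> norm (\<sigma> t *v y)"
proof -
  have off: "\<And>t i j. t \<in> {0..T} \<Longrightarrow> i \<noteq> j \<Longrightarrow> \<sigma> t $ i $ j = 0"
    and C1: "\<And>i. C1_on_interval T (\<lambda>t. \<sigma> t $ i $ i)"
    and ex: "\<And>i. \<exists>m M. 0 < m \<and> (\<forall>t\<in>{0..T}. m \<le> \<sigma> t $ i $ i \<and> \<sigma> t $ i $ i \<le> M)"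
    using A by (auto simp: assumption_A_def)
  from C1 obtain f' where f': "\<And>i. continuous_on {0..T} (f' i)"
      "\<And>i t. t \<in> {0..T} \<Longrightarrow> ((\<lambda>t. \<sigma> t $ i $ i) has_real_derivative f' i t) (at t within {0..T})"
    unfolding C1_on_interval_def by metis
  from ex obtain mm where mm: "\<And>i. 0 < mm i" "\<And>i t. t \<in> {0..T} \<Longrightarrow> mm i \<le> \<sigma> t $ i $ i"
    by metis
  define E :: "'n \<Rightarrow> real^'n^'n" where "E = (\<lambda>i. \<chi> k l. if k = i \<and> l = i then 1 else 0)"
  have Esum: "(\<Sum>i\<in>UNIV. c i * E i $ k $ l) = (if k = l then c k else 0)" for c k l
  proof -
    have "c i * E i $ k $ l = (if i = k then if k = l then c k else 0 else 0)" for i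
      by (auto simp: E_def)
    then show ?thesis by simp
  qed
  define m where "m = Min (range mm)"
  show ?thesis
  proof (rule that)
    show "continuous_on {0..T} (\<lambda>t. \<Sum>i\<in>UNIV. f' i t *\<^sub>R E i)"
      by (intro continuous_intros f')
    show "0 < m" unfolding m_def using mm(1) by (subst Min_gr_iff) auto
    fix t assume t: "t \<in> {0..T}"
    have "((\<lambda>t. \<Sum>i\<in>UNIV. (\<sigma> t $ i $ i) *\<^sub>R E i) has_vector_derivative (\<Sum>i\<in>UNIV. f' i t *\<^sub>R E i)) (at t within {0..T})"
    proof (rule has_vector_derivative_sum)
      fix i
      show "((\<lambda>t. (\<sigma> t $ i $ i) *\<^sub>R E i) has_vector_derivative f' i t *\<^sub>R E i) (at t within {0..T})"
        using has_vector_derivative_scaleR[OF f'(2)[OF t, of i] has_vector_derivative_const[of "E i"]] by simp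
    qed
    then show "(\<sigma> has_vector_derivative (\<Sum>i\<in>UNIV. f' i t *\<^sub>R E i)) (at t within {0..T})"
      by (rule has_vector_derivative_transform[OF t, rotated]) (auto simp: vec_eq_iff Esum off)
    fix y
    have "norm (m *\<^sub>R y) \<le> norm (\<sigma> t *v y)"
    proof (rule norm_le_componentwise_cart)
      fix i
      have "(\<sigma> t *v y) $ i = (\<Sum>j\<in>UNIV. \<sigma> t $ i $ j * y $ j)"
        by (simp add: matrix_vector_mult_def)
      also have "\<dots> = (\<Sum>j\<in>UNIV. if j = i then \<sigma> t $ i $ i * y $ i else 0)"
        by (intro sum.cong refl) (simp add: off[OF t])
      finally have i: "(\<sigma> t *v y) $ i = \<sigma> t $ i $ i * y $ i" by simp
      have "m \<le> mm i" unfolding m_def by (rule Min_le) auto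
      then have "m \<le> \<sigma> t $ i $ i" using mm(2)[OF t, of i] by linarith
      then show "norm ((m *\<^sub>R y) $ i) \<le> norm ((\<sigma> t *v y) $ i)"
        using \<open>0 < m\<close> by (simp add: i abs_mult mult_right_mono)
    qed
    then show "m * norm y \<le> norm (\<sigma> t *v y)" using \<open>0 < m\<close> by simp
  qed
qed

text \<open>No mixed time-space derivatives are available, so the time regularity of the space derivative comes
  from interpolation between the bounds on \<open>\<partial>\<^sub>t b\<close> and on the second space derivative. This limits the
  Hoelder exponent of the drift increments to \<open>1/2\<close>.\<close>

context
  fixes T B :: real and b bt :: "real \<Rightarrow> 'v::euclidean_space \<Rightarrow> 'v"
    and D1 :: "real \<Rightarrow> 'v \<Rightarrow> 'v \<Rightarrow>\<^sub>L 'v" and D2 :: "real \<Rightarrow> 'v \<Rightarrow> 'v \<Rightarrow>\<^sub>L 'v \<Rightarrow>\<^sub>L 'v"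
  assumes db: "\<And>t x. t \<in> {0..T} \<Longrightarrow> (b t has_derivative blinfun_apply (D1 t x)) (at x)"
    and dD1: "\<And>t x. t \<in> {0..T} \<Longrightarrow> (D1 t has_derivative blinfun_apply (D2 t x)) (at x)"
    and dt: "\<And>t x. t \<in> {0..T} \<Longrightarrow> ((\<lambda>s. b s x) has_vector_derivative bt t x) (at t within {0..T})"
    and B: "\<And>t x. t \<in> {0..T} \<Longrightarrow> norm (bt t x) \<le> B" "\<And>t x. t \<in> {0..T} \<Longrightarrow> norm (D1 t x) \<le> B"
      "\<And>t x. t \<in> {0..T} \<Longrightarrow> norm (D2 t x) \<le> B"
    and T: "0 < T"
begin

lemma drift_bound_nonneg: "0 \<le> B"
  using order_trans[OF norm_ge_zero B(1)[of 0]] T by auto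

lemma D1_lipschitz_space: "t \<in> {0..T} \<Longrightarrow> norm (D1 t x - D1 t y) \<le> B * norm (x - y)"
  by (rule differentiable_bound[of UNIV]) (auto intro: dD1 simp: B(3) simp flip: norm_blinfun.rep_eq)

lemma b_lipschitz_space: "t \<in> {0..T} \<Longrightarrow> norm (b t x - b t y) \<le> B * norm (x - y)"
  by (rule differentiable_bound[of UNIV]) (auto intro: db simp: B(2) simp flip: norm_blinfun.rep_eq)

lemma b_lipschitz_time:
  assumes "t \<in> {0..T}" "r \<in> {0..T}"
  shows "norm (b t x - b r x) \<le> B * \<bar>t - r\<bar>"
proof -
  have "norm (b t x - b r x) \<le> B * norm (t - r)"
  proof (rule differentiable_bound[of "{0..T}" _ "\<lambda>t h. h *\<^sub>R bt t x"])
    fix t assume t: "t \<in> {0..T}"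
    then show "((\<lambda>t. b t x) has_derivative (\<lambda>h. h *\<^sub>R bt t x)) (at t within {0..T})"
      using dt by (simp add: has_vector_derivative_def)
    show "onorm (\<lambda>h. h *\<^sub>R bt t x) \<le> B"
      using B(1)[OF t, of x] by (intro onorm_le) (simp add: mult.commute[of B] mult_left_mono)
  qed (use assms in auto)
  then show ?thesis by simp
qed

text \<open>Mean value inequality for y -> b(y) - D1(x) y on the ball of radius |w| about x, where
  D1 deviates from D1(x) by at most B |w|.\<close>

lemma b_remainder:
  assumes t: "t \<in> {0..T}"
  shows "norm (b t (x + w) - b t x - D1 t x w) \<le> B * norm w * norm w"
proof -
  have "norm ((b t (x + w) - D1 t x (x + w)) - (b t x - D1 t x x)) \<le> (B * norm w) * norm (x + w - x)"
  proof (rule differentiable_bound[of "cball x (norm w)" _ "\<lambda>y. blinfun_apply (D1 t y - D1 t x)"])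
    fix y assume y: "y \<in> cball x (norm w)"
    show "((\<lambda>y. b t y - D1 t x y) has_derivative blinfun_apply (D1 t y - D1 t x)) (at y within cball x (norm w))"
      by (auto intro!: derivative_eq_intros has_derivative_at_withinI[OF db[OF t]] bounded_linear.has_derivative[OF blinfun.bounded_linear_right]
          simp: blinfun.diff_left)
    have "norm (D1 t y - D1 t x) \<le> B * norm (y - x)" by (rule D1_lipschitz_space[OF t])
    also have "\<dots> \<le> B * norm w"
      using y drift_bound_nonneg by (intro mult_left_mono) (auto simp: dist_norm norm_minus_commute)
    finally show "onorm (blinfun_apply (D1 t y - D1 t x)) \<le> B * norm w"
      by (simp only: norm_blinfun.rep_eq)
  qed (auto simp: dist_norm)
  then show ?thesis by (simp add: blinfun.add_right algebra_simps)
qed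

text \<open>The derivative is replaced by an increment of b over a step of length h, with remainder
  B h^2 at either time; the increments at the two times differ by at most 2 B |t - r|. Together this
  is 2 B |t - r| + 2 B h^2 for D1 applied to a vector of length h.\<close>

lemma D1_holder_time:
  assumes t: "t \<in> {0..T}" and r: "r \<in> {0..T}"
  shows "norm (D1 t x - D1 r x) \<le> 4 * B * sqrt \<bar>t - r\<bar>"
proof (cases "t = r")
  case False
  \<comment> \<open>The step length that balances the two errors.\<close>
  define h where "h = sqrt \<bar>t - r\<bar>"
  have h: "h > 0" "\<bar>t - r\<bar> = h * h" using False by (auto simp: h_def)
  have "norm (D1 t x - D1 r x) \<le> 4 * B * h"
  proof (rule norm_blinfun_bound)
    show "0 \<le> 4 * B * h" using drift_bound_nonneg h by simp
    fix v
    show "norm ((D1 t x - D1 r x) v) \<le> 4 * B * h * norm v"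
    proof (cases "v = 0")
      case v: False
      define w where "w = (h / norm v) *\<^sub>R v"
      have w: "norm w = h" using v h by (simp add: w_def)
      have "(D1 t x - D1 r x) w = (b t (x + w) - b r (x + w)) - (b t x - b r x)
          - (b t (x + w) - b t x - D1 t x w) + (b r (x + w) - b r x - D1 r x w)"
        by (simp add: blinfun.diff_left)
      also have "norm \<dots> \<le> B * \<bar>t - r\<bar> + B * \<bar>t - r\<bar> + B * norm w * norm w + B * norm w * norm w"
        by (intro norm_triangle_mono norm_triangle_le_diff add_mono b_lipschitz_time b_remainder t r)
      also have "\<dots> = 4 * B * h * h" using w h by simp
      finally have "norm ((D1 t x - D1 r x) w) \<le> 4 * B * h * h" .
      moreover have "norm ((D1 t x - D1 r x) w) = h / norm v * norm ((D1 t x - D1 r x) v)"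
        using h by (simp add: w_def blinfun.scaleR_right)
      ultimately have "h * norm ((D1 t x - D1 r x) v) \<le> h * (4 * B * h * norm v)"
        using v by (simp add: field_simps)
      then show ?thesis using h by simp
    qed simp
  qed
  then show ?thesis by (simp add: h_def)
qed simp

text \<open>The point is the factor s. The base point, the displacement and the time are changed one
  after the other, and each change is proportional to s. The first two are Lipschitz in time and are
  weakened by \<open>sqrt T\<close>; the third has exponent 1/2 by \<open>D1_holder_time\<close>,
  whence the summand 4.\<close>

lemma drift_increment_holder:
  assumes X: "\<And>t r. t \<in> {0..T} \<Longrightarrow> r \<in> {0..T} \<Longrightarrow> norm (X t - X r) \<le> B' * \<bar>t - r\<bar>"
    and \<eta>: "\<And>t. t \<in> {0..T} \<Longrightarrow> norm (\<eta> t) \<le> E"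
      "\<And>t r. t \<in> {0..T} \<Longrightarrow> r \<in> {0..T} \<Longrightarrow> norm (\<eta> t - \<eta> r) \<le> E * \<bar>t - r\<bar>"
    and s: "0 \<le> s" and t: "t \<in> {0..T}" and r: "r \<in> {0..T}"
  shows "norm ((b t (X t + s *\<^sub>R \<eta> t) - b t (X t)) - (b r (X r + s *\<^sub>R \<eta> r) - b r (X r)))
     \<le> s * (B * E * (B' * sqrt T + sqrt T + 4)) * sqrt \<bar>t - r\<bar>"
proof -
  have E: "0 \<le> E" using order_trans[OF norm_ge_zero \<eta>(1)[OF t]] .
  have B': "0 \<le> B'" using order_trans[OF norm_ge_zero X[of 0 T]] T by (auto simp: zero_le_mult_iff)
  have Lip: "\<bar>t - r\<bar> \<le> sqrt T * sqrt \<bar>t - r\<bar>"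
    by (rule abs_le_sqrt_mult_sqrt) (use t r in auto)
  let ?k = "s *\<^sub>R \<eta> t" and ?l = "s *\<^sub>R \<eta> r"
  have k: "norm ?k \<le> s * E" "norm ?l \<le> s * E"
    using \<eta>(1)[OF t] \<eta>(1)[OF r] s by (auto intro: mult_left_mono)
  have 1: "norm ((b t (X t + ?k) - b t (X t)) - (b t (X r + ?k) - b t (X r))) \<le> B * (s * E) * (B' * (sqrt T * sqrt \<bar>t - r\<bar>))"
  proof -
    have "norm ((b t (X t + ?k) - b t (X t)) - (b t (X r + ?k) - b t (X r))) \<le> (B * (s * E)) * norm (X t - X r)"
    proof (rule differentiable_bound[of UNIV _ "\<lambda>y. blinfun_apply (D1 t (y + ?k) - D1 t y)"])
      fix y
      have comp: "((\<lambda>y. b t (y + ?k)) has_derivative blinfun_apply (D1 t (y + ?k))) (at y)"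
      proof -
        have "((\<lambda>y. y + ?k) has_derivative (\<lambda>h. h)) (at y)" by (auto intro!: derivative_eq_intros)
        from has_derivative_compose[OF this db[OF t]] show ?thesis by simp
      qed
      show "((\<lambda>y. b t (y + ?k) - b t y) has_derivative blinfun_apply (D1 t (y + ?k) - D1 t y)) (at y)"
        by (rule has_derivative_eq_rhs[OF has_derivative_diff[OF comp db[OF t]]]) (simp add: fun_eq_iff blinfun.diff_left)
      have "norm (D1 t (y + ?k) - D1 t y) \<le> B * norm (y + ?k - y)" by (rule D1_lipschitz_space[OF t])
      also have "\<dots> \<le> B * (s * E)" using k(1) drift_bound_nonneg by (intro mult_left_mono) auto
      finally show "onorm (blinfun_apply (D1 t (y + ?k) - D1 t y)) \<le> B * (s * E)"
        by (simp only: norm_blinfun.rep_eq)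
    qed auto
    also have "\<dots> \<le> (B * (s * E)) * (B' * (sqrt T * sqrt \<bar>t - r\<bar>))"
      using X[OF t r] Lip B' drift_bound_nonneg s E
      by (intro mult_left_mono mult_nonneg_nonneg) (auto intro: order_trans mult_left_mono)
    finally show ?thesis .
  qed
  have 2: "norm (b t (X r + ?k) - b t (X r + ?l)) \<le> B * (s * (E * (sqrt T * sqrt \<bar>t - r\<bar>)))"
  proof -
    have "norm (b t (X r + ?k) - b t (X r + ?l)) \<le> B * norm ((X r + ?k) - (X r + ?l))"
      by (rule b_lipschitz_space[OF t])
    also have "norm ((X r + ?k) - (X r + ?l)) = s * norm (\<eta> t - \<eta> r)"
      using s by (simp flip: scaleR_diff_right)
    also have "B * (s * norm (\<eta> t - \<eta> r)) \<le> B * (s * (E * (sqrt T * sqrt \<bar>t - r\<bar>)))"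
      using \<eta>(2)[OF t r] Lip E drift_bound_nonneg s by (intro mult_left_mono) (auto intro: order_trans mult_left_mono)
    finally show ?thesis .
  qed
  have 3: "norm ((b t (X r + ?l) - b r (X r + ?l)) - (b t (X r) - b r (X r))) \<le> (4 * B * sqrt \<bar>t - r\<bar>) * (s * E)"
  proof -
    have "norm ((b t (X r + ?l) - b r (X r + ?l)) - (b t (X r) - b r (X r))) \<le> (4 * B * sqrt \<bar>t - r\<bar>) * norm (X r + ?l - X r)"
    proof (rule differentiable_bound[of UNIV _ "\<lambda>y. blinfun_apply (D1 t y - D1 r y)"])
      fix y
      show "((\<lambda>y. b t y - b r y) has_derivative blinfun_apply (D1 t y - D1 r y)) (at y)"
        by (rule has_derivative_eq_rhs[OF has_derivative_diff[OF db[OF t] db[OF r]]]) (simp add: fun_eq_iff blinfun.diff_left)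
      show "onorm (blinfun_apply (D1 t y - D1 r y)) \<le> 4 * B * sqrt \<bar>t - r\<bar>"
        using D1_holder_time[OF t r] by (simp only: norm_blinfun.rep_eq)
    qed auto
    also have "\<dots> \<le> (4 * B * sqrt \<bar>t - r\<bar>) * (s * E)"
      using k(2) drift_bound_nonneg by (intro mult_left_mono) auto
    finally show ?thesis .
  qed
  have "(b t (X t + ?k) - b t (X t)) - (b r (X r + ?l) - b r (X r))
      = ((b t (X t + ?k) - b t (X t)) - (b t (X r + ?k) - b t (X r))) + (b t (X r + ?k) - b t (X r + ?l))
        + ((b t (X r + ?l) - b r (X r + ?l)) - (b t (X r) - b r (X r)))"
    by simp
  also have "norm \<dots> \<le> B * (s * E) * (B' * (sqrt T * sqrt \<bar>t - r\<bar>)) + B * (s * (E * (sqrt T * sqrt \<bar>t - r\<bar>)))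
      + (4 * B * sqrt \<bar>t - r\<bar>) * (s * E)"
    by (intro norm_triangle_mono 1 2 3)
  also have "\<dots> = s * (B * E * (B' * sqrt T + sqrt T + 4)) * sqrt \<bar>t - r\<bar>"
    by (simp add: algebra_simps)
  finally show ?thesis .
qed

end

text \<open>The square of the positive part of \<rho>^2 - (t - t0)^2. Squaring makes it C^1 with a
  Lipschitz derivative, which is enough because \<eta>' has to be Hoelder continuous of exponent
  1/2.\<close>

lemma bump:
  fixes t0 \<rho> T :: real
  assumes "0 < \<rho>" "\<rho> < t0" "t0 + \<rho> < T"
  obtains \<beta> \<beta>' :: "real \<Rightarrow> real" and L where
    "\<And>t. (\<beta> has_real_derivative \<beta>' t) (at t)" "0 < \<beta> t0"
    "\<And>t. \<rho> \<le> \<bar>t - t0\<bar> \<Longrightarrow> \<beta> t = 0" "\<And>t. \<rho> \<le> \<bar>t - t0\<bar> \<Longrightarrow> \<beta>' t = 0"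
    "\<And>t. t \<in> {0..T} \<Longrightarrow> \<bar>\<beta> t\<bar> \<le> L"
    "\<And>t r. t \<in> {0..T} \<Longrightarrow> r \<in> {0..T} \<Longrightarrow> \<bar>\<beta> t - \<beta> r\<bar> \<le> L * \<bar>t - r\<bar>"
    "\<And>t r. t \<in> {0..T} \<Longrightarrow> r \<in> {0..T} \<Longrightarrow> \<bar>\<beta>' t - \<beta>' r\<bar> \<le> L * \<bar>t - r\<bar>"
proof -
  define p where "p = (\<lambda>t. max 0 (\<rho>\<^sup>2 - (t - t0)\<^sup>2))"
  define \<beta> where "\<beta> = (\<lambda>t. (p t)\<^sup>2)"
  define \<beta>' where "\<beta>' = (\<lambda>t. - 4 * (t - t0) * p t)"
  have sq: "((\<lambda>z::real. (max 0 z)\<^sup>2) has_real_derivative 2 * max 0 z) (at z)" for z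
  proof (cases z "0::real" rule: linorder_cases)
    case less
    have "((\<lambda>z::real. 0) has_real_derivative 2 * max 0 z) (at z)" using less by (auto intro!: derivative_eq_intros)
    then show ?thesis
      by (rule has_field_derivative_transform_within_open[of _ _ _ "{..<0}"]) (use less in auto)
  next
    case equal
    have "((\<lambda>h::real. ((max 0 (0 + h))\<^sup>2 - (max 0 0)\<^sup>2) / h) \<longlongrightarrow> 0) (at 0)"
    proof (rule Lim_null_comparison)
      show "\<forall>\<^sub>F h in at 0. norm (((max 0 (0 + h))\<^sup>2 - (max 0 0)\<^sup>2) / h) \<le> \<bar>h::real\<bar>"
        by (intro always_eventually allI) (auto simp: max_def power2_eq_square)
      show "((\<lambda>h::real. \<bar>h\<bar>) \<longlongrightarrow> 0) (at 0)" by (intro tendsto_rabs_zero tendsto_ident_at)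
    qed
    then show ?thesis using equal by (simp add: DERIV_def)
  next
    case greater
    have "((\<lambda>z::real. z\<^sup>2) has_real_derivative 2 * max 0 z) (at z)" using greater by (auto intro!: derivative_eq_intros)
    then show ?thesis
      by (rule has_field_derivative_transform_within_open[of _ _ _ "{0<..}"]) (use greater in auto)
  qed
  have p: "0 \<le> p t" "p t \<le> \<rho>\<^sup>2" for t by (auto simp: p_def)
  have d: "(\<beta> has_real_derivative \<beta>' t) (at t)" for t
  proof -
    have "((\<lambda>t. \<rho>\<^sup>2 - (t - t0)\<^sup>2) has_real_derivative - 2 * (t - t0)) (at t)"
      by (auto intro!: derivative_eq_intros)
    from DERIV_chain2[OF sq this] show ?thesis by (simp add: \<beta>_def \<beta>'_def p_def algebra_simps)
  qed
  have p0: "p t = 0" if "\<rho> \<le> \<bar>t - t0\<bar>" for t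
    using abs_le_square_iff[of \<rho> "t - t0"] that assms by (simp add: p_def)
  have pL: "\<bar>p t - p r\<bar> \<le> 2 * T * \<bar>t - r\<bar>" if "t \<in> {0..T}" "r \<in> {0..T}" for t r
  proof -
    have "\<bar>p t - p r\<bar> \<le> \<bar>(t - t0)\<^sup>2 - (r - t0)\<^sup>2\<bar>" unfolding p_def by (auto simp: max_def)
    also have "(t - t0)\<^sup>2 - (r - t0)\<^sup>2 = ((t - t0) + (r - t0)) * (t - r)" by (simp add: power2_eq_square algebra_simps)
    also have "\<bar>\<dots>\<bar> = \<bar>(t - t0) + (r - t0)\<bar> * \<bar>t - r\<bar>" by (rule abs_mult)
    also have "\<dots> \<le> 2 * T * \<bar>t - r\<bar>" using that assms by (intro mult_right_mono) auto
    finally show ?thesis .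
  qed
  \<comment> \<open>The sum of the separate bounds: for \<beta>, for the slope of \<beta>, and (last
    two terms) for the slope of \<beta>'.\<close>
  define L where "L = \<rho>\<^sup>2 * \<rho>\<^sup>2 + 4 * T * \<rho>\<^sup>2 + 4 * \<rho>\<^sup>2 + 8 * T * T"
  have T: "T > 0" using assms by auto
  show ?thesis
  proof (rule that[OF d])
    show "0 < \<beta> t0" using assms by (simp add: \<beta>_def p_def)
    show "\<beta> t = 0" "\<beta>' t = 0" if "\<rho> \<le> \<bar>t - t0\<bar>" for t using p0[OF that] by (auto simp: \<beta>_def \<beta>'_def)
    have "(p t)\<^sup>2 \<le> \<rho>\<^sup>2 * \<rho>\<^sup>2" for t
      using mult_mono[OF p(2) p(2) _ p(1), of t t] by (simp add: power2_eq_square)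
    moreover have "\<rho>\<^sup>2 * \<rho>\<^sup>2 \<le> L" using T by (simp add: L_def)
    ultimately show "\<bar>\<beta> t\<bar> \<le> L" for t by (auto simp: \<beta>_def intro: order_trans)
    have lip: "\<bar>\<beta>' t\<bar> \<le> 4 * T * \<rho>\<^sup>2" if "t \<in> {0..T}" for t
    proof -
      have "\<bar>\<beta>' t\<bar> = 4 * \<bar>t - t0\<bar> * p t" by (simp only: \<beta>'_def abs_mult abs_of_nonneg[OF p(1)] abs_numeral abs_minus_cancel)
      also have "\<dots> \<le> 4 * T * \<rho>\<^sup>2" using that assms p by (intro mult_mono) auto
      finally show ?thesis .
    qed
    fix t r assume tr: "t \<in> {0..T}" "r \<in> {0..T}"
    have "norm (\<beta> t - \<beta> r) \<le> (4 * T * \<rho>\<^sup>2) * norm (t - r)"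
      by (rule field_differentiable_bound[of "{0..T}" _ \<beta>'])
        (use tr lip d in \<open>auto intro: has_field_derivative_at_within\<close>)
    also have "\<dots> \<le> L * norm (t - r)" using T by (intro mult_right_mono) (auto simp: L_def)
    finally show "\<bar>\<beta> t - \<beta> r\<bar> \<le> L * \<bar>t - r\<bar>" by simp
    have "\<beta>' t - \<beta>' r = - 4 * ((t - r) * p t + (r - t0) * (p t - p r))"
      by (simp add: \<beta>'_def algebra_simps)
    then have "\<bar>\<beta>' t - \<beta>' r\<bar> = 4 * \<bar>(t - r) * p t + (r - t0) * (p t - p r)\<bar>" by (simp only: abs_mult abs_minus_cancel abs_numeral)
    also have "\<dots> \<le> 4 * (\<bar>t - r\<bar> * \<rho>\<^sup>2 + T * (2 * T * \<bar>t - r\<bar>))"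
    proof -
      have "\<bar>(t - r) * p t\<bar> \<le> \<bar>t - r\<bar> * \<rho>\<^sup>2"
        unfolding abs_mult using p by (intro mult_left_mono) auto
      moreover have "\<bar>(r - t0) * (p t - p r)\<bar> \<le> T * (2 * T * \<bar>t - r\<bar>)"
        unfolding abs_mult using pL[OF tr] tr assms by (intro mult_mono) auto
      ultimately show ?thesis
        by (intro mult_left_mono order_trans[OF abs_triangle_ineq] add_mono) auto
    qed
    also have "\<dots> = (4 * \<rho>\<^sup>2 + 8 * T * T) * \<bar>t - r\<bar>" by (simp add: algebra_simps)
    also have "\<dots> \<le> L * \<bar>t - r\<bar>" using T by (intro mult_right_mono) (auto simp: L_def)
    finally show "\<bar>\<beta>' t - \<beta>' r\<bar> \<le> L * \<bar>t - r\<bar>" .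
  qed
qed

section \<open>The divergence of the drift and its second derivative\<close>

lemma jacobian_mult:
  fixes f :: "real^'n \<Rightarrow> real^'m"
  assumes "(f has_derivative f') (at x)"
  shows "jacobian f (at x) *v h = f' h"
  using assms frechet_derivative_at[OF assms]
  by (simp add: jacobian_def matrix_works has_derivative_linear)

lemma divergence_eq:
  fixes f :: "real^'n \<Rightarrow> real^'n"
  assumes "(f has_derivative f') (at x)"
  shows "divergence f x = (\<Sum>k\<in>UNIV. f' (axis k 1) $ k)"
  using frechet_derivative_at[OF assms]
  by (simp add: divergence_def trace_def jacobian_def matrix_def)

text \<open>The trace on bounded linear maps. Being linear, it commutes with differentiation:
  \<open>btrace (D2 t x h)\<close> is the first derivative of the divergence and
  \<open>btrace (D3 t x h h)\<close> its second.\<close>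

definition btrace :: "(real^'n) \<Rightarrow>\<^sub>L (real^'n) \<Rightarrow> real" where
  "btrace A = (\<Sum>k\<in>UNIV. A (axis k 1) $ k)"

lemma linear_btrace: "linear btrace"
  by (auto simp: btrace_def blinfun.add_left blinfun.scaleR_left sum.distrib sum_distrib_left intro!: linearI)

lemma btrace_sum:
  fixes A :: "(real^'n) \<Rightarrow>\<^sub>L (real^'n) \<Rightarrow>\<^sub>L (real^'n)"
  shows "btrace (A v) = (\<Sum>i\<in>UNIV. v $ i * btrace (A (axis i 1)))"
proof -
  have "A (\<Sum>i\<in>UNIV. v $ i *\<^sub>R axis i 1) = (\<Sum>i\<in>UNIV. v $ i *\<^sub>R A (axis i 1))"
    by (simp add: blinfun.sum_right blinfun.scaleR_right)
  also have "(\<Sum>i\<in>UNIV. v $ i *\<^sub>R axis i 1) = v"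
    using basis_expansion[of v] by (simp add: scalar_mult_eq_scaleR)
  finally show ?thesis
    by (simp add: linear_sum[OF linear_btrace] linear_scale[OF linear_btrace])
qed

lemma btrace_quadratic:
  fixes A :: "(real^'n) \<Rightarrow>\<^sub>L (real^'n) \<Rightarrow>\<^sub>L (real^'n) \<Rightarrow>\<^sub>L (real^'n)"
  shows "btrace (A (c *\<^sub>R v) (c *\<^sub>R v)) = c\<^sup>2 * btrace (A v v)"
  by (simp add: blinfun.scaleR_left blinfun.scaleR_right linear_scale[OF linear_btrace] power2_eq_square)

lemma continuous_on_strip_compose:
  assumes "continuous_on ({0..T} \<times> UNIV) (\<lambda>(t, x). F t x)" "continuous_on {0..T} Y"
  shows "continuous_on {0..T} (\<lambda>t. F t (Y t))"
proof -
  have "continuous_on {0..T} (\<lambda>t. (t, Y t))" by (intro continuous_intros assms(2))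
  from continuous_on_compose2[OF assms(1) this] show ?thesis by auto
qed

context
  fixes T :: real and b :: "real \<Rightarrow> real^'n \<Rightarrow> real^'n"
    and D1 :: "real \<Rightarrow> real^'n \<Rightarrow> (real^'n) \<Rightarrow>\<^sub>L (real^'n)"
    and D2 :: "real \<Rightarrow> real^'n \<Rightarrow> (real^'n) \<Rightarrow>\<^sub>L (real^'n) \<Rightarrow>\<^sub>L (real^'n)"
    and D3 :: "real \<Rightarrow> real^'n \<Rightarrow> (real^'n) \<Rightarrow>\<^sub>L (real^'n) \<Rightarrow>\<^sub>L (real^'n) \<Rightarrow>\<^sub>L (real^'n)"
  assumes db: "\<And>t x. t \<in> {0..T} \<Longrightarrow> (b t has_derivative blinfun_apply (D1 t x)) (at x)"
    and dD1: "\<And>t x. t \<in> {0..T} \<Longrightarrow> (D1 t has_derivative blinfun_apply (D2 t x)) (at x)"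
    and dD2: "\<And>t x. t \<in> {0..T} \<Longrightarrow> (D2 t has_derivative blinfun_apply (D3 t x)) (at x)"
begin

lemma divergence_drift: "t \<in> {0..T} \<Longrightarrow> divergence (b t) x = (\<Sum>k\<in>UNIV. D1 t x (axis k 1) $ k)"
  by (rule divergence_eq[OF db])

lemma divergence_derivative:
  assumes t: "t \<in> {0..T}"
  shows "(divergence (b t) has_derivative (\<lambda>h. btrace (D2 t x h))) (at x)"
proof -
  have "((\<lambda>x. \<Sum>k\<in>UNIV. D1 t x (axis k 1) $ k) has_derivative (\<lambda>h. \<Sum>k\<in>UNIV. D2 t x h (axis k 1) $ k)) (at x)"
    by (intro has_derivative_sum bounded_linear.has_derivative[OF bounded_linear_vec_nth]
        bounded_linear.has_derivative[OF blinfun.bounded_linear_left] dD1 t)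
  then show ?thesis
    unfolding btrace_def divergence_drift[OF t, abs_def] .
qed

lemma div1_derivative:
  assumes t: "t \<in> {0..T}"
  shows "((\<lambda>x. btrace (D2 t x v)) has_derivative (\<lambda>h. btrace (D3 t x h v))) (at x)"
  unfolding btrace_def
  by (intro has_derivative_sum bounded_linear.has_derivative[OF bounded_linear_vec_nth]
      bounded_linear.has_derivative[OF blinfun.bounded_linear_left] dD2 t)

lemma gradient_divergence:
  assumes t: "t \<in> {0..T}"
  shows "gradient (divergence (b t)) x = (\<chi> i. btrace (D2 t x (axis i 1)))"
  unfolding gradient_def frechet_derivative_at[OF divergence_derivative[OF t, of x], symmetric] by (rule refl)

text \<open>Replaces the Hessian, defined through chosen derivatives, by \<open>D3\<close>, whose
  joint continuity in time and space is known.\<close>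

lemma hessian_divergence:
  assumes t: "t \<in> {0..T}"
  shows "v \<bullet> (hessian (divergence (b t)) x *v v) = btrace (D3 t x v v)"
proof -
  have "((\<lambda>x. \<chi> i. btrace (D2 t x (axis i 1))) has_derivative (\<lambda>h. \<chi> i. btrace (D3 t x h (axis i 1)))) (at x)"
    by (subst has_derivative_componentwise_within) (auto simp: Basis_vec_def inner_axis intro!: div1_derivative t)
  then have "(gradient (divergence (b t)) has_derivative (\<lambda>h. \<chi> i. btrace (D3 t x h (axis i 1)))) (at x)"
    unfolding gradient_divergence[OF t, abs_def] .
  from jacobian_mult[OF this, of v] show ?thesis
    by (simp add: hessian_def inner_vec_def btrace_sum[of "D3 t x v" v])
qed

text \<open>A Taylor bound along the segment obtained by monotonicity, twice: the first derivative
  plus c r is nonincreasing and starts at 0 because x is critical, so the divergence plus c r^2 / 2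
  is nonincreasing too.\<close>

lemma divergence_decrease:
  assumes t: "t \<in> {0..T}" and crit: "gradient (divergence (b t)) x = 0"
    and s: "0 \<le> s" and neg: "\<And>r. 0 \<le> r \<Longrightarrow> r \<le> s \<Longrightarrow> btrace (D3 t (x + r *\<^sub>R h) h h) \<le> - c"
  shows "divergence (b t) (x + s *\<^sub>R h) \<le> divergence (b t) x - c * s\<^sup>2 / 2"
proof -
  have line: "((\<lambda>r. x + r *\<^sub>R h) has_derivative (\<lambda>r. r *\<^sub>R h)) (at r)" for r
    by (auto intro!: derivative_eq_intros)
  have div1_scale: "btrace (D2 t y (r *\<^sub>R h)) = r * btrace (D2 t y h)" for y r
    by (simp add: btrace_def blinfun.scaleR_left blinfun.scaleR_right sum_distrib_left)
  have div2_scale: "btrace (D3 t y (r *\<^sub>R h) h) = r * btrace (D3 t y h h)" for y r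
    by (simp add: btrace_def blinfun.scaleR_left blinfun.scaleR_right sum_distrib_left)
  have G: "((\<lambda>r. divergence (b t) (x + r *\<^sub>R h)) has_real_derivative btrace (D2 t (x + r *\<^sub>R h) h)) (at r)" for r
    using has_derivative_compose[OF line[of r] divergence_derivative[OF t]]
    by (simp add: has_field_derivative_def div1_scale mult_commute_abs)
  have G': "((\<lambda>r. btrace (D2 t (x + r *\<^sub>R h) h)) has_real_derivative btrace (D3 t (x + r *\<^sub>R h) h h)) (at r)" for r
    using has_derivative_compose[OF line[of r] div1_derivative[OF t, of h]]
    by (simp add: has_field_derivative_def div2_scale mult_commute_abs)
  have "btrace (D2 t x (axis i 1)) = 0" for i
    using crit gradient_divergence[OF t, of x] by (simp add: vec_eq_iff)
  then have d0: "btrace (D2 t x h) = 0" by (simp add: btrace_sum[of "D2 t x" h])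
  have d1: "btrace (D2 t (x + r *\<^sub>R h) h) + c * r \<le> 0" if r: "0 \<le> r" "r \<le> s" for r
  proof -
    have "btrace (D2 t (x + r *\<^sub>R h) h) + c * r \<le> btrace (D2 t (x + 0 *\<^sub>R h) h) + c * 0"
    proof (rule DERIV_nonpos_imp_nonincreasing[OF r(1)])
      fix q assume q: "0 \<le> q" "q \<le> r"
      have "((\<lambda>r. btrace (D2 t (x + r *\<^sub>R h) h) + c * r) has_real_derivative (btrace (D3 t (x + q *\<^sub>R h) h h) + c)) (at q)"
        by (auto intro!: derivative_eq_intros G')
      then show "\<exists>y. DERIV (\<lambda>r. btrace (D2 t (x + r *\<^sub>R h) h) + c * r) q :> y \<and> y \<le> 0"
        using neg[of q] q r by force
    qed
    then show ?thesis using d0 by simp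
  qed
  have "divergence (b t) (x + s *\<^sub>R h) + c * s\<^sup>2 / 2 \<le> divergence (b t) (x + 0 *\<^sub>R h) + c * 0\<^sup>2 / 2"
  proof (rule DERIV_nonpos_imp_nonincreasing[OF s])
    fix q assume q: "0 \<le> q" "q \<le> s"
    have "((\<lambda>r. divergence (b t) (x + r *\<^sub>R h) + c * r\<^sup>2 / 2) has_real_derivative (btrace (D2 t (x + q *\<^sub>R h) h) + c * q)) (at q)"
      by (auto intro!: derivative_eq_intros G)
    then show "\<exists>y. DERIV (\<lambda>r. divergence (b t) (x + r *\<^sub>R h) + c * r\<^sup>2 / 2) q :> y \<and> y \<le> 0"
      using d1[OF q] by blast
  qed
  then show ?thesis by simp
qed

lemma divergence_continuous:
  assumes "continuous_on ({0..T} \<times> UNIV) (\<lambda>(t, x). D1 t x)" "continuous_on {0..T} Y"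
  shows "continuous_on {0..T} (\<lambda>t. divergence (b t) (Y t))"
proof -
  have "continuous_on {0..T} (\<lambda>t. \<Sum>k\<in>UNIV. D1 t (Y t) (axis k 1) $ k)"
    by (intro continuous_intros continuous_on_strip_compose[OF assms])
  then show ?thesis by (rule continuous_on_eq) (simp add: divergence_drift)
qed

lemma hessian_continuous:
  assumes "continuous_on ({0..T} \<times> UNIV) (\<lambda>(t, x). D3 t x)" "continuous_on {0..T} Y" "continuous_on {0..T} \<eta>"
  shows "continuous_on {0..T} (\<lambda>t. \<eta> t \<bullet> (hessian (divergence (b t)) (Y t) *v \<eta> t))"
proof -
  have "continuous_on {0..T} (\<lambda>t. \<Sum>k\<in>UNIV. D3 t (Y t) (\<eta> t) (\<eta> t) (axis k 1) $ k)"
    by (intro continuous_intros continuous_on_strip_compose[OF assms(1,2)] assms(3))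
  then show ?thesis by (rule continuous_on_eq) (simp add: hessian_divergence btrace_def)
qed

text \<open>Continuity of \<open>D3\<close> in (t, x) spreads the negativity at the eigenvector to a
  neighbourhood, uniformly.\<close>

lemma negative_neighbourhood:
  assumes c3: "continuous_on ({0..T} \<times> UNIV) (\<lambda>(t, x). D3 t x)"
    and t0: "t0 \<in> {0..T}" and ev: "\<mu> < 0" "is_eigenvalue (hessian (divergence (b t0)) y0) \<mu>"
  obtains v c \<delta> where "0 < c" "0 < \<delta>"
    "\<And>t x. t \<in> {0..T} \<Longrightarrow> \<bar>t - t0\<bar> < \<delta> \<Longrightarrow> norm (x - y0) < \<delta> \<Longrightarrow> btrace (D3 t x v v) \<le> - c"
proof -
  obtain v where v: "v \<noteq> 0" "hessian (divergence (b t0)) y0 *v v = \<mu> *\<^sub>R v"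
    using ev by (auto simp: is_eigenvalue_def)
  \<comment> \<open>Half the absolute value of the quadratic form at the eigenvector: starting from
    -2c, a deviation below c leaves at most -c.\<close>
  define c where "c = - (\<mu> * (v \<bullet> v)) / 2"
  have c: "0 < c" using ev v by (simp add: c_def mult_neg_pos)
  have "btrace (D3 t0 y0 v v) = - (2 * c)"
    using hessian_divergence[OF t0, of v y0] v by (simp add: c_def)
  moreover have "continuous_on ({0..T} \<times> UNIV) (\<lambda>z. btrace (D3 (fst z) (snd z) v v))"
    using c3 unfolding btrace_def case_prod_beta by (intro continuous_intros)
  ultimately have "\<exists>d>0. \<forall>z\<in>{0..T} \<times> UNIV. dist z (t0, y0) < d \<longrightarrow> dist (btrace (D3 (fst z) (snd z) v v)) (- (2 * c)) < c"
    using t0 c unfolding continuous_on_iff by fastforce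
  then obtain d where d: "d > 0" "\<And>z. z \<in> {0..T} \<times> UNIV \<Longrightarrow> dist z (t0, y0) < d \<Longrightarrow> dist (btrace (D3 (fst z) (snd z) v v)) (- (2 * c)) < c"
    by blast
  show ?thesis
  proof (rule that[OF c])
    show "0 < d / 2" using d by simp
    fix t x assume tx: "t \<in> {0..T}" "\<bar>t - t0\<bar> < d / 2" "norm (x - y0) < d / 2"
    have "dist (t, x) (t0, y0) \<le> dist t t0 + dist x y0"
      unfolding dist_Pair_Pair by (rule sqrt_sum_squares_le_sum) auto
    also have "\<dots> = \<bar>t - t0\<bar> + norm (x - y0)" by (simp only: dist_real_def dist_norm)
    also have "\<dots> < d" using tx by simp
    finally have "dist (btrace (D3 t x v v)) (- (2 * c)) < c" using d(2)[of "(t, x)"] tx by simp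
    then show "btrace (D3 t x v v) \<le> - c" by (simp add: dist_real_def abs_less_iff)
  qed
qed

end

section \<open>Destabilization of the deterministic path\<close>

theorem theorem4p9:
  fixes H T :: real
    and b :: "real \<Rightarrow> real^'n \<Rightarrow> real^'n"
    and \<sigma> :: "real \<Rightarrow> real^'n^'n"
    and X :: "real \<Rightarrow> real^'n"
    and x0 xT :: "real^'n"
    and t0 :: real
  assumes "1/4 < H" and "H < 1" and "0 < T"
    and "assumption_A T b \<sigma>"
    and "\<forall>t\<in>{0..T}. (X has_vector_derivative b t (X t)) (at t within {0..T})"
    and "X 0 = x0" and "xT = X T"
    and "\<forall>t\<in>{0..T}. gradient (divergence (b t)) (X t) = 0"
    and "t0 \<in> {0<..<T}"
    and "\<exists>\<mu><0. is_eigenvalue (hessian (divergence (b t0)) (X t0)) \<mu>"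
  shows "\<exists>\<epsilon>0>0. \<forall>\<epsilon>>\<epsilon>0.
           (\<exists>\<eta>\<in>free_perturbations H \<sigma> T. second_variation H \<sigma> T b \<epsilon> X \<eta> < 0) \<and>
           (\<exists>\<eta>\<in>fixed_perturbations H \<sigma> T. second_variation H \<sigma> T b \<epsilon> X \<eta> < 0) \<and>
           \<not> local_most_probable_transition_path H \<sigma> T b x0 xT \<epsilon> X \<and>
           \<not> local_most_probable_evolution_path H \<sigma> T b x0 \<epsilon> X"
proof -
  have H: "0 < H" "H < 1" and T: "0 < T" and t0: "t0 \<in> {0..T}" "0 < t0" "t0 < T" using assms by auto
  have X': "\<And>t. t \<in> {0..T} \<Longrightarrow> (X has_vector_derivative b t (X t)) (at t within {0..T})"
    and crit: "\<And>t. t \<in> {0..T} \<Longrightarrow> gradient (divergence (b t)) (X t) = 0" using assms by auto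
  obtain \<sigma>' m where \<sigma>: "\<And>t. t \<in> {0..T} \<Longrightarrow> (\<sigma> has_vector_derivative \<sigma>' t) (at t within {0..T})"
      "continuous_on {0..T} \<sigma>'" "0 < m" "\<And>t y. t \<in> {0..T} \<Longrightarrow> m * norm y \<le> norm (\<sigma> t *v y)"
    by (rule diffusion_derivative[OF assms(4)]) blast
  have Cb: "C_b_1_3 T b" using assms(4) by (simp add: assumption_A_def)
  obtain bt where bt: "bounded_continuous_on_strip T bt"
      "\<And>t x. t \<in> {0..T} \<Longrightarrow> ((\<lambda>s. b s x) has_vector_derivative bt t x) (at t within {0..T})"
    using Cb unfolding C_b_1_3_def by blast
  obtain D1 D2 D3 where D: "bounded_continuous_on_strip T D1" "bounded_continuous_on_strip T D2"
      "bounded_continuous_on_strip T D3"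
    and db: "\<And>t x. t \<in> {0..T} \<Longrightarrow> (b t has_derivative blinfun_apply (D1 t x)) (at x)"
    and dD1: "\<And>t x. t \<in> {0..T} \<Longrightarrow> (D1 t has_derivative blinfun_apply (D2 t x)) (at x)"
    and dD2: "\<And>t x. t \<in> {0..T} \<Longrightarrow> (D2 t has_derivative blinfun_apply (D3 t x)) (at x)"
    using Cb unfolding C_b_1_3_def by blast
  have cb: "continuous_on ({0..T} \<times> UNIV) (\<lambda>(t, x). b t x)"
    and cD1: "continuous_on ({0..T} \<times> UNIV) (\<lambda>(t, x). D1 t x)"
    and cD3: "continuous_on ({0..T} \<times> UNIV) (\<lambda>(t, x). D3 t x)"
    using Cb D by (auto simp: C_b_1_3_def bounded_continuous_on_strip_def)
  have bound: "\<exists>B. \<forall>t\<in>{0..T}. \<forall>x. norm (F t x) \<le> B" if "bounded_continuous_on_strip T F"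
    for F :: "real \<Rightarrow> real^'n \<Rightarrow> 'z::real_normed_vector"
    using that by (fastforce simp: bounded_continuous_on_strip_def bounded_iff)
  obtain B1 B2 B3 B4 where B': "\<And>t x. t \<in> {0..T} \<Longrightarrow> norm (bt t x) \<le> B1"
      "\<And>t x. t \<in> {0..T} \<Longrightarrow> norm (D1 t x) \<le> B2" "\<And>t x. t \<in> {0..T} \<Longrightarrow> norm (D2 t x) \<le> B3"
      "\<And>t x. t \<in> {0..T} \<Longrightarrow> norm (b t x) \<le> B4"
    using bound[OF bt(1)] bound[OF D(1)] bound[OF D(2)] bound[of b] Cb unfolding C_b_1_3_def by metis
  define B where "B = Max {B1, B2, B3}"
  have B: "norm (bt t x) \<le> B" "norm (D1 t x) \<le> B" "norm (D2 t x) \<le> B" if "t \<in> {0..T}" for t x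
    using B'(1-3)[OF that, of x] by (auto simp: B_def)
  have B4: "0 \<le> B4" using order_trans[OF norm_ge_zero B'(4)[OF t0(1)]] .
  have Xlip: "norm (X t - X r) \<le> B4 * \<bar>t - r\<bar>" if "t \<in> {0..T}" "r \<in> {0..T}" for t r
  proof -
    have "norm (X t - X r) \<le> B4 * norm (t - r)"
    proof (rule differentiable_bound[of "{0..T}" _ "\<lambda>t h. h *\<^sub>R b t (X t)"])
      fix t assume t: "t \<in> {0..T}"
      show "(X has_derivative (\<lambda>h. h *\<^sub>R b t (X t))) (at t within {0..T})"
        using X'[OF t] by (simp add: has_vector_derivative_def)
      show "onorm (\<lambda>h. h *\<^sub>R b t (X t)) \<le> B4"
        using B'(4)[OF t, of "X t"] by (intro onorm_le) (simp add: mult.commute[of B4] mult_left_mono)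
    qed (use that in auto)
    then show ?thesis by simp
  qed
  have Xc: "continuous_on {0..T} X"
    unfolding continuous_on_eq_continuous_within using has_vector_derivative_continuous[OF X'] by blast
  obtain \<mu> where \<mu>: "\<mu> < 0" "is_eigenvalue (hessian (divergence (b t0)) (X t0)) \<mu>" using assms(10) by blast
  obtain v c \<delta> where c: "0 < c" "0 < \<delta>"
    and neg: "\<And>t x. t \<in> {0..T} \<Longrightarrow> \<bar>t - t0\<bar> < \<delta> \<Longrightarrow> norm (x - X t0) < \<delta> \<Longrightarrow> btrace (D3 t x v v) \<le> - c"
  proof (rule negative_neighbourhood[OF db dD1 dD2 cD3 t0(1) \<mu>])
    fix c \<delta> v
    assume "0 < c" "0 < \<delta>"
      "\<And>t x. t \<in> {0..T} \<Longrightarrow> \<bar>t - t0\<bar> < \<delta> \<Longrightarrow> norm (x - X t0) < \<delta> \<Longrightarrow> btrace (D3 t x v v) \<le> - c"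
    then show thesis by (rule that)
  qed
  \<comment> \<open>The first two terms keep the support of the bump inside (0,T), the third keeps
    it within time \<delta> of t0. By the last one X moves at most \<delta>/2 over the support, as X
    has Lipschitz constant \<open>B4\<close>.\<close>
  define \<rho> where "\<rho> = min (min (t0 / 2) ((T - t0) / 2)) (min (\<delta> / 2) (\<delta> / (2 * (B4 + 1))))"
  have \<rho>: "0 < \<rho>" "\<rho> < t0" "t0 + \<rho> < T" "\<rho> < \<delta>" "B4 * \<rho> \<le> \<delta> / 2"
  proof -
    have le: "\<rho> \<le> t0 / 2" "\<rho> \<le> (T - t0) / 2" "\<rho> \<le> \<delta> / 2" "\<rho> \<le> \<delta> / (2 * (B4 + 1))"
      unfolding \<rho>_def by linarith+
    show "0 < \<rho>" using c t0 B4 unfolding \<rho>_def min_less_iff_conj by simp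
    show "\<rho> < t0" "t0 + \<rho> < T" "\<rho> < \<delta>" using le c t0 by auto
    have "B4 * \<rho> \<le> B4 * (\<delta> / (2 * (B4 + 1)))" using B4 le by (intro mult_left_mono) auto
    also have "\<dots> = (B4 / (B4 + 1)) * (\<delta> / 2)" using B4 by (simp add: field_simps)
    also have "\<dots> \<le> 1 * (\<delta> / 2)" using B4 c by (intro mult_right_mono) auto
    finally show "B4 * \<rho> \<le> \<delta> / 2" by simp
  qed
  obtain \<beta> \<beta>' L where \<beta>: "\<And>t. (\<beta> has_real_derivative \<beta>' t) (at t)" "0 < \<beta> t0"
    "\<And>t. \<rho> \<le> \<bar>t - t0\<bar> \<Longrightarrow> \<beta> t = 0" "\<And>t. \<rho> \<le> \<bar>t - t0\<bar> \<Longrightarrow> \<beta>' t = 0"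
    "\<And>t. t \<in> {0..T} \<Longrightarrow> \<bar>\<beta> t\<bar> \<le> L"
    "\<And>t r. t \<in> {0..T} \<Longrightarrow> r \<in> {0..T} \<Longrightarrow> \<bar>\<beta> t - \<beta> r\<bar> \<le> L * \<bar>t - r\<bar>"
    "\<And>t r. t \<in> {0..T} \<Longrightarrow> r \<in> {0..T} \<Longrightarrow> \<bar>\<beta>' t - \<beta>' r\<bar> \<le> L * \<bar>t - r\<bar>"
    by (rule bump[OF \<rho>(1-3)]) blast
  define \<eta> where "\<eta> = (\<lambda>t. \<beta> t *\<^sub>R v)"
  define \<eta>' where "\<eta>' = (\<lambda>t. \<beta>' t *\<^sub>R v)"
  define E where "E = L * norm v"
  have L: "0 \<le> L" using \<beta>(5)[OF t0(1)] by linarith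
  have E: "0 \<le> E" using L by (simp add: E_def)
  have \<eta>b: "norm (\<eta> t) \<le> E" if "t \<in> {0..T}" for t
    using \<beta>(5)[OF that] by (simp add: \<eta>_def E_def mult_right_mono)
  have \<eta>l: "norm (\<eta> t - \<eta> r) \<le> E * \<bar>t - r\<bar>" "norm (\<eta>' t - \<eta>' r) \<le> E * \<bar>t - r\<bar>" if "t \<in> {0..T}" "r \<in> {0..T}" for t r
    using mult_right_mono[OF \<beta>(6)[OF that], of "norm v"] mult_right_mono[OF \<beta>(7)[OF that], of "norm v"]
    by (simp_all add: \<eta>_def \<eta>'_def E_def mult_ac flip: scaleR_diff_left)
  have sqrtT: "\<bar>t - r\<bar> \<le> sqrt T * sqrt \<bar>t - r\<bar>" if "t \<in> {0..T}" "r \<in> {0..T}" for t r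
    by (rule abs_le_sqrt_mult_sqrt) (use that in auto)
  have \<eta>d: "(\<eta> has_vector_derivative \<eta>' t) (at t)" for t
    unfolding \<eta>_def \<eta>'_def using has_vector_derivative_scaleR[OF \<beta>(1) has_vector_derivative_const[of v]] by simp
  have \<eta>c: "continuous_on S \<eta>" for S
    by (intro continuous_at_imp_continuous_on ballI has_vector_derivative_continuous[OF \<eta>d])
  have \<eta>0: "\<eta> t = 0" "\<eta>' t = 0" if "\<rho> \<le> \<bar>t - t0\<bar>" for t
    using \<beta>(3,4)[OF that] by (auto simp: \<eta>_def \<eta>'_def)
  have \<eta>int: "(\<eta>' has_integral \<eta> t) {0..t}" if "t \<in> {0..T}" for t
    using fundamental_theorem_of_calculus[of 0 t \<eta> \<eta>'] \<eta>d \<eta>0(1)[of 0] \<rho> that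
    by (auto intro: has_vector_derivative_at_within)
  \<comment> \<open>Start of the bump. Before it the path is not perturbed, so every density to be
    solved for vanishes up to \<tau>.\<close>
  define \<tau> where "\<tau> = t0 - \<rho>"
  have \<tau>: "0 < \<tau>" "\<tau> < T" using \<rho> t0 by (auto simp: \<tau>_def)
  obtain C where C: "0 \<le> C"
    "\<And>A f h. (\<And>s r. s \<in> {0..T} \<Longrightarrow> r \<in> {0..T} \<Longrightarrow> norm (f s - f r) \<le> A * sqrt \<bar>s - r\<bar>) \<Longrightarrow>
       (\<And>s. s \<in> {0..\<tau>} \<Longrightarrow> f s = 0) \<Longrightarrow> (\<And>t. t \<in> {0..T} \<Longrightarrow> h t = integral {0..t} f) \<Longrightarrow>
       h \<in> H_space H \<sigma> T \<and> (LINT t:{0..T}|lebesgue. (norm (K_sigma_inv H \<sigma> T h t))\<^sup>2) \<le> C * A\<^sup>2"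
  proof (rule K_sigma_solution[OF H T \<sigma> \<tau>])
    fix C
    assume "0 \<le> C"
      "\<And>A f h. (\<And>s r. s \<in> {0..T} \<Longrightarrow> r \<in> {0..T} \<Longrightarrow> norm (f s - f r) \<le> A * sqrt \<bar>s - r\<bar>) \<Longrightarrow>
         (\<And>s. s \<in> {0..\<tau>} \<Longrightarrow> f s = 0) \<Longrightarrow> (\<And>t. t \<in> {0..T} \<Longrightarrow> h t = integral {0..t} f) \<Longrightarrow>
         h \<in> H_space H \<sigma> T \<and> (LINT t:{0..T}|lebesgue. (norm (K_sigma_inv H \<sigma> T h t))\<^sup>2) \<le> C * A\<^sup>2"
    then show thesis by (rule that)
  qed
  have \<eta>h: "norm (s *\<^sub>R \<eta>' t - s *\<^sub>R \<eta>' r) \<le> s * (E * sqrt T) * sqrt \<bar>t - r\<bar>"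
    if "0 \<le> s" "t \<in> {0..T}" "r \<in> {0..T}" for s t r
  proof -
    have "norm (s *\<^sub>R \<eta>' t - s *\<^sub>R \<eta>' r) = s * norm (\<eta>' t - \<eta>' r)"
      using that(1) by (simp flip: scaleR_diff_right)
    also have "\<dots> \<le> s * (E * (sqrt T * sqrt \<bar>t - r\<bar>))"
      using that E by (intro mult_left_mono order_trans[OF \<eta>l(2)] sqrtT) auto
    finally show ?thesis by (simp add: mult_ac)
  qed
  \<comment> \<open>Kept with the scale s: s = 1 gives admissibility of \<eta>, and general s gives
    the distance from X to the perturbed path.\<close>
  have s\<eta>: "(\<lambda>t. s *\<^sub>R \<eta> t) \<in> H_space H \<sigma> T"
    "(LINT t:{0..T}|lebesgue. (norm (K_sigma_inv H \<sigma> T (\<lambda>t. s *\<^sub>R \<eta> t) t))\<^sup>2) \<le> C * (s * (E * sqrt T))\<^sup>2"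
    if s: "0 \<le> s" for s
  proof -
    have i: "s *\<^sub>R \<eta> t = integral {0..t} (\<lambda>t. s *\<^sub>R \<eta>' t)" if "t \<in> {0..T}" for t
      using integral_unique[OF has_integral_cmul[OF \<eta>int[OF that], of s]] by (rule sym)
    have z: "s *\<^sub>R \<eta>' t = 0" if "t \<in> {0..\<tau>}" for t
      using that by (subst \<eta>0(2)) (auto simp: \<tau>_def)
    show "(\<lambda>t. s *\<^sub>R \<eta> t) \<in> H_space H \<sigma> T"
      "(LINT t:{0..T}|lebesgue. (norm (K_sigma_inv H \<sigma> T (\<lambda>t. s *\<^sub>R \<eta> t) t))\<^sup>2) \<le> C * (s * (E * sqrt T))\<^sup>2"
      using C(2)[OF \<eta>h[OF s] z i] by auto
  qed
  have \<eta>H: "\<eta> \<in> H_space H \<sigma> T" using s\<eta>(1)[of 1] by simp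
  have \<eta>T: "\<eta> T = 0" using \<rho> t0 by (intro \<eta>0) auto
  define I where "I = (LINT t:{0..T}|lebesgue. (\<beta> t)\<^sup>2)"
  have \<beta>c: "continuous_on S \<beta>" for S
    using \<beta>(1) by (auto intro!: continuous_at_imp_continuous_on DERIV_isCont)
  have \<beta>int: "set_integrable lebesgue {0..T} (\<lambda>t. (\<beta> t)\<^sup>2)"
    by (intro absolutely_integrable_continuous_real continuous_intros \<beta>c)
  have I: "0 < I"
  proof -
    have I_eq: "I = integral {0..T} (\<lambda>t. (\<beta> t)\<^sup>2)"
      unfolding I_def by (rule set_lebesgue_integral_eq_integral(2)[OF \<beta>int])
    have "I \<noteq> 0"
    proof
      assume "I = 0"
      then have "((\<lambda>t. (\<beta> t)\<^sup>2) has_integral 0) (cbox 0 T)"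
        using set_lebesgue_integral_eq_integral(1)[OF \<beta>int] I_eq by (metis cbox_interval integrable_integral)
      then have "(\<beta> t0)\<^sup>2 = 0"
        by (intro has_integral_0_cbox_imp_0[of 0 T "\<lambda>t. (\<beta> t)\<^sup>2"]) (use T t0 in \<open>auto intro!: continuous_intros \<beta>c\<close>)
      then show False using \<beta>(2) by simp
    qed
    moreover have "0 \<le> I" unfolding I_eq by (intro Henstock_Kurzweil_Integration.integral_nonneg
      set_lebesgue_integral_eq_integral(1)[OF \<beta>int]) auto
    ultimately show ?thesis by simp
  qed
  \<comment> \<open>Limits the displacement s \<eta> to less than \<delta>/2, the half of \<delta>
    that the motion of X leaves over.\<close>
  define s0 where "s0 = \<delta> / (2 * (E + 1))"
  have s0: "0 < s0" "s0 * E < \<delta> / 2"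
  proof -
    show "0 < s0" using c E by (simp add: s0_def)
    show "s0 * E < \<delta> / 2" using c E by (simp add: s0_def field_simps)
  qed
  \<comment> \<open>Needed at all intermediate displacements r and not only at r = 0, because the
    decrease of the divergence is exact along the segment and not just to second order. Off the
    support of the bump both sides are 0.\<close>
  have neg\<eta>: "btrace (D3 t (X t + r *\<^sub>R \<eta> t) (\<eta> t) (\<eta> t)) \<le> - (c * (\<beta> t)\<^sup>2)"
    if t: "t \<in> {0..T}" and r: "0 \<le> r" "r \<le> s0" for t r
  proof (cases "\<rho> \<le> \<bar>t - t0\<bar>")
    case True
    then show ?thesis by (simp add: \<eta>_def \<beta>(3) btrace_def)
  next
    case False
    have "norm (X t + r *\<^sub>R \<eta> t - X t0) \<le> norm (X t - X t0) + norm (r *\<^sub>R \<eta> t)"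
      using norm_triangle_ineq[of "X t - X t0" "r *\<^sub>R \<eta> t"] by (simp add: algebra_simps)
    also have "norm (X t - X t0) \<le> B4 * \<rho>"
      using False B4 by (intro order_trans[OF Xlip[OF t t0(1)]] mult_left_mono) auto
    also have "norm (r *\<^sub>R \<eta> t) \<le> s0 * E"
      using r \<eta>b[OF t] s0(1) by (auto intro: mult_mono)
    finally have "norm (X t + r *\<^sub>R \<eta> t - X t0) < \<delta>" using \<rho>(5) s0(2) by simp
    with neg[OF t, of "X t + r *\<^sub>R \<eta> t"] False \<rho>(4) have "btrace (D3 t (X t + r *\<^sub>R \<eta> t) v v) \<le> - c" by simp
    then have "(\<beta> t)\<^sup>2 * btrace (D3 t (X t + r *\<^sub>R \<eta> t) v v) \<le> (\<beta> t)\<^sup>2 * (- c)"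
      by (rule mult_left_mono) simp
    then show ?thesis
      unfolding \<eta>_def btrace_quadratic by (simp add: mult.commute)
  qed
  \<comment> \<open>The cost part of the second variation without its factor 1/\<epsilon>: a fixed
    number, of which only nonnegativity enters.\<close>
  define P where "P = (LINT t:{0..T}|lebesgue. (norm (K_sigma_inv H \<sigma> T
      (\<lambda>r. \<eta> r - (LINT s:{0..r}|lebesgue. jacobian (b s) (at (X s)) *v \<eta> s)) t))\<^sup>2)"
  have P0: "0 \<le> P"
    unfolding P_def set_lebesgue_integral_def by (rule Bochner_Integration.integral_nonneg) (auto split: split_indicator)
  have Q: "(LINT t:{0..T}|lebesgue. \<eta> t \<bullet> (hessian (divergence (b t)) (X t) *v \<eta> t)) \<le> - c * I"
  proof -
    have "(LINT t:{0..T}|lebesgue. \<eta> t \<bullet> (hessian (divergence (b t)) (X t) *v \<eta> t)) \<le> (LINT t:{0..T}|lebesgue. - c * (\<beta> t)\<^sup>2)"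
    proof (rule set_integral_mono)
      show "set_integrable lebesgue {0..T} (\<lambda>t. \<eta> t \<bullet> (hessian (divergence (b t)) (X t) *v \<eta> t))"
        by (intro absolutely_integrable_continuous_real hessian_continuous[OF db dD1 dD2 cD3 Xc \<eta>c])
      show "set_integrable lebesgue {0..T} (\<lambda>t. - c * (\<beta> t)\<^sup>2)"
        using \<beta>int by (rule set_integrable_mult_right)
      fix t assume t: "t \<in> {0..T}"
      show "\<eta> t \<bullet> (hessian (divergence (b t)) (X t) *v \<eta> t) \<le> - c * (\<beta> t)\<^sup>2"
      proof -
        have "\<eta> t \<bullet> (hessian (divergence (b t)) (X t) *v \<eta> t) = btrace (D3 t (X t) (\<eta> t) (\<eta> t))"
          by (rule hessian_divergence[OF db dD1 dD2 t])
        then show ?thesis using neg\<eta>[OF t, of 0] s0(1) by simp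
      qed
    qed
    also have "\<dots> = - c * I" unfolding I_def by (rule set_integral_mult_right)
    finally show ?thesis .
  qed
  \<comment> \<open>\<open>s * A\<close> is the Hoelder constant of the residual of X + s \<eta>:
    the first summand belongs to \<eta>', the second to the drift increment.\<close>
  define A where "A = E * sqrt T + B * E * (B4 * sqrt T + sqrt T + 4)"
  \<comment> \<open>Two thresholds at once. The second variation is negative for \<epsilon> > 2 P /
    (d_H c I), and J decreases for \<epsilon> > 2 C A^2 / (d_H c I); the sum exceeds both, and 1
    makes it positive.\<close>
  define \<epsilon>0 where "\<epsilon>0 = 2 * (P + C * A\<^sup>2) / (d_H H * (c * I)) + 1"
  have d: "0 < d_H H" by (rule d_H_pos[OF H])
  have \<epsilon>0: "0 < \<epsilon>0" using P0 C(1) d c I by (simp add: \<epsilon>0_def add_nonneg_pos)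
  define \<phi> where "\<phi> = (\<lambda>s t. X t + s *\<^sub>R \<eta> t)"
  have \<phi>c: "continuous_on {0..T} (\<phi> s)" for s
    unfolding \<phi>_def by (intro continuous_intros Xc \<eta>c)
  have drift: "set_integrable lebesgue {0..r} (\<lambda>u. b u (Y u))" "(LINT u:{0..r}|lebesgue. b u (Y u)) = integral {0..r} (\<lambda>u. b u (Y u))"
    if "r \<in> {0..T}" "continuous_on {0..T} Y" for r Y
  proof -
    show "set_integrable lebesgue {0..r} (\<lambda>u. b u (Y u))"
      using that by (intro absolutely_integrable_continuous_real
        continuous_on_subset[OF continuous_on_strip_compose[OF cb that(2)]]) auto
    then show "(LINT u:{0..r}|lebesgue. b u (Y u)) = integral {0..r} (\<lambda>u. b u (Y u))"
      by (rule set_lebesgue_integral_eq_integral(2))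
  qed
  have control: "(LINT t:{0..T}|lebesgue. (norm (K_sigma_inv H \<sigma> T
        (\<lambda>r. \<phi> s r - x0 - (LINT u:{0..r}|lebesgue. b u (\<phi> s u))) t))\<^sup>2) \<le> C * (s * A)\<^sup>2"
    if s: "0 \<le> s" for s
  proof -
    \<comment> \<open>As X solves the equation, X' = b(X) cancels from the residual; what is left
      vanishes wherever the bump does.\<close>
    let ?f = "\<lambda>t. s *\<^sub>R \<eta>' t - (b t (\<phi> s t) - b t (X t))"
    have h1: "norm (?f t - ?f r) \<le> s * A * sqrt \<bar>t - r\<bar>" if tr: "t \<in> {0..T}" "r \<in> {0..T}" for t r
    proof -
      have "norm (?f t - ?f r) \<le> norm (s *\<^sub>R \<eta>' t - s *\<^sub>R \<eta>' r)
          + norm ((b t (\<phi> s t) - b t (X t)) - (b r (\<phi> s r) - b r (X r)))"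
        by (rule order_trans[OF _ norm_triangle_ineq4]) (simp add: algebra_simps)
      also have "\<dots> \<le> s * (E * sqrt T) * sqrt \<bar>t - r\<bar> + s * (B * E * (B4 * sqrt T + sqrt T + 4)) * sqrt \<bar>t - r\<bar>"
        unfolding \<phi>_def
        by (intro add_mono \<eta>h s tr drift_increment_holder[OF db dD1 bt(2) B T Xlip \<eta>b \<eta>l(1)])
      also have "\<dots> = s * A * sqrt \<bar>t - r\<bar>" by (simp add: A_def algebra_simps)
      finally show ?thesis .
    qed
    have h2: "?f t = 0" if "t \<in> {0..\<tau>}" for t
    proof -
      have "\<rho> \<le> \<bar>t - t0\<bar>" using that by (auto simp: \<tau>_def)
      from \<eta>0[OF this] show ?thesis by (simp add: \<phi>_def)
    qed
    have h3: "\<phi> s r - x0 - (LINT u:{0..r}|lebesgue. b u (\<phi> s u)) = integral {0..r} ?f" if r: "r \<in> {0..T}" for r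
    proof -
      have "((\<lambda>u. b u (X u)) has_integral X r - X 0) {0..r}"
        using r by (intro fundamental_theorem_of_calculus) (auto intro: has_vector_derivative_within_subset[OF X'])
      moreover have "((\<lambda>u. b u (\<phi> s u)) has_integral integral {0..r} (\<lambda>u. b u (\<phi> s u))) {0..r}"
        using set_lebesgue_integral_eq_integral(1)[OF drift(1)[OF r \<phi>c[of s]]] by (rule integrable_integral)
      ultimately have "(?f has_integral (s *\<^sub>R \<eta> r - (integral {0..r} (\<lambda>u. b u (\<phi> s u)) - (X r - X 0)))) {0..r}"
        by (intro has_integral_diff has_integral_cmul \<eta>int r)
      then show ?thesis
        unfolding drift(2)[OF r \<phi>c[of s]] assms(6)[symmetric]
        by (subst integral_unique[of ?f], assumption) (simp add: \<phi>_def)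
    qed
    show ?thesis using C(2)[OF h1 h2 h3] by auto
  qed
  have J: "J_fun H \<sigma> T b x0 \<epsilon> (\<phi> s) < J_fun H \<sigma> T b x0 \<epsilon> X"
    if s: "0 < s" "s \<le> s0" and \<epsilon>: "\<epsilon> > \<epsilon>0" for s \<epsilon>
  proof -
    let ?dX = "LINT t:{0..T}|lebesgue. divergence (b t) (X t)"
    have \<epsilon>p: "0 < \<epsilon>" using \<epsilon> \<epsilon>0 by simp
    have int: "set_integrable lebesgue {0..T} (\<lambda>t. divergence (b t) (Y t))" if "continuous_on {0..T} Y" for Y
      by (intro absolutely_integrable_continuous_real divergence_continuous[OF db dD1 dD2 cD1 that])
    have int2: "set_integrable lebesgue {0..T} (\<lambda>t. (c * s\<^sup>2 / 2) * (\<beta> t)\<^sup>2)"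
      using \<beta>int by (rule set_integrable_mult_right)
    have "(LINT t:{0..T}|lebesgue. divergence (b t) (\<phi> s t))
        \<le> (LINT t:{0..T}|lebesgue. divergence (b t) (X t) - (c * s\<^sup>2 / 2) * (\<beta> t)\<^sup>2)"
    proof (rule set_integral_mono)
      show "set_integrable lebesgue {0..T} (\<lambda>t. divergence (b t) (X t) - (c * s\<^sup>2 / 2) * (\<beta> t)\<^sup>2)"
        by (rule set_integral_diff(1)[OF int[OF Xc] int2])
      fix t assume t: "t \<in> {0..T}"
      show "divergence (b t) (\<phi> s t) \<le> divergence (b t) (X t) - (c * s\<^sup>2 / 2) * (\<beta> t)\<^sup>2"
        using divergence_decrease[where b = b and T = T and t = t and x = "X t" and s = s and h = "\<eta> t" and c = "c * (\<beta> t)\<^sup>2",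
            OF db dD1 dD2 t crit[OF t]] neg\<eta>[OF t] s
        by (simp add: \<phi>_def mult_ac)
    qed (rule int[OF \<phi>c])
    also have "\<dots> = ?dX - (c * s\<^sup>2 / 2) * I"
      unfolding I_def using set_integral_diff(2)[OF int[OF Xc] int2] by simp
    finally have "d_H H / 2 * (LINT t:{0..T}|lebesgue. divergence (b t) (\<phi> s t)) \<le> d_H H / 2 * (?dX - (c * s\<^sup>2 / 2) * I)"
      using d by (intro mult_left_mono) auto
    moreover have "1 / (2 * \<epsilon>) * (LINT t:{0..T}|lebesgue. (norm (K_sigma_inv H \<sigma> T
        (\<lambda>r. \<phi> s r - x0 - (LINT u:{0..r}|lebesgue. b u (\<phi> s u))) t))\<^sup>2) \<le> 1 / (2 * \<epsilon>) * (C * (s * A)\<^sup>2)"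
      using control[of s] s \<epsilon>p by (intro mult_left_mono) auto
    moreover have "1 / (2 * \<epsilon>) * (C * (s * A)\<^sup>2) < d_H H / 2 * ((c * s\<^sup>2 / 2) * I)"
    proof -
      have "2 * (C * A\<^sup>2) / (d_H H * (c * I)) \<le> 2 * (P + C * A\<^sup>2) / (d_H H * (c * I))"
        using P0 d c I by (intro divide_right_mono) auto
      then have "2 * (C * A\<^sup>2) / (d_H H * (c * I)) < \<epsilon>" using \<epsilon> by (simp add: \<epsilon>0_def)
      then have "2 * (C * A\<^sup>2) < \<epsilon> * (d_H H * (c * I))" using d c I by (simp add: divide_less_eq)
      then have "s\<^sup>2 * (2 * (C * A\<^sup>2)) < s\<^sup>2 * (\<epsilon> * (d_H H * (c * I)))" using s by (intro mult_strict_left_mono) auto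
      then show ?thesis using \<epsilon>p by (simp add: field_simps power_mult_distrib)
    qed
    \<comment> \<open>The cost of X itself may be bounded below by 0, since it stands on the larger
      side.\<close>
    moreover have "0 \<le> 1 / (2 * \<epsilon>) * (LINT t:{0..T}|lebesgue. (norm (K_sigma_inv H \<sigma> T
        (\<lambda>r. X r - x0 - (LINT u:{0..r}|lebesgue. b u (X u))) t))\<^sup>2)"
      using \<epsilon>p unfolding set_lebesgue_integral_def
      by (intro mult_nonneg_nonneg Bochner_Integration.integral_nonneg) (auto split: split_indicator)
    ultimately show ?thesis
      unfolding J_fun_def right_diff_distrib by linarith
  qed
  \<comment> \<open>S is either path space. A minimizer belongs to S by definition, so it suffices
    that S is stable under the perturbation once it contains X; otherwise there is nothing to
    refute.\<close>
  have not_min: "\<not> local_minimizer (H_norm H \<sigma> T) S (J_fun H \<sigma> T b x0 \<epsilon>) X"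
    if \<epsilon>: "\<epsilon> > \<epsilon>0" and S: "X \<in> S \<Longrightarrow> (\<And>s. 0 \<le> s \<Longrightarrow> \<phi> s \<in> S)" for S \<epsilon>
  proof
    assume "local_minimizer (H_norm H \<sigma> T) S (J_fun H \<sigma> T b x0 \<epsilon>) X"
    then obtain d where XS: "X \<in> S" and dd: "d > 0"
      "\<And>\<psi>. \<psi> \<in> S \<Longrightarrow> H_norm H \<sigma> T (\<lambda>t. \<psi> t - X t) < d \<Longrightarrow> J_fun H \<sigma> T b x0 \<epsilon> X \<le> J_fun H \<sigma> T b x0 \<epsilon> \<psi>"
      by (auto simp: local_minimizer_def)
    \<comment> \<open>\<open>s * K\<close> bounds the Cameron-Martin norm of s \<eta>; the summand 1
      permits division by \<open>K\<close>.\<close>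
    define K where "K = sqrt C * (E * sqrt T) + 1"
    have K: "0 < K" using C(1) E T by (simp add: K_def add_nonneg_pos)
    define s where "s = min s0 (d / (2 * K))"
    have s: "0 < s" "s \<le> s0" using s0 dd K by (auto simp: s_def)
    have "H_norm H \<sigma> T (\<lambda>t. \<phi> s t - X t) \<le> sqrt (C * (s * (E * sqrt T))\<^sup>2)"
      using s\<eta>(2)[of s] s by (simp add: H_norm_def L2_norm_def \<phi>_def)
    also have "\<dots> = s * (sqrt C * (E * sqrt T))"
      using s E T by (simp add: real_sqrt_mult)
    also have "\<dots> \<le> s * K" using s by (intro mult_left_mono) (auto simp: K_def)
    also have "\<dots> \<le> (d / (2 * K)) * K" using K by (intro mult_right_mono) (auto simp: s_def)
    also have "\<dots> < d" using K dd by simp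
    finally have "J_fun H \<sigma> T b x0 \<epsilon> X \<le> J_fun H \<sigma> T b x0 \<epsilon> (\<phi> s)"
      using S[OF XS, of s] s by (intro dd(2)) auto
    with J[OF s \<epsilon>] show False by simp
  qed
  have free: "\<phi> s \<in> free_paths H \<sigma> T x0" if "X \<in> free_paths H \<sigma> T x0" "0 \<le> s" for s
  proof -
    have "(\<lambda>t. (X t - x0) + s *\<^sub>R \<eta> t) \<in> H_space H \<sigma> T"
      using that(1) by (intro H_space_add[OF H T \<sigma>] s\<eta>(1) that(2)) (auto simp: free_paths_def)
    then show ?thesis by (simp add: free_paths_def \<phi>_def diff_add_eq)
  qed
  show ?thesis
  proof (intro exI[of _ \<epsilon>0] conjI allI impI \<epsilon>0)
    fix \<epsilon> assume \<epsilon>: "\<epsilon> > \<epsilon>0"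
    have \<epsilon>p: "0 < \<epsilon>" using \<epsilon> \<epsilon>0 by simp
    have sv: "second_variation H \<sigma> T b \<epsilon> X \<eta> < 0"
    proof -
      have "second_variation H \<sigma> T b \<epsilon> X \<eta> \<le> 1 / \<epsilon> * P + d_H H / 2 * (- c * I)"
        unfolding second_variation_def P_def[symmetric] using Q d by (intro add_left_mono mult_left_mono) auto
      moreover have "1 / \<epsilon> * P < d_H H / 2 * (c * I)"
      proof -
        have "2 * P / (d_H H * (c * I)) \<le> 2 * (P + C * A\<^sup>2) / (d_H H * (c * I))"
          using C(1) d c I by (intro divide_right_mono) auto
        then have "2 * P / (d_H H * (c * I)) < \<epsilon>" using \<epsilon> by (simp add: \<epsilon>0_def)
        then have "2 * P < \<epsilon> * (d_H H * (c * I))" using d c I by (simp add: divide_less_eq)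
        then show ?thesis using \<epsilon>p by (simp add: field_simps)
      qed
      moreover have "d_H H / 2 * (- c * I) = - (d_H H / 2 * (c * I))" by simp
      ultimately show ?thesis by linarith
    qed
    show "\<exists>\<eta>\<in>free_perturbations H \<sigma> T. second_variation H \<sigma> T b \<epsilon> X \<eta> < 0"
      using sv \<eta>H by (auto simp: free_perturbations_def)
    show "\<exists>\<eta>\<in>fixed_perturbations H \<sigma> T. second_variation H \<sigma> T b \<epsilon> X \<eta> < 0"
      using sv \<eta>H \<eta>T by (auto simp: fixed_perturbations_def)
    show "\<not> local_most_probable_transition_path H \<sigma> T b x0 xT \<epsilon> X"
      unfolding local_most_probable_transition_path_def
      by (rule not_min[OF \<epsilon>]) (use free \<eta>T assms(7) in \<open>auto simp: fixed_paths_def \<phi>_def\<close>)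
    show "\<not> local_most_probable_evolution_path H \<sigma> T b x0 \<epsilon> X"
      unfolding local_most_probable_evolution_path_def
      by (rule not_min[OF \<epsilon>]) (use free in auto)
  qed
qed

end
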